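(* Let $K$ be a local field with finite residue field of characteristic $p$ and cardinality $q$, let $e>0$ be an integer with $e\not\equiv 0\pmod p$, and let $f>0$ be an integer. For every $m>0$ let $K_m$ be the unramified extension of $K$ of degree $m$, $k_m$ its residue field, and $G_m=\mathrm{Gal}(K_m|K)$. Let $L$ be a finite separable extension of $K$ of ramification index $e$ and residual degree $f$ (so that $L\supset K_f$), and let $\tilde L$ be the Galois closure of $L$ over $K$. (a) Let $r$ be the order of $q^f$ in $(\mathbf Z/e\mathbf Z)^\times$. Then $K_{rf}\subset\tilde L$. (b) Suppose that $q^f\equiv1\pmod e$. Let $D\subset K_f^\times/K_f^{\times e}$ be a ramified line representing the $G_f$-orbit corresponding to $L$, let $\pi$ be a uniformiser of $K$, and let $\xi\in k_f^\times$ be such that $D$ is generated by the image of $\xi\pi$ (so that $L=K_f(\sqrt[e]{\xi\pi})$). Let $d$ be the order of $\bar\xi^{\,q-1}$ in $k_f^\times/k_f^{\times e}$. Then $d$ depends only on $L$, not on the choices of $D$ and $\pi$, and $\tilde L=K_{df}(\sqrt[e]{\xi\pi})$. In particular, the ramification index of $\tilde L$ over $K$ is $e$.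
   Context: A local field is a field complete for a discrete valuation with finite residue field. Elements of $k_f^\times$ are identified with their Teichmüller lifts in $K_f^\times$. Let $\bar w_f:K_f^\times/K_f^{\times e}\to\mathbf Z/e\mathbf Z$ be induced by the normalised valuation of $K_f$. A ramified line is a subgroup $D\subset K_f^\times/K_f^{\times e}$ on which $\bar w_f$ restricts to an isomorphism $D\to\mathbf Z/e\mathbf Z$; it is generated by the image of a uniformiser $\varpi$ of $K_f$ and one puts $K_f(\sqrt[e]{D})=K_f(\sqrt[e]{\varpi})$. The map sending the $G_f$-orbit of $D$ to the $K$-isomorphism class of $K_f(\sqrt[e]{D})$ is a bijection from the set of $G_f$-orbits of ramified lines to the set of $K$-isomorphism classes of finite separable extensions of $K$ of ramification index $e$ and residual degree $f$; the orbit corresponding to $L$ is the one given by this bijection. *)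

theory Defs
  imports
    "HOL-Algebra.Algebra"
    "HOL-Algebra.Algebraic_Closure"
    "HOL-Number_Theory.Number_Theory"
begin

section \<open>Discretely valued fields and local fields\<close>

text \<open>Valuations are integer-valued; the value at zero (conventionally infinite) is left
  unconstrained and never used.\<close>

locale normalised_valuation = field F for F (structure) +
  fixes v :: "'a \<Rightarrow> int"
  assumes val_mult: "\<lbrakk> x \<in> carrier F - {\<zero>}; y \<in> carrier F - {\<zero>} \<rbrakk> \<Longrightarrow> v (x \<otimes> y) = v x + v y"
    and val_add: "\<lbrakk> x \<in> carrier F - {\<zero>}; y \<in> carrier F - {\<zero>}; x \<oplus> y \<noteq> \<zero> \<rbrakk>
      \<Longrightarrow> min (v x) (v y) \<le> v (x \<oplus> y)"
    and val_surj: "v ` (carrier F - {\<zero>}) = UNIV"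

definition valuation_ring :: "('a, 'b) ring_scheme \<Rightarrow> ('a \<Rightarrow> int) \<Rightarrow> ('a, 'b) ring_scheme" where
  "valuation_ring F v = F\<lparr>carrier := {x \<in> carrier F. x \<noteq> \<zero>\<^bsub>F\<^esub> \<longrightarrow> 0 \<le> v x}\<rparr>"

definition valuation_ideal :: "('a, 'b) ring_scheme \<Rightarrow> ('a \<Rightarrow> int) \<Rightarrow> 'a set" where
  "valuation_ideal F v = {x \<in> carrier F. x \<noteq> \<zero>\<^bsub>F\<^esub> \<longrightarrow> 0 < v x}"

definition residue_field :: "('a, 'b) ring_scheme \<Rightarrow> ('a \<Rightarrow> int) \<Rightarrow> 'a set ring" where
  "residue_field F v = valuation_ring F v Quot valuation_ideal F v"

definition residue_char :: "('a, 'b) ring_scheme \<Rightarrow> ('a \<Rightarrow> int) \<Rightarrow> nat" where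
  "residue_char F v = group.ord (add_monoid (residue_field F v)) \<one>\<^bsub>residue_field F v\<^esub>"

definition val_close :: "('a, 'b) ring_scheme \<Rightarrow> ('a \<Rightarrow> int) \<Rightarrow> int \<Rightarrow> 'a \<Rightarrow> 'a \<Rightarrow> bool" where
  "val_close F v N x y \<longleftrightarrow> x = y \<or> N \<le> v (x \<ominus>\<^bsub>F\<^esub> y)"

locale local_field = normalised_valuation +
  assumes complete:
    "\<lbrakk> \<And>n::nat. s n \<in> carrier F; \<forall>N. \<exists>M. \<forall>m\<ge>M. \<forall>n\<ge>M. val_close F v N (s m) (s n) \<rbrakk>
      \<Longrightarrow> \<exists>l\<in>carrier F. \<forall>N. \<exists>M. \<forall>n\<ge>M. val_close F v N (s n) l"
    and finite_residue_field: "finite (carrier (residue_field F v))"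

definition uniformiser :: "('a, 'b) ring_scheme \<Rightarrow> ('a \<Rightarrow> int) \<Rightarrow> 'a \<Rightarrow> bool" where
  "uniformiser F v x \<longleftrightarrow> x \<in> carrier F - {\<zero>\<^bsub>F\<^esub>} \<and> v x = 1"

text \<open>Residue classes are cosets, that is, sets of integers of the valued field. The Teichmueller
  lift of a class is its unique member fixed by raising to the cardinality of the residue field.\<close>

definition teichmuller :: "('a, 'b) ring_scheme \<Rightarrow> ('a \<Rightarrow> int) \<Rightarrow> 'a set \<Rightarrow> 'a" where
  "teichmuller F v \<xi> =
    (THE x. x \<in> \<xi> \<and> x [^]\<^bsub>F\<^esub> card (carrier (residue_field F v)) = x)"


section \<open>Extensions of a valued field inside a fixed algebraic closure\<close>

text \<open>In the rest of the theory \<open>\<Omega>\<close> is an algebraic closure of \<open>K\<close>, and extensions of \<open>K\<close> are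
  subfields of \<open>\<Omega>\<close>, given by their carrier sets.\<close>

definition finite_subextension :: "('a, 'b) ring_scheme \<Rightarrow> 'a set \<Rightarrow> 'a set \<Rightarrow> bool" where
  "finite_subextension \<Omega> K L \<longleftrightarrow>
    subfield L \<Omega> \<and> K \<subseteq> L \<and> ring.finite_dimension \<Omega> K L"

text \<open>Separability is absence of multiple roots in the algebraic closure.\<close>

definition separable_subextension :: "('a, 'b) ring_scheme \<Rightarrow> 'a set \<Rightarrow> 'a set \<Rightarrow> bool" where
  "separable_subextension \<Omega> K L \<longleftrightarrow>
    (\<forall>x\<in>L. \<forall>a\<in>carrier \<Omega>. ring.alg_mult \<Omega> (ring.Irr \<Omega> K x) a \<le> 1)"

text \<open>As \<open>\<Omega>\<close> is algebraically closed, a polynomial splits over \<open>L\<close> if and only if all its roots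
  lie in \<open>L\<close>. (The library's \<open>splitted_on\<close> is unsuitable for infinite \<open>L\<close>: it uses \<open>mset_set L\<close>,
  which is then empty.)\<close>

definition normal_subextension :: "('a, 'b) ring_scheme \<Rightarrow> 'a set \<Rightarrow> 'a set \<Rightarrow> bool" where
  "normal_subextension \<Omega> K L \<longleftrightarrow>
    (\<forall>x\<in>L. \<forall>a. ring.is_root \<Omega> (ring.Irr \<Omega> K x) a \<longrightarrow> a \<in> L)"

definition galois_subextension :: "('a, 'b) ring_scheme \<Rightarrow> 'a set \<Rightarrow> 'a set \<Rightarrow> bool" where
  "galois_subextension \<Omega> K L \<longleftrightarrow>
    subfield L \<Omega> \<and> K \<subseteq> L \<and> separable_subextension \<Omega> K L \<and> normal_subextension \<Omega> K L"

definition galois_closure :: "('a, 'b) ring_scheme \<Rightarrow> 'a set \<Rightarrow> 'a set \<Rightarrow> 'a set" where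
  "galois_closure \<Omega> K L = \<Inter>{E. galois_subextension \<Omega> K E \<and> L \<subseteq> E}"

text \<open>Maps on a subfield are total functions on the ambient type; only their values on the
  subfield matter.\<close>

definition galois_group :: "('a, 'b) ring_scheme \<Rightarrow> 'a set \<Rightarrow> 'a set \<Rightarrow> ('a \<Rightarrow> 'a) set" where
  "galois_group \<Omega> K E =
    {\<sigma> \<in> ring_iso (\<Omega>\<lparr>carrier := E\<rparr>) (\<Omega>\<lparr>carrier := E\<rparr>). \<forall>x\<in>K. \<sigma> x = x}"

definition isomorphic_over :: "('a, 'b) ring_scheme \<Rightarrow> 'a set \<Rightarrow> 'a set \<Rightarrow> 'a set \<Rightarrow> bool" where
  "isomorphic_over \<Omega> K E E' \<longleftrightarrow>
    (\<exists>\<phi> \<in> ring_iso (\<Omega>\<lparr>carrier := E\<rparr>) (\<Omega>\<lparr>carrier := E'\<rparr>). \<forall>x\<in>K. \<phi> x = x)"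

definition adjoin :: "('a, 'b) ring_scheme \<Rightarrow> 'a set \<Rightarrow> 'a \<Rightarrow> 'a set" where
  "adjoin \<Omega> F a = generate_field \<Omega> (insert a F)"

text \<open>\<open>valuation_extends \<Omega> K v L w e\<close>: \<open>w\<close> is the normalised valuation of \<open>L\<close> belonging to the
  extension of \<open>v\<close>, and \<open>e\<close> is the index of the value group of \<open>v\<close> in that of its extension.\<close>

definition valuation_extends ::
  "('a, 'b) ring_scheme \<Rightarrow> 'a set \<Rightarrow> ('a \<Rightarrow> int) \<Rightarrow> 'a set \<Rightarrow> ('a \<Rightarrow> int) \<Rightarrow> nat \<Rightarrow> bool" where
  "valuation_extends \<Omega> K v L w e \<longleftrightarrow>
    normalised_valuation (\<Omega>\<lparr>carrier := L\<rparr>) w \<and> 0 < e \<and>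
    (\<forall>x \<in> K - {\<zero>\<^bsub>\<Omega>\<^esub>}. w x = int e * v x)"

text \<open>For complete \<open>v\<close> and finite \<open>L\<close> over \<open>K\<close> the valuation \<open>w\<close> below exists and is unique on
  nonzero elements.\<close>

definition has_ramification_index ::
  "('a, 'b) ring_scheme \<Rightarrow> 'a set \<Rightarrow> ('a \<Rightarrow> int) \<Rightarrow> 'a set \<Rightarrow> nat \<Rightarrow> bool" where
  "has_ramification_index \<Omega> K v L e \<longleftrightarrow>
    finite_subextension \<Omega> K L \<and> (\<exists>w. valuation_extends \<Omega> K v L w e)"

text \<open>The residue field of \<open>K\<close> is not a subset of that of \<open>L\<close>; the degree is taken over its image.\<close>

definition has_residual_degree ::
  "('a, 'b) ring_scheme \<Rightarrow> 'a set \<Rightarrow> ('a \<Rightarrow> int) \<Rightarrow> 'a set \<Rightarrow> ('a \<Rightarrow> int) \<Rightarrow> nat \<Rightarrow> bool" where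
  "has_residual_degree \<Omega> K v L w f \<longleftrightarrow>
    (let OK = valuation_ring (\<Omega>\<lparr>carrier := K\<rparr>) v;
         OL = valuation_ring (\<Omega>\<lparr>carrier := L\<rparr>) w;
         l = residue_field (\<Omega>\<lparr>carrier := L\<rparr>) w
     in ring.dimension l f
          ((\<lambda>x. valuation_ideal (\<Omega>\<lparr>carrier := L\<rparr>) w +>\<^bsub>OL\<^esub> x) ` carrier OK) (carrier l))"

text \<open>Residue fields are finite here, so residual separability is automatic.\<close>

definition unramified_extension ::
  "('a, 'b) ring_scheme \<Rightarrow> 'a set \<Rightarrow> ('a \<Rightarrow> int) \<Rightarrow> nat \<Rightarrow> 'a set \<Rightarrow> bool" where
  "unramified_extension \<Omega> K v m E \<longleftrightarrow>
    has_ramification_index \<Omega> K v E 1 \<and> ring.dimension \<Omega> m K E"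


section \<open>Ramified lines\<close>

definition powers :: "('a, 'b) monoid_scheme \<Rightarrow> nat \<Rightarrow> 'a set" where
  "powers G e = (\<lambda>x. x [^]\<^bsub>G\<^esub> e) ` carrier G"

definition power_quotient :: "('a, 'b) monoid_scheme \<Rightarrow> nat \<Rightarrow> 'a set monoid" where
  "power_quotient G e = G Mod powers G e"

definition power_class :: "('a, 'b) monoid_scheme \<Rightarrow> nat \<Rightarrow> 'a \<Rightarrow> 'a set" where
  "power_class G e x = powers G e #>\<^bsub>G\<^esub> x"

text \<open>The map induced by \<open>w\<close> on classes modulo \<open>e\<close>-th powers; \<open>w\<close> is constant modulo \<open>e\<close> on each
  class.\<close>

definition induced_val :: "('a \<Rightarrow> int) \<Rightarrow> nat \<Rightarrow> 'a set \<Rightarrow> int" where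
  "induced_val w e C = the_elem ((\<lambda>x. w x mod int e) ` C)"

definition ramified_line ::
  "('a, 'b) ring_scheme \<Rightarrow> ('a \<Rightarrow> int) \<Rightarrow> nat \<Rightarrow> 'a set set \<Rightarrow> bool" where
  "ramified_line F w e D \<longleftrightarrow>
    subgroup D (power_quotient (mult_of F) e) \<and>
    induced_val w e \<in>
      iso ((power_quotient (mult_of F) e)\<lparr>carrier := D\<rparr>) (integer_mod_group e)"

definition generated_by_class :: "('a, 'b) ring_scheme \<Rightarrow> nat \<Rightarrow> 'a set set \<Rightarrow> 'a \<Rightarrow> bool" where
  "generated_by_class F e D x \<longleftrightarrow>
    D = generate (power_quotient (mult_of F) e) {power_class (mult_of F) e x}"

definition line_orbit ::
  "('a, 'b) ring_scheme \<Rightarrow> 'a set \<Rightarrow> 'a set \<Rightarrow> 'a set set \<Rightarrow> 'a set set set" where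
  "line_orbit \<Omega> K F D = {((`) \<sigma>) ` D | \<sigma>. \<sigma> \<in> galois_group \<Omega> K F}"

text \<open>\<open>E\<close> is one of the (\<open>F\<close>-isomorphic) subfields of \<open>\<Omega>\<close> obtained from \<open>F\<close> by adjoining an
  \<open>e\<close>-th root of a uniformiser whose class generates \<open>D\<close>.\<close>

definition line_root_field ::
  "('a, 'b) ring_scheme \<Rightarrow> 'a set \<Rightarrow> ('a \<Rightarrow> int) \<Rightarrow> nat \<Rightarrow> 'a set set \<Rightarrow> 'a set \<Rightarrow> bool" where
  "line_root_field \<Omega> F w e D E \<longleftrightarrow>
    (\<exists>\<pi> \<alpha>. uniformiser (\<Omega>\<lparr>carrier := F\<rparr>) w \<pi> \<and>
       generated_by_class (\<Omega>\<lparr>carrier := F\<rparr>) e D \<pi> \<and>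
       \<alpha> \<in> carrier \<Omega> \<and> \<alpha> [^]\<^bsub>\<Omega>\<^esub> e = \<pi> \<and> E = adjoin \<Omega> F \<alpha>)"

text \<open>The orbit of \<open>D\<close> corresponds to the \<open>K\<close>-isomorphism class of \<open>L\<close>. All members of an orbit
  yield the same class, so one member suffices.\<close>

definition represents_orbit_of ::
  "('a, 'b) ring_scheme \<Rightarrow> 'a set \<Rightarrow> 'a set \<Rightarrow> ('a \<Rightarrow> int) \<Rightarrow> nat \<Rightarrow> 'a set set \<Rightarrow> 'a set \<Rightarrow> bool"
  where
  "represents_orbit_of \<Omega> K F w e D L \<longleftrightarrow>
    ramified_line (\<Omega>\<lparr>carrier := F\<rparr>) w e D \<and>
    (\<exists>D' \<in> line_orbit \<Omega> K F D. \<exists>E. line_root_field \<Omega> F w e D' E \<and> isomorphic_over \<Omega> K E L)"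

definition twisted_uniformiser ::
  "('a, 'b) ring_scheme \<Rightarrow> 'a set \<Rightarrow> ('a \<Rightarrow> int) \<Rightarrow> 'a set \<Rightarrow> 'a \<Rightarrow> 'a" where
  "twisted_uniformiser \<Omega> F w \<xi> \<pi> = teichmuller (\<Omega>\<lparr>carrier := F\<rparr>) w \<xi> \<otimes>\<^bsub>\<Omega>\<^esub> \<pi>"

definition admissible_choice ::
  "('a, 'b) ring_scheme \<Rightarrow> 'a set \<Rightarrow> ('a \<Rightarrow> int) \<Rightarrow> 'a set \<Rightarrow> ('a \<Rightarrow> int) \<Rightarrow> nat \<Rightarrow> 'a set \<Rightarrow>
    'a set set \<Rightarrow> 'a \<Rightarrow> 'a set \<Rightarrow> bool" where
  "admissible_choice \<Omega> K v F w e L D \<pi> \<xi> \<longleftrightarrow>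
    represents_orbit_of \<Omega> K F w e D L \<and>
    uniformiser (\<Omega>\<lparr>carrier := K\<rparr>) v \<pi> \<and>
    \<xi> \<in> carrier (mult_of (residue_field (\<Omega>\<lparr>carrier := F\<rparr>) w)) \<and>
    generated_by_class (\<Omega>\<lparr>carrier := F\<rparr>) e D (twisted_uniformiser \<Omega> F w \<xi> \<pi>)"

text \<open>The order of the \<open>n\<close>-th power of the class of \<open>\<xi>\<close> in the group of units of \<open>k\<close> modulo
  \<open>e\<close>-th powers.\<close>

definition class_power_order :: "('a, 'b) ring_scheme \<Rightarrow> nat \<Rightarrow> nat \<Rightarrow> 'a \<Rightarrow> nat" where
  "class_power_order k e n \<xi> =
    (let Q = power_quotient (mult_of k) e
     in group.ord Q (power_class (mult_of k) e \<xi> [^]\<^bsub>Q\<^esub> n))"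

end

(*
Write a = xi pi. Counting valuations and residues, the tame extension L is K_f(alpha) with
alpha^e = a for some root of unity xi of order dividing q^f - 1: the one-units of L are
e-divisible, so a uniformiser of L can be corrected until its e-th power is xi pi.

(a) A normal extension containing alpha contains the roots of X^e - a, hence a primitive e-th
root of unity zeta. Together with a generator of the roots of unity of K_f, zeta generates
K_{rf}, because e divides q^(fi) - 1 exactly when r divides i.

(b) Now K_f contains the e-th roots of unity. A conjugate of alpha over K lying above the
Frobenius automorphism is rho alpha with rho^e = xi^(q-1), so the Galois closure contains rho, and
the field generated by rho over K_f is K_{df}, since
rho^(q^(fi) - 1) = xi^((q-1) (q^(fi)-1)/e) is 1 exactly when d divides i. Conversely
M = K_{df}(alpha) is Galois: an element fixed by alpha -> zeta alpha lies in K_{df}, and an element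
of K_{df} fixed by the extension of Frobenius lies in K. Finally [M : K] = d f e, which depends on L
only and therefore determines d.
*)
theory Submission imports Defs
begin

text \<open>The hypotheses say little about the fields K_m: they have index 1 and degree m over K,
  and nothing is given about their residue fields, roots of unity or automorphisms. All of that has
  to be recovered. Independent residues lift to independent elements, which bounds the residue
  degree, and successive approximation shows that a lifted basis spans. Completeness of an extension
  is inherited from K by controlling rates of convergence one coordinate at a time. Roots of unity
  are Teichmueller representatives; their conjugates over K are found by counting roots of reduced
  polynomials, and this yields the Frobenius automorphism. There is no appeal to Hensel's lemma:
  Teichmueller lifts and e-th roots of one-units are limits of explicit powers. Nor is there a norm:
  the valuation of K_n(alpha) is the order of divisibility by alpha in O[alpha], where O is the ring
  of integers of K_n. Conjugates are handled through embeddings of subfields into \<Omega>, and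
  irreducibility of X^e - a is read off from valuations.\<close>

lemma (in domain) pow_non_zero:
  "x \<in> carrier R \<Longrightarrow> x \<noteq> \<zero> \<Longrightarrow> x [^] (n::nat) \<noteq> \<zero>"
  by (induction n) (auto simp: integral_iff)

text \<open>The fractional ideal of level \<open>n\<close>. Zero belongs to it whatever value
  \<open>v\<close> takes there, so congruences become memberships of differences and most case
  distinctions on zero disappear.\<close>

definition vball :: "('a, 'b) ring_scheme \<Rightarrow> ('a \<Rightarrow> int) \<Rightarrow> int \<Rightarrow> 'a set" where
  "vball F v n = {x \<in> carrier F. x \<noteq> \<zero>\<^bsub>F\<^esub> \<longrightarrow> n \<le> v x}"

section \<open>Balls of a discrete valuation\<close>

context normalised_valuation begin

abbreviation B where "B \<equiv> vball F v"

lemma vball_carrier: "x \<in> B n \<Longrightarrow> x \<in> carrier F"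
  by (simp add: vball_def)

lemma vball_zero [simp]: "\<zero> \<in> B n"
  by (simp add: vball_def)

lemma vball_antimono: "m \<le> n \<Longrightarrow> x \<in> B n \<Longrightarrow> x \<in> B m"
  by (auto simp: vball_def)

lemma val_one [simp]: "v \<one> = 0"
  using val_mult[of \<one> \<one>] by simp

lemma val_pow: "x \<in> carrier F - {\<zero>} \<Longrightarrow> v (x [^] (n::nat)) = int n * v x"
proof (induction n)
  case (Suc n)
  have "x [^] n \<noteq> \<zero>" using Suc.prems pow_non_zero by blast
  then show ?case using Suc val_mult[of "x [^] n" x] by (auto simp: algebra_simps)
qed simp

lemma val_minus_one [simp]: "v (\<ominus> \<one>) = 0"
proof -
  have c: "\<ominus> \<one> \<in> carrier F - {\<zero>}"
    using add.inv_eq_1_iff one_not_zero by fastforce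
  have "v ((\<ominus> \<one>) \<otimes> (\<ominus> \<one>)) = 2 * v (\<ominus> \<one>)"
    using val_mult[OF c c] by simp
  moreover have "(\<ominus> \<one>) \<otimes> (\<ominus> \<one>) = \<one>" by algebra
  ultimately show ?thesis by simp
qed

lemma val_minus [simp]: "x \<in> carrier F \<Longrightarrow> v (\<ominus> x) = v x"
proof (cases "x = \<zero>")
  case False
  assume x: "x \<in> carrier F"
  have c: "\<ominus> \<one> \<in> carrier F - {\<zero>}"
    using add.inv_eq_1_iff one_not_zero by fastforce
  have "\<ominus> x = (\<ominus> \<one>) \<otimes> x" using x by algebra
  then show ?thesis using val_mult[OF c, of x] x False by simp
qed simp

lemma val_inv: "x \<in> carrier F - {\<zero>} \<Longrightarrow> v (inv x) = - v x"
proof -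
  assume x: "x \<in> carrier F - {\<zero>}"
  then have i: "inv x \<in> carrier F - {\<zero>}" and m: "x \<otimes> inv x = \<one>"
    using field_Units by (auto simp: Units_inv_closed dest: Units_r_inv)
  show ?thesis using val_mult[OF x i] m by simp
qed

lemma vball_add: "x \<in> B n \<Longrightarrow> y \<in> B n \<Longrightarrow> x \<oplus> y \<in> B n"
proof -
  assume a: "x \<in> B n" "y \<in> B n"
  show ?thesis
  proof (cases "x = \<zero> \<or> y = \<zero> \<or> x \<oplus> y = \<zero>")
    case True then show ?thesis using a vball_carrier by auto
  next
    case False
    then show ?thesis using a val_add[of x y] by (auto simp: vball_def)
  qed
qed

lemma vball_minus: "x \<in> B n \<Longrightarrow> \<ominus> x \<in> B n"
  by (auto simp: vball_def)

lemma vball_diff: "x \<in> B n \<Longrightarrow> y \<in> B n \<Longrightarrow> x \<ominus> y \<in> B n"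
  unfolding a_minus_def by (intro vball_add vball_minus)

lemma vball_diff_commute: "x \<in> carrier F \<Longrightarrow> y \<in> carrier F \<Longrightarrow> x \<ominus> y \<in> B n \<Longrightarrow> y \<ominus> x \<in> B n"
proof -
  assume a: "x \<in> carrier F" "y \<in> carrier F" "x \<ominus> y \<in> B n"
  have "y \<ominus> x = \<ominus> (x \<ominus> y)" using a(1,2) by algebra
  then show ?thesis using vball_minus[OF a(3)] by simp
qed

lemma vball_diff_trans:
  "x \<in> carrier F \<Longrightarrow> y \<in> carrier F \<Longrightarrow> z \<in> carrier F \<Longrightarrow> x \<ominus> y \<in> B n \<Longrightarrow> y \<ominus> z \<in> B n
    \<Longrightarrow> x \<ominus> z \<in> B n"
proof -
  assume a: "x \<in> carrier F" "y \<in> carrier F" "z \<in> carrier F" "x \<ominus> y \<in> B n" "y \<ominus> z \<in> B n"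
  have "x \<ominus> z = (x \<ominus> y) \<oplus> (y \<ominus> z)" using a(1,2,3) by algebra
  then show ?thesis using vball_add[OF a(4,5)] by simp
qed

lemma vball_mult: "x \<in> B m \<Longrightarrow> y \<in> B n \<Longrightarrow> x \<otimes> y \<in> B (m + n)"
proof -
  assume a: "x \<in> B m" "y \<in> B n"
  show ?thesis
  proof (cases "x = \<zero> \<or> y = \<zero>")
    case True then show ?thesis using a vball_carrier by auto
  next
    case False
    then show ?thesis using a val_mult[of x y] by (auto simp: vball_def)
  qed
qed

lemma vball_one [simp]: "\<one> \<in> B 0"
  by (simp add: vball_def)

lemma vball_one_iff: "\<one> \<in> B n \<longleftrightarrow> n \<le> 0"
  by (simp add: vball_def)

lemma vball_mult0: "x \<in> B 0 \<Longrightarrow> y \<in> B n \<Longrightarrow> x \<otimes> y \<in> B n"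
  using vball_mult[of x 0 y n] by simp

lemma vball_pow: "x \<in> B 0 \<Longrightarrow> x [^] (n::nat) \<in> B 0"
  by (induction n) (use vball_mult0 in auto)

text \<open>The value of a nonzero element is an integer and cannot exceed every bound. Equalities
  are proved below as infinite families of congruences; the shift \<open>c\<close> matches the
  convergence rates that occur there.\<close>

lemma vball_all_zero: "x \<in> carrier F \<Longrightarrow> (\<And>n::nat. x \<in> B (int n - c)) \<Longrightarrow> x = \<zero>"
proof (rule ccontr)
  assume a: "x \<in> carrier F" "\<And>n::nat. x \<in> B (int n - c)" "x \<noteq> \<zero>"
  have "int (nat (v x + c + 1)) - c \<le> v x" using a(2)[of "nat (v x + c + 1)"] a by (simp add: vball_def)
  then show False by linarith
qed

lemma vball_cancel: "x \<in> carrier F - {\<zero>} \<Longrightarrow> y \<in> carrier F \<Longrightarrow> x \<otimes> y \<in> B n \<longleftrightarrow> y \<in> B (n - v x)"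
  by (cases "y = \<zero>") (auto simp: vball_def val_mult integral_iff)

lemma val_root_of_unity:
  assumes "x \<in> carrier F" "x [^] (n::nat) = \<one>" "0 < n"
  shows "v x = 0" "x \<noteq> \<zero>" "x \<in> B 0"
proof -
  show nz: "x \<noteq> \<zero>" using assms nat_pow_zero[of n] by auto
  show "v x = 0" using val_pow[of x n] assms nz by auto
  then show "x \<in> B 0" using assms by (simp add: vball_def)
qed

section \<open>The residue field\<close>

lemma valuation_ring_eq: "valuation_ring F v = F\<lparr>carrier := B 0\<rparr>"
  by (simp add: valuation_ring_def vball_def)

lemma valuation_ideal_eq: "valuation_ideal F v = B 1"
  by (auto simp: valuation_ideal_def vball_def)

lemma subring_vball: "subring (B 0) F"
  by (rule subringI) (auto intro: vball_add vball_minus vball_mult0 simp: vball_carrier)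

lemma O_cring: "cring (F\<lparr>carrier := B 0\<rparr>)"
  using subcring_iff[of "B 0"] subcringI'[OF subring_vball] subringE(1)[OF subring_vball] by blast

lemma O_ring: "ring (F\<lparr>carrier := B 0\<rparr>)"
  using O_cring cring.axioms(1) by blast

text \<open>Negation in a ring record is an inverse searched for in that record's own carrier, so
  restricting the carrier changes it as a term and the agreement needs an argument.\<close>

lemma O_a_inv: "x \<in> B 0 \<Longrightarrow> \<ominus>\<^bsub>F\<lparr>carrier := B 0\<rparr>\<^esub> x = \<ominus> x"
proof -
  interpret O: ring "F\<lparr>carrier := B 0\<rparr>" by (rule O_ring)
  assume x: "x \<in> B 0"
  have "x \<oplus> (\<ominus>\<^bsub>F\<lparr>carrier := B 0\<rparr>\<^esub> x) = \<zero>" using O.r_neg[of x] x by simp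
  moreover have "\<ominus>\<^bsub>F\<lparr>carrier := B 0\<rparr>\<^esub> x \<in> B 0" using O.a_inv_closed[of x] x by simp
  ultimately show ?thesis using x vball_carrier sum_zero_eq_neg
    by (metis a_comm)
qed

lemma ideal_vball: "ideal (B 1) (F\<lparr>carrier := B 0\<rparr>)"
proof (rule idealI[OF O_ring])
  have "B 1 \<subseteq> B 0" using vball_antimono[of 0 1] by auto
  interpret O: ring "F\<lparr>carrier := B 0\<rparr>" by (rule O_ring)
  show "subgroup (B 1) (add_monoid (F\<lparr>carrier := B 0\<rparr>))"
  proof (rule group.subgroupI[OF O.a_group])
    fix a assume "a \<in> B 1"
    moreover from this have "inv\<^bsub>add_monoid (F\<lparr>carrier := B 0\<rparr>)\<^esub> a = \<ominus> a"
      using O_a_inv[of a] \<open>B 1 \<subseteq> B 0\<close> unfolding a_inv_def by blast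
    ultimately show "inv\<^bsub>add_monoid (F\<lparr>carrier := B 0\<rparr>)\<^esub> a \<in> B 1" using vball_minus by metis
  next
    show "B 1 \<noteq> {}" using vball_zero by blast
  qed (use \<open>B 1 \<subseteq> B 0\<close> vball_add in auto)
  fix a x assume "a \<in> B 1" "x \<in> carrier (F\<lparr>carrier := B 0\<rparr>)"
  then show "x \<otimes>\<^bsub>F\<lparr>carrier := B 0\<rparr>\<^esub> a \<in> B 1" "a \<otimes>\<^bsub>F\<lparr>carrier := B 0\<rparr>\<^esub> x \<in> B 1"
    using vball_mult[of x 0 a 1] vball_mult[of a 1 x 0] by auto
qed

abbreviation k where "k \<equiv> residue_field F v"

definition res where "res x = B 1 +>\<^bsub>F\<lparr>carrier := B 0\<rparr>\<^esub> x"

lemma k_eq: "k = (F\<lparr>carrier := B 0\<rparr>) Quot B 1"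
  by (simp add: residue_field_def valuation_ring_eq valuation_ideal_eq)

lemma res_hom: "res \<in> ring_hom (F\<lparr>carrier := B 0\<rparr>) k"
proof -
  have "res = (+>\<^bsub>F\<lparr>carrier := B 0\<rparr>\<^esub>) (B 1)" by (rule ext) (simp add: res_def)
  then show ?thesis using ideal.rcos_ring_hom[OF ideal_vball] by (simp add: k_eq)
qed

lemma res_mem: "res x = {b \<oplus> x | b. b \<in> B 1}"
  by (auto simp: res_def a_r_coset_def r_coset_def)

lemma res_eq_iff: "x \<in> B 0 \<Longrightarrow> y \<in> B 0 \<Longrightarrow> res x = res y \<longleftrightarrow> x \<ominus> y \<in> B 1"
proof -
  assume a: "x \<in> B 0" "y \<in> B 0"
  then have c: "x \<in> carrier F" "y \<in> carrier F" using vball_carrier by auto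
  show ?thesis
  proof
    assume "res x = res y"
    moreover have "x \<in> res x" using c by (auto simp: res_mem intro: exI[of _ \<zero>])
    ultimately obtain b where b: "b \<in> B 1" "x = b \<oplus> y" by (auto simp: res_mem)
    then have "x \<ominus> y = b" using vball_carrier[OF b(1)] c by algebra
    then show "x \<ominus> y \<in> B 1" using b by simp
  next
    assume d: "x \<ominus> y \<in> B 1"
    have "b \<oplus> x = (b \<oplus> (x \<ominus> y)) \<oplus> y" "b \<oplus> y = (b \<oplus> (y \<ominus> x)) \<oplus> x" if "b \<in> B 1" for b
      using vball_carrier[OF that] c by algebra+
    then show "res x = res y" using d vball_diff_commute[OF c d] vball_add
      unfolding res_mem by blast
  qed
qed

lemma res_zero_iff: "x \<in> B 0 \<Longrightarrow> res x = \<zero>\<^bsub>k\<^esub> \<longleftrightarrow> x \<in> B 1"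
proof -
  assume a: "x \<in> B 0"
  have "res \<zero> = \<zero>\<^bsub>k\<^esub>"
    using ring_hom_zero[OF res_hom O_ring] ideal.quotient_is_ring[OF ideal_vball]
    by (simp add: k_eq)
  then show ?thesis using res_eq_iff[OF a vball_zero] vball_carrier[OF a] by (simp add: minus_eq)
qed

lemma k_carrier: "carrier k = res ` B 0"
  by (auto simp: k_eq FactRing_def A_RCOSETS_def RCOSETS_def res_def a_r_coset_def)

lemma res_closed [simp]: "x \<in> B 0 \<Longrightarrow> res x \<in> carrier k"
  by (simp add: k_carrier)

lemma mem_res: "x \<in> B 0 \<Longrightarrow> y \<in> res x \<Longrightarrow> y \<in> B 0 \<and> res y = res x"
proof -
  assume a: "x \<in> B 0" "y \<in> res x"
  then obtain b where b: "b \<in> B 1" "y = b \<oplus> x" by (auto simp: res_mem)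
  then have y: "y \<in> B 0" using a vball_add vball_antimono[of 0 1] by auto
  have "y \<ominus> x = b" using vball_carrier[OF b(1)] vball_carrier[OF a(1)] b(2) by algebra
  then show ?thesis using y b res_eq_iff[OF y a(1)] by simp
qed

lemma mem_res_self: "x \<in> B 0 \<Longrightarrow> x \<in> res x"
  using vball_carrier by (auto simp: res_mem intro!: exI[of _ \<zero>])

lemma k_cring: "cring k"
  unfolding k_eq by (rule ideal.quotient_is_cring[OF ideal_vball O_cring])

lemma res_ring_hom: "ring_hom_ring (F\<lparr>carrier := B 0\<rparr>) k res"
  using ring_hom_ringI2[OF O_ring _ res_hom] k_cring cring.axioms(1) by blast

lemma res_add: "x \<in> B 0 \<Longrightarrow> y \<in> B 0 \<Longrightarrow> res (x \<oplus> y) = res x \<oplus>\<^bsub>k\<^esub> res y"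
  using ring_hom_add[OF res_hom, of x y] by simp

lemma res_mult: "x \<in> B 0 \<Longrightarrow> y \<in> B 0 \<Longrightarrow> res (x \<otimes> y) = res x \<otimes>\<^bsub>k\<^esub> res y"
  using ring_hom_mult[OF res_hom, of x y] by simp

lemma res_one: "res \<one> = \<one>\<^bsub>k\<^esub>"
  using ring_hom_one[OF res_hom] by simp

lemma res_pow: "x \<in> B 0 \<Longrightarrow> res (x [^] (n::nat)) = res x [^]\<^bsub>k\<^esub> n"
  by (induction n) (auto simp: res_one res_mult vball_pow)

text \<open>An integral element outside the maximal ideal has value 0, so its inverse in
  \<open>F\<close> is integral too.\<close>

lemma k_field: "field k"
proof -
  interpret k: cring k by (rule k_cring)
  show ?thesis
  proof (rule k.cring_fieldI2)
    show "\<zero>\<^bsub>k\<^esub> \<noteq> \<one>\<^bsub>k\<^esub>"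
      using res_zero_iff[OF vball_one] by (simp add: res_one[symmetric] vball_one_iff)
    fix a assume a: "a \<in> carrier k" "a \<noteq> \<zero>\<^bsub>k\<^esub>"
    then obtain x where x: "x \<in> B 0" "a = res x" by (auto simp: k_carrier)
    then have n: "x \<notin> B 1" using a res_zero_iff by simp
    then have xc: "x \<in> carrier F - {\<zero>}" using x vball_carrier by auto
    then have v0: "v x = 0" using n x by (auto simp: vball_def)
    have i: "inv x \<in> carrier F - {\<zero>}" and m: "x \<otimes> inv x = \<one>"
      using xc field_Units by (auto simp: Units_inv_closed dest: Units_r_inv)
    have ib: "inv x \<in> B 0" using i val_inv[OF xc] v0 by (simp add: vball_def)
    show "\<exists>b\<in>carrier k. a \<otimes>\<^bsub>k\<^esub> b = \<one>\<^bsub>k\<^esub>"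
      using res_mult[OF x(1) ib] x ib m by (auto simp: res_one intro!: bexI[of _ "res (inv x)"])
  qed
qed

lemma exists_uniformiser: "\<exists>x \<in> carrier F - {\<zero>}. v x = 1"
  using val_surj by (metis UNIV_I image_iff)

end

section \<open>Finite fields\<close>

text \<open>Two constants share this base name. The cyclic structure of finite multiplicative groups
  is stated for the qualified one, while the other is used throughout.\<close>

lemma mult_of_eq: "Multiplicative_Group.mult_of R = mult_of R"
  by (simp add: Multiplicative_Group.mult_of_def mult_of_def)

lemma (in cring) binomial_expansion:
  assumes "x \<in> carrier R" "y \<in> carrier R"
  shows "(x \<oplus> y) [^] (n::nat) = (\<Oplus>i\<in>{..n}. [(n choose i)] \<cdot> (x [^] i \<otimes> y [^] (n - i)))"
proof (induction n)
  case 0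
  then show ?case using assms by simp
next
  case (Suc n)
  define t where "t i = [(n choose i)] \<cdot> (x [^] i \<otimes> y [^] (n - i))" for i
  \<comment> \<open>The products of \<open>x\<close> and \<open>y\<close> with the inductive sum are
    both spread over \<open>{..Suc n}\<close> by padding with zero, the first shifted by one, so
    that Pascal's rule applies term by term.\<close>
  define a where "a i = (case i of 0 \<Rightarrow> \<zero> | Suc j \<Rightarrow> x \<otimes> t j)" for i
  define b where "b i = (if i \<le> n then y \<otimes> t i else \<zero>)" for i
  have tc: "t \<in> A \<rightarrow> carrier R" for A using assms by (auto simp: t_def)
  have tc': "t i \<in> carrier R" for i using assms by (auto simp: t_def)
  have ac: "a \<in> A \<rightarrow> carrier R" for A using assms tc' by (auto simp: a_def split: nat.split)
  have bc: "b \<in> A \<rightarrow> carrier R" for A using assms tc' by (auto simp: b_def)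
  have A: "(\<Oplus>i\<in>{..Suc n}. a i) = x \<otimes> (\<Oplus>i\<in>{..n}. t i)"
  proof -
    have "(\<Oplus>i\<in>{..Suc n}. a i) = (\<Oplus>i\<in>{..n}. a (Suc i)) \<oplus> a 0"
      by (rule finsum_Suc2[OF ac])
    then have "(\<Oplus>i\<in>{..Suc n}. a i) = (\<Oplus>i\<in>{..n}. x \<otimes> t i)"
      using assms tc' by (simp add: a_def finsum_closed Pi_def)
    then show ?thesis using finsum_rdistr[of "{..n}" x t] assms tc by simp
  qed
  have Bs: "(\<Oplus>i\<in>{..Suc n}. b i) = y \<otimes> (\<Oplus>i\<in>{..n}. t i)"
  proof -
    have "(\<Oplus>i\<in>{..Suc n}. b i) = b (Suc n) \<oplus> (\<Oplus>i\<in>{..n}. b i)"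
      by (rule finsum_Suc[OF bc])
    moreover have "(\<Oplus>i\<in>{..n}. b i) = (\<Oplus>i\<in>{..n}. y \<otimes> t i)"
      by (rule finsum_cong') (use assms tc' in \<open>auto simp: b_def\<close>)
    ultimately have "(\<Oplus>i\<in>{..Suc n}. b i) = (\<Oplus>i\<in>{..n}. y \<otimes> t i)"
      using assms tc' by (simp add: b_def finsum_closed Pi_def)
    then show ?thesis using finsum_rdistr[of "{..n}" y t] assms tc by simp
  qed
  have ab: "a i \<oplus> b i = [(Suc n choose i)] \<cdot> (x [^] i \<otimes> y [^] (Suc n - i))" if "i \<le> Suc n" for i
  proof (cases i)
    case 0
    then show ?thesis using assms by (simp add: a_def b_def t_def m_comm)
  next
    case (Suc j)
    then have j: "j \<le> n" using that by simp
    have 1: "x \<otimes> t j = [(n choose j)] \<cdot> (x [^] i \<otimes> y [^] (Suc n - i))"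
      using assms Suc add_pow_rdistr[of x "x [^] j \<otimes> y [^] (n - j)" "n choose j"]
      by (simp add: t_def m_ac)
    have 2: "b i = [(n choose i)] \<cdot> (x [^] i \<otimes> y [^] (Suc n - i))"
    proof (cases "i \<le> n")
      case True
      then have "Suc n - i = Suc (n - i)" by simp
      then show ?thesis using assms True add_pow_rdistr[of y "x [^] i \<otimes> y [^] (n - i)" "n choose i"]
        by (simp add: b_def t_def m_ac)
    next
      case False
      then have "n choose i = 0" by simp
      then show ?thesis using assms False by (simp add: b_def del: binomial_eq_0_iff)
    qed
    have "a i \<oplus> b i = [((n choose j) + (n choose i))] \<cdot> (x [^] i \<otimes> y [^] (Suc n - i))"
      using 1 2 Suc assms by (simp add: a_def add.nat_pow_mult)
    moreover have "(n choose j) + (n choose i) = (Suc n choose i)" using Suc by simp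
    ultimately show ?thesis by metis
  qed
  have "(x \<oplus> y) [^] Suc n = x \<otimes> (\<Oplus>i\<in>{..n}. t i) \<oplus> y \<otimes> (\<Oplus>i\<in>{..n}. t i)"
    using assms tc finsum_closed[of t "{..n}"] Suc
    by (simp add: t_def[symmetric] m_comm[of _ "x \<oplus> y"] l_distr)
  also have "\<dots> = (\<Oplus>i\<in>{..Suc n}. a i \<oplus> b i)"
    using A Bs finsum_addf[of a "{..Suc n}" b] ac bc by simp
  also have "\<dots> = (\<Oplus>i\<in>{..Suc n}. [(Suc n choose i)] \<cdot> (x [^] i \<otimes> y [^] (Suc n - i)))"
    by (rule finsum_cong') (use assms ab in auto)
  finally show ?case .
qed

lemma (in cring) freshmans_dream_prime:
  assumes "x \<in> carrier R" "y \<in> carrier R" "Factorial_Ring.prime (p::nat)" "[p] \<cdot> \<one> = \<zero>"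
  shows "(x \<oplus> y) [^] p = x [^] p \<oplus> y [^] p"
proof -
  have p: "0 < p" using assms(3) prime_gt_0_nat by blast
  define u where "u i = [(p choose i)] \<cdot> (x [^] i \<otimes> y [^] (p - i))" for i
  have uc: "u i \<in> carrier R" for i using assms by (auto simp: u_def)
  have kill: "[(p * m)] \<cdot> z = \<zero>" if z: "z \<in> carrier R" for m :: nat and z
  proof -
    have "[p] \<cdot> z = ([p] \<cdot> \<one>) \<otimes> z" using add_pow_ldistr[of \<one> z p] z by simp
    then have "[p] \<cdot> z = \<zero>" using assms z by simp
    then show ?thesis using add.nat_pow_pow[OF z, of m p] by (simp add: mult.commute)
  qed
  have mid: "u i = \<zero>" if "0 < i" "i < p" for i
    using dvd_choose_prime[of i p] that kill assms by (auto simp: u_def dvd_def)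
  have "(x \<oplus> y) [^] p = (\<Oplus>i\<in>{..p}. u i)"
    using binomial_expansion[OF assms(1,2)] by (simp add: u_def)
  also have "\<dots> = (\<Oplus>i\<in>{0, p}. u i)"
    by (rule add.finprod_mono_neutral_cong_right) (use uc mid in auto)
  also have "\<dots> = u 0 \<oplus> u p" using uc p by simp
  also have "\<dots> = x [^] p \<oplus> y [^] p" using assms by (simp add: u_def a_comm)
  finally show ?thesis .
qed

lemma (in cring) freshmans_dream:
  assumes "x \<in> carrier R" "y \<in> carrier R" "Factorial_Ring.prime (p::nat)" "[p] \<cdot> \<one> = \<zero>"
  shows "(x \<oplus> y) [^] (p ^ s) = x [^] (p ^ s) \<oplus> y [^] (p ^ s)"
proof (induction s)
  case (Suc s)
  have "(x \<oplus> y) [^] (p ^ Suc s) = ((x \<oplus> y) [^] (p ^ s)) [^] p"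
    using assms nat_pow_pow[of "x \<oplus> y" "p ^ s" p] by (simp add: mult.commute)
  also have "\<dots> = (x [^] (p ^ s)) [^] p \<oplus> (y [^] (p ^ s)) [^] p"
    using Suc freshmans_dream_prime[of "x [^] (p ^ s)" "y [^] (p ^ s)" p] assms by simp
  also have "\<dots> = x [^] (p ^ Suc s) \<oplus> y [^] (p ^ Suc s)"
    using assms by (simp add: nat_pow_pow mult.commute)
  finally show ?case .
qed (use assms in simp)

text \<open>The additive order of 1 is prime because there are no zero divisors. If a prime
  \<open>r\<close> divides the cardinality, Sylow's theorem with exponent 1 gives a subgroup of
  order \<open>r\<close>; a nonzero \<open>x\<close> in it satisfies r x = 0, so the characteristic
  divides \<open>r\<close>. Hence no other prime occurs.\<close>

lemma (in field) finite_field_char: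
  assumes "finite (carrier R)"
  defines "p \<equiv> group.ord (add_monoid R) \<one>"
  shows "Factorial_Ring.prime (p::nat)" "[p] \<cdot> \<one> = \<zero>" "\<exists>s>0. card (carrier R) = p ^ s"
proof -
  have ordiff: "[n] \<cdot> x = \<zero> \<longleftrightarrow> group.ord (add_monoid R) x dvd n" if "x \<in> carrier R" for x and n :: nat
    using group.pow_eq_id[OF a_group, of x n] that by (simp add: add_pow_def)
  have piff: "[n] \<cdot> \<one> = \<zero> \<longleftrightarrow> p dvd n" for n :: nat using ordiff[of \<one> n] by (simp add: p_def)
  show p0: "[p] \<cdot> \<one> = \<zero>" using piff by simp
  have card0: "[(card (carrier R))] \<cdot> x = \<zero>" if "x \<in> carrier R" for x
    using group.pow_order_eq_1[OF a_group, of x] that by (simp add: add_pow_def order_def)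
  have cpos: "1 < card (carrier R)"
  proof -
    have "card {\<zero>, \<one>} \<le> card (carrier R)" by (rule card_mono[OF assms(1)]) auto
    then show ?thesis by simp
  qed
  have pn1: "p \<noteq> 1" using piff[of 1] by auto
  have ppos: "p \<noteq> 0" using piff[of "card (carrier R)"] card0[of \<one>] cpos
    by (metis dvd_0_left_iff not_less_zero one_closed)
  show pr: "Factorial_Ring.prime (p::nat)"
  proof (rule prime_natI)
    show "2 \<le> p" using pn1 ppos by simp
    fix n m assume d: "p dvd n * m"
    have "([n] \<cdot> \<one>) \<otimes> ([m] \<cdot> \<one>) = [(n * m)] \<cdot> \<one>"
      using add_pow_ldistr[of \<one> "[m] \<cdot> \<one>" n] add.nat_pow_pow[of \<one> n m] by (simp add: mult.commute)
    then have "([n] \<cdot> \<one>) \<otimes> ([m] \<cdot> \<one>) = \<zero>" using piff d by simp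
    then show "p dvd n \<or> p dvd m" using integral[of "[n] \<cdot> \<one>" "[m] \<cdot> \<one>"] piff by auto
  qed
  have pd: "r = p" if r: "Factorial_Ring.prime (r::nat)" "r dvd card (carrier R)" for r
  proof -
    have "\<exists>H. subgroup H (add_monoid R) \<and> card H = r ^ 1"
      by (rule sylow_thm[OF r(1) a_group, of 1 "card (carrier R) div r"])
        (use r(2) assms(1) in \<open>auto simp: order_def\<close>)
    then obtain H where H: "subgroup H (add_monoid R)" "card H = r" by auto
    have "1 < card H" using H r prime_gt_1_nat by auto
    then have "\<exists>x\<in>H. x \<noteq> \<zero>"
      by (metis One_nat_def card_1_singleton_iff card_mono finite.emptyI finite.insertI insertCI leD subsetI singletonD card.empty card_insert_disjoint empty_iff)
    then obtain x where x: "x \<in> H" "x \<noteq> \<zero>" by blast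
    have xc: "x \<in> carrier R" using x H subgroup.subset by fastforce
    interpret H: group "(add_monoid R)\<lparr>carrier := H\<rparr>"
      using subgroup.subgroup_is_group[OF H(1) a_group] .
    have "x [^]\<^bsub>(add_monoid R)\<lparr>carrier := H\<rparr>\<^esub> card H = \<zero>"
      using H.pow_order_eq_1[of x] x by (simp add: order_def)
    then have "[r] \<cdot> x = \<zero>"
      using monoid.nat_pow_consistent[OF group.is_monoid[OF a_group], of x r H] H
      by (simp add: add_pow_def)
    then have "([r] \<cdot> \<one>) \<otimes> x = \<zero>" using add_pow_ldistr[of \<one> x r] xc by simp
    then have "p dvd r" using integral[of "[r] \<cdot> \<one>" x] xc x piff by auto
    then show ?thesis using r pr primes_dvd_imp_eq by blast
  qed
  show "\<exists>s>0. card (carrier R) = p ^ s"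
  proof -
    have "\<exists>s. card (carrier R) = p ^ s"
    proof -
      obtain m where m: "card (carrier R) = p ^ multiplicity p (card (carrier R)) * m" "\<not> p dvd m"
        using multiplicity_decompose'[of "card (carrier R)" p] cpos pn1 by auto
      have "m = 1"
      proof (rule ccontr)
        assume "m \<noteq> 1"
        then obtain r where r: "Factorial_Ring.prime (r::nat)" "r dvd m" using prime_factor_nat by blast
        then have "r dvd card (carrier R)" using m(1) by (metis dvd_mult)
        then have "r = p" using pd r(1) by blast
        then show False using r(2) m(2) by simp
      qed
      then show ?thesis using m(1) by auto
    qed
    then obtain s where s: "card (carrier R) = p ^ s" by blast
    then have "s \<noteq> 0" using cpos by (metis less_irrefl power_0)
    then show ?thesis using s by blast
  qed
qed

lemma (in field) finite_field_pow_card: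
  assumes "finite (carrier R)" "x \<in> carrier R"
  shows "x [^] card (carrier R) = x"
proof (cases "x = \<zero>")
  case True
  have "0 < card (carrier R)" using assms card_gt_0_iff by blast
  then show ?thesis using True nat_pow_zero by auto
next
  case False
  then have "x \<in> Units R" using assms field_Units by simp
  moreover have "finite (Units R)" using assms field_Units by simp
  ultimately have "x [^] card (Units R) = \<one>" using units_power_order_eq_one by blast
  moreover have "card (carrier R) = Suc (card (Units R))"
    using assms field_Units card_Suc_Diff1[of "carrier R" \<zero>] by simp
  ultimately show ?thesis using assms by simp
qed

text \<open>The order of the generator is recorded as a divisibility criterion for exponents, the
  form in which primitive roots are used later.\<close>

lemma (in field) finite_field_generator:
  assumes "finite (carrier R)"
  obtains a where "a \<in> carrier R" "\<And>i. a [^] (i::nat) = \<one> \<longleftrightarrow> (card (carrier R) - 1) dvd i"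
proof -
  obtain a where a: "a \<in> carrier (mult_of R)" "carrier (mult_of R) = {a [^] i | i::nat. i \<in> UNIV}"
    using finite_field_mult_group_has_gen[OF assms]
    unfolding mult_of_eq by (elim bexE) (rule that)
  interpret M: group "mult_of R" using field_mult_group unfolding mult_of_eq .
  have fin: "finite (carrier (mult_of R))" using assms by simp
  have "generate (mult_of R) {a} = {a [^]\<^bsub>mult_of R\<^esub> i | i::nat. i \<in> UNIV}"
    using M.generate_pow_nat[OF a(1)] M.ord_ge_1[OF fin a(1)] by simp
  then have "generate (mult_of R) {a} = carrier (mult_of R)" using a by (simp add: nat_pow_mult_of)
  then have "M.ord a = card (carrier (mult_of R))" using M.generate_pow_card[OF a(1)] by simp
  then have o: "M.ord a = card (carrier R) - 1" using assms by simp
  have "a [^] (i::nat) = \<one> \<longleftrightarrow> (card (carrier R) - 1) dvd i" for i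
    using M.pow_eq_id[OF a(1), of i] o by (simp add: nat_pow_mult_of)
  then show thesis using that a(1) by auto
qed

section \<open>Complete discretely valued fields\<close>

context normalised_valuation begin

lemma val_close_iff: "x \<in> carrier F \<Longrightarrow> y \<in> carrier F \<Longrightarrow> val_close F v N x y \<longleftrightarrow> x \<ominus> y \<in> B N"
  by (auto simp: val_close_def vball_def)

text \<open>The cofactor \<open>s\<close> is the sum of all a^i b^(n-i). As \<open>a\<close> and
  \<open>b\<close> have the same residue, each of its n + 1 terms reduces to the residue of a^n. For
  the exponent \<open>Q\<close> this multiple vanishes, which is the source of
  \<open>pow_Q_cong\<close>.\<close>

lemma pow_diff:
  assumes "a \<in> B 0" "b \<in> B 0" "a \<ominus> b \<in> B 1"
  shows "\<exists>s \<in> B 0. a [^] Suc n \<ominus> b [^] Suc n = (a \<ominus> b) \<otimes> s \<and>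
    res s = [(Suc n)] \<cdot>\<^bsub>k\<^esub> (res a [^]\<^bsub>k\<^esub> n)"
proof (induction n)
  case 0
  have c: "a \<in> carrier F" "b \<in> carrier F" using assms vball_carrier by auto
  interpret k: cring k by (rule k_cring)
  show ?case using c assms by (intro bexI[of _ \<one>]) (auto simp: res_one)
next
  case (Suc n)
  interpret k: cring k by (rule k_cring)
  obtain s where s: "s \<in> B 0" "a [^] Suc n \<ominus> b [^] Suc n = (a \<ominus> b) \<otimes> s"
    "res s = [(Suc n)] \<cdot>\<^bsub>k\<^esub> (res a [^]\<^bsub>k\<^esub> n)" using Suc by blast
  define t where "t = a \<otimes> s \<oplus> b [^] Suc n"
  have c: "a \<in> carrier F" "b \<in> carrier F" "s \<in> carrier F" using assms s vball_carrier by auto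
  have ab: "res b = res a" using res_eq_iff[of a b] assms by simp
  have bn: "b [^] Suc n \<in> B 0" using vball_pow assms by blast
  have tb: "t \<in> B 0" unfolding t_def using vball_add vball_mult0 assms s bn by blast
  have "a [^] Suc (Suc n) \<ominus> b [^] Suc (Suc n) = a \<otimes> (a [^] Suc n \<ominus> b [^] Suc n) \<oplus> (a \<ominus> b) \<otimes> b [^] Suc n"
  proof -
    have x: "a [^] Suc n \<in> carrier F" "b [^] Suc n \<in> carrier F" using c by auto
    have "a [^] Suc (Suc n) = a \<otimes> a [^] Suc n" "b [^] Suc (Suc n) = b \<otimes> b [^] Suc n"
      using c nat_pow_Suc2 by blast+
    then show ?thesis using c(1,2) x by algebra
  qed
  also have "\<dots> = (a \<ominus> b) \<otimes> t"
  proof -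
    have "b [^] Suc n \<in> carrier F" using c by auto
    then show ?thesis unfolding s(2) t_def using c by algebra
  qed
  finally have 1: "a [^] Suc (Suc n) \<ominus> b [^] Suc (Suc n) = (a \<ominus> b) \<otimes> t" .
  have ra: "res a \<in> carrier k" using assms by simp
  have "res t = res a \<otimes>\<^bsub>k\<^esub> res s \<oplus>\<^bsub>k\<^esub> res a [^]\<^bsub>k\<^esub> Suc n"
    unfolding t_def using assms s bn by (simp only: res_add res_mult vball_mult0 res_pow ab)
  also have "\<dots> = [(Suc n)] \<cdot>\<^bsub>k\<^esub> (res a [^]\<^bsub>k\<^esub> Suc n) \<oplus>\<^bsub>k\<^esub> res a [^]\<^bsub>k\<^esub> Suc n"
    unfolding s(3) using ra k.add_pow_rdistr[of "res a" "res a [^]\<^bsub>k\<^esub> n" "Suc n"]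
    by (simp add: k.m_comm)
  also have "\<dots> = [(Suc (Suc n))] \<cdot>\<^bsub>k\<^esub> (res a [^]\<^bsub>k\<^esub> Suc n)"
    using ra by (simp add: k.add.nat_pow_Suc)
  finally show ?case using tb 1 by blast
qed

lemma pow_cong:
  assumes "a \<in> B 0" "b \<in> B 0" "a \<ominus> b \<in> B m"
  shows "a [^] (n::nat) \<ominus> b [^] n \<in> B m"
proof (induction n)
  case 0 then show ?case by (simp add: a_minus_def r_neg)
next
  case (Suc n)
  have c: "a \<in> carrier F" "b \<in> carrier F" using assms vball_carrier by auto
  have "a [^] n \<in> carrier F" "b [^] n \<in> carrier F" using c by auto
  then have "a [^] n \<otimes> a \<ominus> b [^] n \<otimes> b = (a [^] n) \<otimes> (a \<ominus> b) \<oplus> b \<otimes> (a [^] n \<ominus> b [^] n)"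
    using c by algebra
  then show ?case using Suc assms vball_add vball_mult0 vball_pow by simp
qed

text \<open>By the ultrametric inequality, a bound on consecutive differences that improves with the
  index bounds all later differences with no loss.\<close>

lemma geometric_diff:
  assumes "\<And>n::nat. s n \<in> carrier F" "\<And>n. s (Suc n) \<ominus> s n \<in> B (int n - c)" "n \<le> m"
  shows "s m \<ominus> s n \<in> B (int n - c)"
  using assms(3)
proof (induction m rule: dec_induct)
  case base
  then show ?case using assms(1) by (simp add: a_minus_def r_neg)
next
  case (step m)
  have "s (Suc m) \<ominus> s m \<in> B (int n - c)"
    using assms(2)[of m] step vball_antimono[of "int n - c" "int m - c"] by simp
  then show ?case using step vball_diff_trans[OF assms(1)[of "Suc m"] assms(1)[of m] assms(1)[of n]] by blast
qed

lemma geometric_cauchy: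
  assumes "\<And>n::nat. s n \<in> carrier F" "\<And>n. s (Suc n) \<ominus> s n \<in> B (int n - c)"
  shows "\<exists>M. \<forall>m\<ge>M. \<forall>n\<ge>M. s m \<ominus> s n \<in> B N"
proof (intro exI allI impI)
  fix m n assume mn: "nat (N + c) \<le> m" "nat (N + c) \<le> n"
  have le: "N \<le> int (nat (N + c)) - c" by linarith
  have "s m \<ominus> s (nat (N + c)) \<in> B N" "s n \<ominus> s (nat (N + c)) \<in> B N"
    using vball_antimono[OF le geometric_diff[of s, OF assms mn(1)]]
      vball_antimono[OF le geometric_diff[of s, OF assms mn(2)]] by blast+
  then show "s m \<ominus> s n \<in> B N"
    using vball_diff_trans[OF assms(1) assms(1) assms(1)] vball_diff_commute[OF assms(1) assms(1)]
    by metis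
qed

text \<open>A term far enough out is closer to the limit than the claimed bound, so plain
  convergence already implies convergence at the rate of the sequence.\<close>

lemma geometric_limit_rate:
  assumes "\<And>n::nat. s n \<in> carrier F" "\<And>n. s (Suc n) \<ominus> s n \<in> B (int n - c)"
    and l: "l \<in> carrier F" "\<forall>N. \<exists>M. \<forall>n\<ge>M. s n \<ominus> l \<in> B N"
  shows "s n \<ominus> l \<in> B (int n - c)"
proof -
  obtain M where M: "\<forall>m\<ge>M. s m \<ominus> l \<in> B (int n - c)" using l by blast
  define m where "m = max M n"
  have "s m \<ominus> l \<in> B (int n - c)" using M by (simp add: m_def)
  moreover have "s n \<ominus> s m \<in> B (int n - c)"
    using vball_diff_commute[OF assms(1) assms(1) geometric_diff[of s, OF assms(1,2), of n m]]
    by (simp add: m_def)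
  ultimately show ?thesis using vball_diff_trans[OF assms(1)[of n] assms(1)[of m] l(1)] by blast
qed

end

text \<open>Separated from completeness: congruences for \<open>Q\<close>-th powers and the
  uniqueness of Teichmueller lifts rest on finiteness of the residue field alone.\<close>

locale finite_residue_valuation = normalised_valuation +
  assumes fin_k: "finite (carrier (residue_field F v))"
begin

definition Q where "Q = card (carrier k)"

lemma Q_gt_1: "1 < Q"
proof -
  interpret k: field k by (rule k_field)
  have "card {\<zero>\<^bsub>k\<^esub>, \<one>\<^bsub>k\<^esub>} \<le> Q" unfolding Q_def by (rule card_mono[OF fin_k]) auto
  then show ?thesis by simp
qed

lemma pow_Q_cong_self: "x \<in> B 0 \<Longrightarrow> x [^] Q \<ominus> x \<in> B 1"
proof -
  interpret k: field k by (rule k_field)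
  assume x: "x \<in> B 0"
  have "res (x [^] Q) = res x" using res_pow[OF x] k.finite_field_pow_card[OF fin_k, of "res x"] x
    by (simp add: Q_def)
  then show ?thesis using res_eq_iff[of "x [^] Q" x] x vball_pow by blast
qed

text \<open>The \<open>Q\<close>-th power map gains one order of closeness: the cofactor from
  \<open>pow_diff\<close> reduces to a \<open>Q\<close>-fold multiple, and \<open>Q\<close> is the
  order of the additive group of the residue field.\<close>

lemma pow_Q_cong:
  assumes "a \<in> B 0" "b \<in> B 0" "a \<ominus> b \<in> B n" "1 \<le> n"
  shows "a [^] Q \<ominus> b [^] Q \<in> B (n + 1)"
proof -
  interpret k: field k by (rule k_field)
  have "a \<ominus> b \<in> B 1" using assms vball_antimono by blast
  then obtain s where s: "s \<in> B 0" "a [^] Suc (Q - 1) \<ominus> b [^] Suc (Q - 1) = (a \<ominus> b) \<otimes> s"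
    "res s = [(Suc (Q - 1))] \<cdot>\<^bsub>k\<^esub> (res a [^]\<^bsub>k\<^esub> (Q - 1))" using pow_diff[OF assms(1,2)] by blast
  have Q: "Suc (Q - 1) = Q" using Q_gt_1 by simp
  have "res a [^]\<^bsub>k\<^esub> (Q - 1) \<in> carrier k" using assms by simp
  then have "[Q] \<cdot>\<^bsub>k\<^esub> (res a [^]\<^bsub>k\<^esub> (Q - 1)) = \<zero>\<^bsub>k\<^esub>"
    using group.pow_order_eq_1[OF k.a_group, of "res a [^]\<^bsub>k\<^esub> (Q - 1)"]
    by (simp add: add_pow_def order_def Q_def)
  then have "s \<in> B 1" using s Q res_zero_iff by simp
  then show ?thesis using s(2) vball_mult[OF assms(3)] Q by simp
qed

lemma teichmuller_vball:
  assumes "z \<in> carrier F" "z [^] Q = z" shows "z \<in> B 0"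
proof (cases "z = \<zero>")
  case False
  then have "int Q * v z = v z" using val_pow[of z Q] assms by simp
  then have "v z = 0" using Q_gt_1 by auto
  then show ?thesis using assms by (simp add: vball_def)
qed simp

text \<open>Raising to the power \<open>Q\<close> fixes both elements and yet brings them one order
  closer, so their difference lies in every ball.\<close>

lemma teichmuller_unique:
  assumes "x \<in> carrier F" "y \<in> carrier F" "x [^] Q = x" "y [^] Q = y" "x \<ominus> y \<in> B 1"
  shows "x = y"
proof -
  have "x \<ominus> y \<in> B (int (n + 1))" for n
  proof (induction n)
    case (Suc n)
    then show ?case using pow_Q_cong[OF teichmuller_vball teichmuller_vball Suc] assms by (simp add: add.commute)
  qed (use assms in simp)
  then have "x \<ominus> y \<in> B (int n - (-1))" for n by (simp add: add.commute)
  then have "x \<ominus> y = \<zero>" using vball_all_zero[of "x \<ominus> y" "-1"] assms by simp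
  then show ?thesis using assms r_right_minus_eq by blast
qed

lemma coprime_residue_char:
  assumes "\<not> residue_char F v dvd e"
  shows "coprime e Q"
proof -
  interpret k: field k by (rule k_field)
  obtain s where "Factorial_Ring.prime (residue_char F v)" "Q = residue_char F v ^ s"
    using k.finite_field_char[OF fin_k] unfolding residue_char_def Q_def by blast
  then show ?thesis using assms
    by (metis coprime_commute coprime_power_left_iff prime_imp_coprime)
qed

end

sublocale local_field \<subseteq> finite_residue_valuation
  by unfold_locales (rule finite_residue_field)

context local_field begin

lemma geometric_limit:
  assumes "\<And>n::nat. s n \<in> carrier F" "\<And>n. s (Suc n) \<ominus> s n \<in> B (int n - c)"
  shows "\<exists>l\<in>carrier F. \<forall>n. s n \<ominus> l \<in> B (int n - c)"
proof -
  have "\<forall>N. \<exists>M. \<forall>m\<ge>M. \<forall>n\<ge>M. val_close F v N (s m) (s n)"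
    using geometric_cauchy[of s, OF assms] val_close_iff[OF assms(1) assms(1)] by simp
  then obtain l where l: "l \<in> carrier F" "\<forall>N. \<exists>M. \<forall>n\<ge>M. val_close F v N (s n) l"
    using complete[of s] assms(1) by blast
  then have "\<forall>N. \<exists>M. \<forall>n\<ge>M. s n \<ominus> l \<in> B N" using val_close_iff[OF assms(1) l(1)] by simp
  then show ?thesis using geometric_limit_rate[of s, OF assms l(1)] l(1) by blast
qed

text \<open>The iterated \<open>Q\<close>-th powers of \<open>x\<close> converge, since each
  application of the map gains one order; their limit is the fixed point. The rate has shift -1
  because x^Q - x already lies in \<open>B 1\<close>.\<close>

lemma teichmuller_exists:
  assumes "x \<in> B 0"
  shows "\<exists>t \<in> B 0. t [^] Q = t \<and> t \<ominus> x \<in> B 1"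
proof -
  have xc: "x \<in> carrier F" using assms vball_carrier by blast
  define s where "s n = x [^] (Q ^ n)" for n
  have s0: "s n \<in> B 0" for n using assms vball_pow by (simp add: s_def)
  have sc: "s n \<in> carrier F" for n using s0 vball_carrier by blast
  have sS: "s (Suc n) = s n [^] Q" for n using xc by (simp add: s_def nat_pow_pow mult.commute)
  have d: "s (Suc n) \<ominus> s n \<in> B (int n - (-1))" for n
  proof (induction n)
    case 0 then show ?case using pow_Q_cong_self[OF assms] xc by (simp add: s_def)
  next
    case (Suc n)
    then show ?case using pow_Q_cong[OF s0 s0 Suc] sS by (simp add: add.commute)
  qed
  obtain l where l: "l \<in> carrier F" "\<And>n. s n \<ominus> l \<in> B (int n - (-1))"
    using geometric_limit[of s, OF sc d] by blast
  have "s 0 \<ominus> l \<in> B 1" using l(2)[of 0] by simp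
  then have lx: "l \<ominus> x \<in> B 1" using vball_diff_commute l xc by (simp add: s_def)
  have l0: "l \<in> B 0"
  proof -
    have "l = (l \<ominus> x) \<oplus> x" using l xc by algebra
    then show ?thesis using vball_add[of "l \<ominus> x" 0 x] lx assms vball_antimono[of 0 1] by simp
  qed
  have "l [^] Q \<ominus> l \<in> B (int n - (-1))" for n
  proof -
    have "l [^] Q \<ominus> s (Suc n) \<in> B (int n - (-1) + 1)"
      using pow_Q_cong[OF l0 s0 vball_diff_commute[OF sc l(1) l(2)[of n]]] sS[of n] by simp
    then have "l [^] Q \<ominus> s (Suc n) \<in> B (int n - (-1))"
      using vball_antimono[of "int n - (-1)" "int n - (-1) + 1"] by simp
    moreover have "s (Suc n) \<ominus> l \<in> B (int n - (-1))"
      using l(2)[of "Suc n"] vball_antimono[of "int n - (-1)" "int (Suc n) - (-1)"] by simp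
    ultimately show ?thesis using vball_diff_trans[of "l [^] Q" "s (Suc n)" l] l(1) sc by simp
  qed
  then have "l [^] Q \<ominus> l = \<zero>" using vball_all_zero[of "l [^] Q \<ominus> l" "-1"] l by simp
  then have "l [^] Q = l" using l r_right_minus_eq by simp
  then show ?thesis using lx l0 by blast
qed

text \<open>With \<open>N\<close> a power of \<open>Q\<close> congruent to \<open>1\<close> modulo \<open>e\<close> and \<open>b = inverse of a\<close>, the powers
  \<open>b ^ ((N ^ n - 1) / e)\<close> converge to the root, as \<open>b ^ (N ^ n)\<close> tends to \<open>1\<close>.\<close>
lemma one_unit_root:
  assumes "a \<in> carrier F" "a \<ominus> \<one> \<in> B 1" "0 < e" "coprime e Q"
  shows "\<exists>y\<in>carrier F. y [^] e = a \<and> y \<ominus> \<one> \<in> B 1"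
proof -
  have unit: "z \<in> B 0" if "z \<in> carrier F" "z \<ominus> \<one> \<in> B 1" for z
  proof -
    have "z = (z \<ominus> \<one>) \<oplus> \<one>" using that by algebra
    then show ?thesis using vball_add[of "z \<ominus> \<one>" 0 \<one>] that vball_antimono[of 0 1] by simp
  qed
  have a0: "a \<in> B 0" using unit assms by blast
  have ab1: "a \<notin> B 1"
  proof
    assume "a \<in> B 1"
    then have "a \<ominus> (a \<ominus> \<one>) \<in> B 1" using assms vball_diff by blast
    moreover have "a \<ominus> (a \<ominus> \<one>) = \<one>" using assms by algebra
    ultimately show False using vball_one_iff by simp
  qed
  then have anz: "a \<in> carrier F - {\<zero>}" using assms by auto
  then have va: "v a = 0" using ab1 a0 by (auto simp: vball_def)
  define b where "b = inv a"
  have b: "b \<in> carrier F - {\<zero>}" "a \<otimes> b = \<one>"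
    using anz field_Units by (auto simp: b_def Units_inv_closed dest: Units_r_inv)
  have bc: "b \<in> carrier F" using b by simp
  have b0: "b \<in> B 0" using val_inv[OF anz] va b by (simp add: b_def vball_def)
  have b1: "b \<ominus> \<one> \<in> B 1"
  proof -
    have "b \<ominus> \<one> = b \<ominus> a \<otimes> b" using b by simp
    also have "\<dots> = b \<otimes> (\<one> \<ominus> a)" using bc assms(1) by algebra
    finally show ?thesis using vball_mult0[OF b0] vball_diff_commute[of a \<one>] assms by simp
  qed
  define N where "N = Q ^ totient e"
  have tot: "0 < totient e" using assms by simp
  have N1: "1 < N" unfolding N_def using Q_gt_1 tot by (rule one_less_power)
  have "[N = 1] (mod e)" unfolding N_def using euler_theorem[of Q e] assms coprime_commute by blast
  then have "e dvd N - 1" using N1 cong_to_1_nat by blast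
  then obtain c where c: "N - 1 = e * c" by (auto simp: dvd_def)
  have bQ: "b [^] (Q ^ j) \<ominus> \<one> \<in> B (int j + 1)" for j
  proof (induction j)
    case (Suc j)
    have "(b [^] (Q ^ j)) [^] Q \<ominus> \<one> [^] Q \<in> B (int j + 1 + 1)"
      by (rule pow_Q_cong) (use Suc b0 vball_pow in auto)
    then show ?case using bc by (simp add: nat_pow_pow mult.commute add.commute)
  qed (use b1 bc in simp)
  have bN: "b [^] (N ^ n) \<ominus> \<one> \<in> B (int n + 1)" for n
  proof -
    have "N ^ n = Q ^ (totient e * n)" by (simp add: N_def power_mult)
    moreover have "n \<le> totient e * n" using mult_le_mono1[of 1 "totient e" n] tot by linarith
    ultimately show ?thesis using bQ[of "totient e * n"] vball_antimono[of "int n + 1" "int (totient e * n) + 1"]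
      by (metis add_le_cancel_right of_nat_le_iff)
  qed
  \<comment> \<open>This is (N^n - 1)/(N - 1), so that c * t n is the exponent (N^n - 1)/e.\<close>
  define t where "t n = (\<Sum>i<n. N ^ i)" for n
  have tN: "t n * (N - 1) + 1 = N ^ n" for n
  proof (induction n)
    case (Suc n)
    have "t (Suc n) * (N - 1) + 1 = N ^ n + N ^ n * (N - 1)"
      using Suc by (simp add: t_def algebra_simps)
    also have "\<dots> = N ^ n * (1 + (N - 1))" by (simp only: distrib_left mult_1_right)
    finally show ?case using N1 by (simp add: mult.commute)
  qed (simp add: t_def)
  define y where "y n = b [^] (c * t n)" for n
  have y0: "y n \<in> B 0" for n using b0 vball_pow by (simp add: y_def)
  have yc: "y n \<in> carrier F" for n using y0 vball_carrier by blast
  have yS: "y (Suc n) \<ominus> y n \<in> B (int n - (-1))" for n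
  proof -
    define w where "w = (b [^] (N ^ n)) [^] c"
    have wc: "w \<in> carrier F" using bc by (simp add: w_def)
    have "w \<ominus> \<one> [^] c \<in> B (int n + 1)"
      unfolding w_def by (rule pow_cong) (use bN b0 vball_pow in auto)
    then have w1: "w \<ominus> \<one> \<in> B (int n - (-1))" by simp
    have "y (Suc n) = y n \<otimes> w"
      using bc by (simp add: y_def w_def t_def nat_pow_pow nat_pow_mult distrib_left mult.commute)
    then have "y (Suc n) \<ominus> y n = y n \<otimes> (w \<ominus> \<one>)" using yc[of n] wc by algebra
    then show ?thesis using w1 vball_mult0 y0 by simp
  qed
  obtain l where l: "l \<in> carrier F" "\<And>n. y n \<ominus> l \<in> B (int n - (-1))"
    using geometric_limit[of y, OF yc yS] by blast
  have l1: "l \<ominus> \<one> \<in> B 1" using l(2)[of 0] vball_diff_commute l(1) by (simp add: y_def t_def)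
  then have l0: "l \<in> B 0" using unit l by blast
  have lec: "l [^] e \<in> carrier F" using l by simp
  \<comment> \<open>The product l^e b is compared with y_n^e b = b^(N^n), which tends to 1. Hence
    l^e is the inverse of \<open>b\<close>, that is, \<open>a\<close>.\<close>
  have "l [^] e \<otimes> b \<ominus> \<one> \<in> B (int n - (-1))" for n
  proof -
    have "l [^] e \<ominus> y n [^] e \<in> B (int n - (-1))"
      by (rule pow_cong) (use l0 y0 l vball_diff_commute yc in auto)
    then have "(l [^] e \<ominus> y n [^] e) \<otimes> b \<in> B (int n - (-1))"
      using vball_mult0[OF b0] bc l yc by (simp add: m_comm)
    moreover have "y n [^] e \<otimes> b \<ominus> \<one> \<in> B (int n - (-1))"
    proof -
      have "c * t n * e = t n * (N - 1)" using c by simp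
      then have "c * t n * e + 1 = N ^ n" using tN[of n] by metis
      then have "y n [^] e \<otimes> b = b [^] (N ^ n)"
        using bc nat_pow_Suc[of b "c * t n * e"] by (simp add: y_def nat_pow_pow)
      then show ?thesis using bN[of n] by simp
    qed
    ultimately have "(l [^] e \<ominus> y n [^] e) \<otimes> b \<oplus> (y n [^] e \<otimes> b \<ominus> \<one>) \<in> B (int n - (-1))"
      using vball_add by blast
    moreover have "(l [^] e \<ominus> y n [^] e) \<otimes> b \<oplus> (y n [^] e \<otimes> b \<ominus> \<one>) = l [^] e \<otimes> b \<ominus> \<one>"
    proof -
      have "y n [^] e \<in> carrier F" using yc by simp
      then show ?thesis using lec bc by algebra
    qed
    ultimately show ?thesis by simp
  qed
  then have "l [^] e \<otimes> b \<ominus> \<one> = \<zero>" using vball_all_zero[of "l [^] e \<otimes> b \<ominus> \<one>" "-1"] lec bc by simp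
  then have "l [^] e \<otimes> b = \<one>" using lec bc r_right_minus_eq by simp
  then have "(l [^] e \<otimes> b) \<otimes> a = a" using anz by simp
  then have "l [^] e = a" using b anz lec bc by (simp add: m_assoc m_comm[of b a])
  then show ?thesis using l l1 by blast
qed

text \<open>The Teichmueller lift of a generator of the residue field. Its powers are again fixed by
  the \<open>Q\<close>-th power map, so by uniqueness one of them equals 1 as soon as its residue
  does.\<close>

lemma primitive_root_exists:
  obtains t where "t \<in> carrier F" "\<And>i. t [^] (i::nat) = \<one> \<longleftrightarrow> (Q - 1) dvd i"
proof -
  interpret k: field k by (rule k_field)
  obtain a where a: "a \<in> carrier k" "\<And>i. a [^]\<^bsub>k\<^esub> (i::nat) = \<one>\<^bsub>k\<^esub> \<longleftrightarrow> (Q - 1) dvd i"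
    using k.finite_field_generator[OF fin_k] unfolding Q_def by blast
  obtain x where x: "x \<in> B 0" "a = res x" using a(1) by (auto simp: k_carrier)
  obtain t where t: "t \<in> B 0" "t [^] Q = t" "t \<ominus> x \<in> B 1" using teichmuller_exists[OF x(1)] by blast
  have rt: "res t = a" using t x res_eq_iff by simp
  have tc: "t \<in> carrier F" using t vball_carrier by blast
  have "t [^] (i::nat) = \<one> \<longleftrightarrow> (Q - 1) dvd i" for i
  proof -
    have 1: "(t [^] i) [^] Q = t [^] i"
      using tc t(2) by (metis mult.commute nat_pow_pow)
    have "t [^] i = \<one> \<longleftrightarrow> t [^] i \<ominus> \<one> \<in> B 1"
      using teichmuller_unique[of "t [^] i" \<one>] 1 tc by (auto simp: a_minus_def r_neg)
    also have "\<dots> \<longleftrightarrow> a [^]\<^bsub>k\<^esub> i = \<one>\<^bsub>k\<^esub>"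
      using res_eq_iff[of "t [^] i" \<one>] t vball_pow res_pow[of t i] rt res_one by auto
    finally show ?thesis using a(2) by simp
  qed
  then show thesis using that tc by blast
qed

end

section \<open>Polynomials with many roots\<close>

context field begin

lemma mset_set_roots:
  assumes "p \<in> carrier (poly_ring R)" "p \<noteq> []" "finite S" "S \<subseteq> carrier R" "\<And>s. s \<in> S \<Longrightarrow> eval p s = \<zero>"
  shows "mset_set S \<subseteq># roots p"
proof (rule mset_subset_eqI)
  fix a
  show "count (mset_set S) a \<le> count (roots p) a"
  proof (cases "a \<in> S")
    case True
    then have "a \<in># roots p" using assms roots_mem_iff_is_root[of p a] by (auto simp: is_root_def)
    then have "0 < count (roots p) a" by simp
    then show ?thesis using assms True by simp
  qed (use assms in simp)
qed

text \<open>The coefficient list may start with zeros, and the conclusion speaks of all its entries.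
  Differences and reductions of polynomials can thus be fed in without normalising them.\<close>

lemma coeffs_zero_of_many_roots:
  assumes "set p \<subseteq> carrier R" "finite S" "S \<subseteq> carrier R" "length p \<le> card S" "\<And>s. s \<in> S \<Longrightarrow> eval p s = \<zero>"
  shows "set p \<subseteq> {\<zero>}"
proof -
  define q where "q = normalize p"
  have q: "q \<in> carrier (poly_ring R)"
    using normalize_gives_polynomial[OF assms(1)] by (simp add: q_def univ_poly_carrier)
  have "q = []"
  proof (rule ccontr)
    assume nz: "q \<noteq> []"
    have "eval q s = \<zero>" if "s \<in> S" for s
      using eval_normalize[OF assms(1), of s] assms that by (auto simp: q_def)
    then have "mset_set S \<subseteq># roots q" using mset_set_roots q nz assms by blast
    then have "card S \<le> size (roots q)" using size_mset_mono by fastforce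
    also have "\<dots> \<le> length q - 1" using size_roots_le_degree[OF q] .
    also have "\<dots> < length p" using nz normalize_length_le[of p]
      by (metis One_nat_def diff_less le_trans length_greater_0_conv less_le_trans lessI q_def)
    finally show False using assms by simp
  qed
  then show ?thesis using normalize_trick[of p] by (metis append_Nil2 q_def set_replicate_conv_if subset_refl empty_subsetI)
qed

text \<open>The multiset of roots has at most as many elements as the degree. If it contains a set
  of that size, the two coincide, which gives simplicity and completeness of the known roots at
  once.\<close>

lemma alg_mult_le_1_of_many_roots:
  assumes "p \<in> carrier (poly_ring R)" "p \<noteq> []" "finite S" "S \<subseteq> carrier R" "\<And>s. s \<in> S \<Longrightarrow> eval p s = \<zero>"
    and "length p - 1 \<le> card S"
  shows "alg_mult p a \<le> 1" "eval p a = \<zero> \<Longrightarrow> a \<in> carrier R \<Longrightarrow> a \<in> S"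
proof -
  have sub: "mset_set S \<subseteq># roots p" using mset_set_roots assms by blast
  have "size (roots p) \<le> size (mset_set S)" using size_roots_le_degree[OF assms(1)] assms by simp
  then have eq: "roots p = mset_set S" using sub
    by (metis leD mset_subset_size subset_mset.le_imp_less_or_eq)
  show "alg_mult p a \<le> 1" using alg_mult_eq_count_roots[OF assms(1)] eq
    by (simp add: count_mset_set')
  assume "eval p a = \<zero>" "a \<in> carrier R"
  then have "a \<in># roots p" using roots_mem_iff_is_root[OF assms(1), of a] assms by (simp add: is_root_def)
  then show "a \<in> S" using eq assms by simp
qed

lemma eval_map2_diff:
  assumes "length p = length q" "set p \<subseteq> carrier R" "set q \<subseteq> carrier R" "x \<in> carrier R"
  shows "eval (map2 (\<lambda>a b. a \<ominus> b) p q) x = eval p x \<ominus> eval q x"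
  using assms
proof (induction p q rule: list_induct2)
  case (Cons a p b q)
  then have c: "a \<in> carrier R" "b \<in> carrier R" "eval p x \<in> carrier R" "eval q x \<in> carrier R"
    "x [^] length q \<in> carrier R" using eval_in_carrier by auto
  show ?case using Cons c by (simp add: minus_eq minus_add l_distr r_distr l_minus a_ac)
qed (simp add: minus_eq)

text \<open>The leading ones are written outside \<open>p\<close> and \<open>q\<close> so that they
  cancel: the difference has no more coefficients than there are roots, hence vanishes.\<close>

lemma monic_unique_of_roots:
  assumes "length p = length q" "length p \<le> card S" "set p \<subseteq> carrier R" "set q \<subseteq> carrier R"
    and "finite S" "S \<subseteq> carrier R" "\<And>s. s \<in> S \<Longrightarrow> eval (\<one> # p) s = \<zero>" "\<And>s. s \<in> S \<Longrightarrow> eval (\<one> # q) s = \<zero>"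
  shows "p = q"
proof -
  define d where "d = map2 (\<lambda>a b. a \<ominus> b) p q"
  have "set d \<subseteq> carrier R" using assms(3,4) by (fastforce simp: d_def dest: set_zip_leftD set_zip_rightD)
  moreover have "eval d s = \<zero>" if "s \<in> S" for s
  proof -
    have s: "s \<in> carrier R" "eval p s \<in> carrier R" "eval q s \<in> carrier R"
      using that assms eval_in_carrier by auto
    have "s [^] length q \<oplus> eval p s = s [^] length q \<oplus> eval q s"
      using assms(7)[OF that] assms(8)[OF that] assms(1) s by simp
    then have "eval p s = eval q s" using s by simp
    then show ?thesis using eval_map2_diff[of p q s] assms s by (simp add: d_def r_neg minus_eq)
  qed
  ultimately have "set d \<subseteq> {\<zero>}" using coeffs_zero_of_many_roots[of d S] assms by (simp add: d_def)
  then have z: "p ! i \<ominus> q ! i = \<zero>" if "i < length p" for i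
    using that assms(1) nth_mem[of i d] by (auto simp: d_def)
  show ?thesis
  proof (rule nth_equalityI)
    fix i assume i: "i < length p"
    then have "p ! i \<in> carrier R" "q ! i \<in> carrier R" using assms nth_mem by (metis subsetD)+
    then show "p ! i = q ! i" using z[OF i] by simp
  qed (use assms in simp)
qed

text \<open>The product of the factors X - s, given by its list of non-leading coefficients as in
  \<open>monic_unique_of_roots\<close>.\<close>

lemma exists_monic_vanishing:
  assumes "subfield M R" "finite S" "S \<subseteq> M"
  shows "\<exists>p. length p = card S \<and> set p \<subseteq> M \<and> (\<forall>s\<in>S. eval (\<one> # p) s = \<zero>)"
  using assms(2,3)
proof (induction S rule: finite_induct)
  case empty
  then show ?case by simp
next
  case (insert s S)
  note Mc = subfieldE(3)[OF assms(1)] and Mr = subringE[OF subfieldE(1)[OF assms(1)]]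
  obtain p where p: "length p = card S" "set p \<subseteq> M" "\<forall>s\<in>S. eval (\<one> # p) s = \<zero>" using insert by blast
  define f where "f = poly_mult [\<one>, \<ominus> s] (\<one> # p)"
  have s: "s \<in> M" "s \<in> carrier R" using insert Mc by auto
  have pp: "polynomial M (\<one> # p)" "polynomial M [\<one>, \<ominus> s]"
    using p s Mr by (auto intro!: polynomialI)
  have fp: "polynomial M f" unfolding f_def
    by (rule poly_mult_closed[OF subfieldE(1)[OF assms(1)] pp(2,1)])
  have len: "length f - 1 = Suc (card S)"
    unfolding f_def using poly_mult_degree_eq[OF subfieldE(1)[OF assms(1)] pp(2,1)] p(1) by (simp del: poly_mult.simps)
  have lc: "hd f = \<one>"
    unfolding f_def using poly_mult_lead_coeff[OF subfieldE(1)[OF assms(1)] pp(2,1)] by (simp del: poly_mult.simps)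
  obtain g where g: "f = \<one> # g" using len lc by (cases f) auto
  have "eval f t = \<zero>" if "t \<in> insert s S" for t
  proof -
    have t: "t \<in> carrier R" using that insert Mc by auto
    have "eval f t = eval [\<one>, \<ominus> s] t \<otimes> eval (\<one> # p) t"
      unfolding f_def by (rule eval_poly_mult) (use t s p Mc in auto)
    moreover have "eval (\<one> # p) t \<in> carrier R" by (rule eval_in_carrier) (use t p Mc in auto)
    ultimately show ?thesis using that p(3) t s by (auto simp: r_neg)
  qed
  moreover have "set g \<subseteq> M" using fp g polynomial_incl by force
  ultimately show ?case using len g insert by auto
qed

section \<open>Simple extensions and their homomorphisms\<close>

text \<open>For algebraic \<open>a\<close> the ring of polynomial expressions in \<open>a\<close> is
  already a field; this makes elements of \<open>adjoin\<close> accessible as values of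
  polynomials.\<close>

lemma adjoin_eq_simple_extension:
  assumes "subfield K R" "a \<in> carrier R" "(algebraic over K) a"
  shows "adjoin R K a = simple_extension K a"
proof -
  have sub: "insert a K \<subseteq> carrier R" using assms subfieldE(3) by blast
  have sf: "subfield (simple_extension K a) R" using simple_extension_is_subfield assms by blast
  show ?thesis unfolding adjoin_def
  proof (rule equalityI)
    show "generate_field R (insert a K) \<subseteq> simple_extension K a"
      by (rule generate_field_min_subfield1[OF sub sf])
        (use simple_extension_incl[of K a] simple_extension_mem[OF subfieldE(1)[OF assms(1)], of a] assms sub in auto)
    show "simple_extension K a \<subseteq> generate_field R (insert a K)"
      by (rule simple_extension_subring_incl[OF subfieldE(1)[OF generate_fieldE(1)[OF sub refl]]])
        (use generate_fieldE(2)[OF sub refl] in auto)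
  qed
qed

lemma adjoin_subfield: "subfield K R \<Longrightarrow> a \<in> carrier R \<Longrightarrow> subfield (adjoin R K a) R"
  unfolding adjoin_def using generate_field_is_subfield[of "insert a K"] subfieldE(3) by blast

lemma adjoin_incl: "K \<subseteq> adjoin R K a" "a \<in> adjoin R K a"
  unfolding adjoin_def by (auto intro: generate_field.incl)

lemma adjoin_subset:
  "subfield K R \<Longrightarrow> subfield E R \<Longrightarrow> K \<subseteq> E \<Longrightarrow> a \<in> E \<Longrightarrow> adjoin R K a \<subseteq> E"
  unfolding adjoin_def by (rule generate_field_min_subfield1) (auto dest: subfieldE(3))

lemma adjoin_elem:
  assumes "subfield K R" "a \<in> carrier R" "(algebraic over K) a" "x \<in> adjoin R K a"
  obtains p where "p \<in> carrier (K[X])" "length p \<le> degree (Irr K a)" "x = eval p a"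
  using assms adjoin_eq_simple_extension[of K a] Span_exp_base[of K a]
    Span_eq_eval_img[of K a "degree (Irr K a)"] by (auto simp: image_iff)

lemma poly_set: "p \<in> carrier (K[X]) \<Longrightarrow> set p \<subseteq> K"
  by (simp add: univ_poly_carrier[symmetric] polynomial_incl)

lemma hom_ring_hom:
  assumes "subfield E R" "h \<in> ring_hom (R\<lparr>carrier := E\<rparr>) R"
  shows "ring_hom_ring (R\<lparr>carrier := E\<rparr>) R h"
  using ring_hom_ringI2[OF subring_is_ring[OF subfieldE(1)[OF assms(1)]] ring_axioms assms(2)] .

lemma hom_simps:
  assumes "h \<in> ring_hom (R\<lparr>carrier := E\<rparr>) R"
  shows "x \<in> E \<Longrightarrow> h x \<in> carrier R" "x \<in> E \<Longrightarrow> y \<in> E \<Longrightarrow> h (x \<otimes> y) = h x \<otimes> h y"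
    "x \<in> E \<Longrightarrow> y \<in> E \<Longrightarrow> h (x \<oplus> y) = h x \<oplus> h y" "h \<one> = \<one>"
  using ring_hom_closed[OF assms] ring_hom_mult[OF assms] ring_hom_add[OF assms] ring_hom_one[OF assms]
  by auto

lemma hom_zero:
  assumes "subfield E R" "h \<in> ring_hom (R\<lparr>carrier := E\<rparr>) R"
  shows "h \<zero> = \<zero>"
  using ring_hom_zero[OF assms(2) subring_is_ring[OF subfieldE(1)[OF assms(1)]] ring_axioms] by simp

lemma hom_inj:
  assumes "subfield E R" "h \<in> ring_hom (R\<lparr>carrier := E\<rparr>) R"
  shows "inj_on h E"
  using non_trivial_field_hom_is_inj[OF assms(2) subfield_iff(2)[OF assms(1)] field_axioms] by simp

lemma hom_pow:
  assumes "subfield E R" "h \<in> ring_hom (R\<lparr>carrier := E\<rparr>) R" "x \<in> E"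
  shows "h (x [^] (n::nat)) = h x [^] n" "x [^] n \<in> E"
proof -
  note Er = subringE[OF subfieldE(1)[OF assms(1)]]
  have "h (x [^] n) = h x [^] n \<and> x [^] n \<in> E"
    by (induction n) (use hom_simps[OF assms(2)] assms Er in auto)
  then show "h (x [^] (n::nat)) = h x [^] n" "x [^] n \<in> E" by auto
qed

lemma subfield_pow: "subfield E R \<Longrightarrow> x \<in> E \<Longrightarrow> x [^] (n::nat) \<in> E"
  by (induction n) (auto simp: subringE[OF subfieldE(1)])

lemma hom_eval:
  assumes "subfield E R" "h \<in> ring_hom (R\<lparr>carrier := E\<rparr>) R" "set p \<subseteq> E" "x \<in> E"
  shows "h (eval p x) = eval (map h p) (h x)"
  using ring_hom_ring.eval_hom'[OF hom_ring_hom[OF assms(1,2)], of x p] assms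
    eval_consistent[OF subfieldE(1)[OF assms(1)]] by simp

lemma hom_eval_fix:
  assumes "subfield E R" "h \<in> ring_hom (R\<lparr>carrier := E\<rparr>) R" "set p \<subseteq> K" "K \<subseteq> E" "\<And>c. c \<in> K \<Longrightarrow> h c = c" "x \<in> E"
  shows "h (eval p x) = eval p (h x)"
proof -
  have "map h p = p" using assms(3,5) by (simp add: map_idI subset_iff)
  then show ?thesis using hom_eval[OF assms(1,2), of p x] assms by auto
qed

lemma hom_image_subfield:
  assumes "subfield E R" "h \<in> ring_hom (R\<lparr>carrier := E\<rparr>) R"
  shows "subfield (h ` E) R"
  using ring_hom_ring.img_is_subfield(2)[OF hom_ring_hom[OF assms], of E]
    ring.carrier_is_subring field.carrier_is_subfield[OF subfield_iff(2)[OF assms(1)]] by simp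

text \<open>The value of a polynomial at \<open>a\<close> is sent to the value at \<open>b\<close>
  of its image under \<open>h\<close>. Polynomials that agree at \<open>a\<close> differ by a
  multiple of the minimal polynomial, whose image vanishes at \<open>b\<close>, so the rule is
  consistent.\<close>

lemma extend_hom:
  assumes F: "subfield E R" and a: "a \<in> carrier R" "(algebraic over E) a"
    and h: "h \<in> ring_hom (R\<lparr>carrier := E\<rparr>) R" and b: "b \<in> carrier R" "eval (map h (Irr E a)) b = \<zero>"
  shows "\<exists>g\<in>ring_hom (R\<lparr>carrier := adjoin R E a\<rparr>) R. (\<forall>x\<in>E. g x = h x) \<and> g a = b"
proof -
  note Er = subfieldE(1)[OF F]
  interpret H: ring_hom_ring "R\<lparr>carrier := E\<rparr>" R h by (rule hom_ring_hom[OF F h])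
  interpret U: domain "E[X]" by (rule univ_poly_is_domain[OF Er])
  define ev where "ev p = eval (map h p) b" for p
  have hc: "set (map h p) \<subseteq> carrier R" if "set p \<subseteq> E" for p using that hom_simps(1)[OF h] by auto
  have ps: "set p \<subseteq> E" if "p \<in> carrier (E[X])" for p using that poly_set by blast
  have evm: "ev (p \<otimes>\<^bsub>E[X]\<^esub> q) = ev p \<otimes> ev q" if pq: "p \<in> carrier (E[X])" "q \<in> carrier (E[X])" for p q
  proof -
    have "normalize (map h (poly_mult p q)) = poly_mult (map h p) (map h q)"
      using H.poly_mult_hom'[of p q] ps pq poly_mult_consistent[OF Er] by simp
    moreover have "set (map h (poly_mult p q)) \<subseteq> carrier R"
      using hc polynomial_incl[OF poly_mult_is_polynomial[OF Er ps[OF pq(1)] ps[OF pq(2)]]] by simp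
    ultimately have "eval (map h (poly_mult p q)) b = eval (poly_mult (map h p) (map h q)) b"
      using eval_normalize[of "map h (poly_mult p q)" b] b by metis
    then show ?thesis using eval_poly_mult[OF hc[OF ps[OF pq(1)]] hc[OF ps[OF pq(2)]] b(1)] by (simp add: ev_def univ_poly_mult)
  qed
  have eva: "ev (p \<oplus>\<^bsub>E[X]\<^esub> q) = ev p \<oplus> ev q" if pq: "p \<in> carrier (E[X])" "q \<in> carrier (E[X])" for p q
  proof -
    have "normalize (map h (poly_add p q)) = poly_add (map h p) (map h q)"
      using H.poly_add_hom'[of p q] ps pq poly_add_consistent[OF Er] by simp
    moreover have "set (map h (poly_add p q)) \<subseteq> carrier R"
      using hc polynomial_incl[OF poly_add_is_polynomial[OF Er ps[OF pq(1)] ps[OF pq(2)]]] by simp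
    ultimately have "eval (map h (poly_add p q)) b = eval (poly_add (map h p) (map h q)) b"
      using eval_normalize[of "map h (poly_add p q)" b] b by metis
    then show ?thesis using eval_poly_add[OF hc[OF ps[OF pq(1)]] hc[OF ps[OF pq(2)]] b(1)] by (simp add: ev_def univ_poly_add)
  qed
  have evc: "ev p \<in> carrier R" if "p \<in> carrier (E[X])" for p
    unfolding ev_def using eval_in_carrier hc ps that b by blast
  have ev0: "ev p = \<zero>" if p: "p \<in> carrier (E[X])" "eval p a = \<zero>" for p
  proof -
    have I: "Irr E a \<in> carrier (E[X])" using IrrE(1)[OF F a] .
    have "Irr E a divides\<^bsub>E[X]\<^esub> p"
      using Irr_minimal[OF F a p] pdivides_iff_shell[OF F I p(1)] by simp
    then obtain q where q: "q \<in> carrier (E[X])" "p = Irr E a \<otimes>\<^bsub>E[X]\<^esub> q" by (auto simp: factor_def)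
    then show ?thesis using evm[OF I q(1)] b evc[OF q(1)] by (simp add: ev_def)
  qed
  have eveq: "ev p = ev q" if p: "p \<in> carrier (E[X])" "q \<in> carrier (E[X])" "eval p a = eval q a" for p q
  proof -
    let ?m = "\<ominus>\<^bsub>E[X]\<^esub> q"
    have mq: "?m \<in> carrier (E[X])" using p by simp
    have ea: "eval (r \<oplus>\<^bsub>E[X]\<^esub> t) a = eval r a \<oplus> eval t a" if "r \<in> carrier (E[X])" "t \<in> carrier (E[X])" for r t
    proof -
      have "set r \<subseteq> carrier R" "set t \<subseteq> carrier R" using ps that subfieldE(3)[OF F] by blast+
      then show ?thesis using eval_poly_add[of r t a] a by (simp add: univ_poly_add)
    qed
    have z: "q \<oplus>\<^bsub>E[X]\<^esub> ?m = []" using U.r_neg[OF p(2)] by (simp add: univ_poly_zero)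
    have "eval (p \<oplus>\<^bsub>E[X]\<^esub> ?m) a = eval (q \<oplus>\<^bsub>E[X]\<^esub> ?m) a" using ea p mq by simp
    also have "\<dots> = \<zero>" using z by simp
    finally have 1: "ev (p \<oplus>\<^bsub>E[X]\<^esub> ?m) = \<zero>" using ev0[of "p \<oplus>\<^bsub>E[X]\<^esub> ?m"] p mq by simp
    have 2: "ev (q \<oplus>\<^bsub>E[X]\<^esub> ?m) = \<zero>" using z by (simp add: ev_def)
    have "ev p \<oplus> ev ?m = ev q \<oplus> ev ?m" using 1 2 eva p mq by simp
    then show ?thesis using evc p mq by simp
  qed
  \<comment> \<open>An arbitrary polynomial representing \<open>x\<close> is chosen; by
    \<open>eveq\<close> the result is independent of the choice.\<close>
  define g where "g x = ev (SOME p. p \<in> carrier (E[X]) \<and> eval p a = x)" for x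
  have g: "g (eval p a) = ev p" if "p \<in> carrier (E[X])" for p
  proof -
    have "\<exists>r. r \<in> carrier (E[X]) \<and> eval r a = eval p a" using that by blast
    from someI_ex[OF this] show ?thesis unfolding g_def using eveq that by blast
  qed
  have img: "adjoin R E a = (\<lambda>p. eval p a) ` carrier (E[X])"
    using adjoin_eq_simple_extension[OF F a] simple_extension_as_eval_img[OF subfieldE(3)[OF F] a(1)] by simp
  note evh = eval_is_hom[OF Er a(1)]
  have gh: "g \<in> ring_hom (R\<lparr>carrier := adjoin R E a\<rparr>) R"
  proof (rule ring_hom_memI)
    fix x y assume "x \<in> carrier (R\<lparr>carrier := adjoin R E a\<rparr>)" "y \<in> carrier (R\<lparr>carrier := adjoin R E a\<rparr>)"
    then obtain p q where p: "p \<in> carrier (E[X])" "x = eval p a" and q: "q \<in> carrier (E[X])" "y = eval q a"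
      by (auto simp: img)
    show "g x \<in> carrier R" using g p evc by simp
    have "x \<otimes> y = eval (p \<otimes>\<^bsub>E[X]\<^esub> q) a" "x \<oplus> y = eval (p \<oplus>\<^bsub>E[X]\<^esub> q) a"
      using ring_hom_mult[OF evh p(1) q(1)] ring_hom_add[OF evh p(1) q(1)] p q by auto
    then show "g (x \<otimes>\<^bsub>R\<lparr>carrier := adjoin R E a\<rparr>\<^esub> y) = g x \<otimes> g y" "g (x \<oplus>\<^bsub>R\<lparr>carrier := adjoin R E a\<rparr>\<^esub> y) = g x \<oplus> g y"
      using g evm eva p q by auto
  next
    have "[\<one>] \<in> carrier (E[X])" using one_is_polynomial[OF Er] by (simp add: univ_poly_carrier)
    then show "g \<one>\<^bsub>R\<lparr>carrier := adjoin R E a\<rparr>\<^esub> = \<one>"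
      using g[of "[\<one>]"] a b hom_simps(4)[OF h] by (simp add: ev_def)
  qed
  moreover have "g x = h x" if x: "x \<in> E" for x
  proof (cases "x = \<zero>")
    case True
    have "[] \<in> carrier (E[X])" by blast
    then have "g \<zero> = \<zero>" using g[of "[]"] by (simp add: ev_def)
    then show ?thesis using True hom_zero[OF F h] by simp
  next
    case False
    then have "[x] \<in> carrier (E[X])" using x const_is_polynomial by (simp add: univ_poly_carrier[symmetric])
    moreover have "x \<in> carrier R" using x subfieldE(3)[OF F] by blast
    ultimately show ?thesis using g[of "[x]"] a b hom_simps(1)[OF h x] by (simp add: ev_def)
  qed
  moreover have "g a = b"
  proof -
    have "[\<one>, \<zero>] \<in> carrier (E[X])" using var_closed(1)[OF Er] by (simp add: var_def)
    then show ?thesis using g[of "[\<one>, \<zero>]"] a b hom_simps(4)[OF h] hom_zero[OF F h] by (simp add: ev_def)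
  qed
  ultimately show ?thesis by blast
qed

section \<open>A criterion for Galois extensions\<close>

lemma hom_conjugate_mem_normal:
  assumes K: "subfield K R" and "normal_subextension R K E" "x \<in> E" "subfield A R" "K \<subseteq> A" "x \<in> A"
    "(algebraic over K) x" "h \<in> ring_hom (R\<lparr>carrier := A\<rparr>) R" "\<And>c. c \<in> K \<Longrightarrow> h c = c"
  shows "h x \<in> E" "is_root (Irr K x) (h x)"
proof -
  have xc: "x \<in> carrier R" using assms subfieldE(3) by blast
  note I = IrrE[OF K xc assms(7)]
  have "eval (Irr K x) (h x) = h \<zero>"
    using hom_eval_fix[OF assms(4,8) poly_set[OF I(1)] assms(5,9,6)] I(4) by simp
  then show r: "is_root (Irr K x) (h x)" unfolding is_root_def
    using hom_zero[OF assms(4,8)] hom_simps(1)[OF assms(8,6)] pirreducibleE(1)[OF subfieldE(1)[OF K] I(1,2)] by simp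
  then show "h x \<in> E" using assms(2,3) by (auto simp: normal_subextension_def)
qed

text \<open>Artin's argument. The orbit of \<open>x\<close> under the self-embeddings of
  \<open>M\<close> over \<open>K\<close> consists of roots of the minimal polynomial, hence is
  finite. The monic polynomial with exactly this orbit as simple roots is invariant, so its
  coefficients are fixed and lie in \<open>K\<close>. The minimal polynomial divides it and inherits
  both simplicity of the roots and their membership in \<open>M\<close>.\<close>

lemma galois_of_fixed_field:
  assumes K: "subfield K R" and M: "subfield M R" and KM: "K \<subseteq> M"
    and alg: "\<And>x. x \<in> M \<Longrightarrow> (algebraic over K) x"
    and fixed: "\<And>x. x \<in> M \<Longrightarrow> (\<And>g. g \<in> ring_hom (R\<lparr>carrier := M\<rparr>) R \<Longrightarrow> g ` M \<subseteq> M \<Longrightarrow> (\<forall>c\<in>K. g c = c) \<Longrightarrow> g x = x) \<Longrightarrow> x \<in> K"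
  shows "galois_subextension R K M"
proof -
  define G where "G = {g \<in> ring_hom (R\<lparr>carrier := M\<rparr>) R. g ` M \<subseteq> M \<and> (\<forall>c\<in>K. g c = c)}"
  have Mc: "M \<subseteq> carrier R" using subfieldE(3)[OF M] .
  have Gid: "id \<in> G" using Mc by (auto simp: G_def ring_hom_def)
  have Gcomp: "g \<circ> h \<in> G" if "g \<in> G" "h \<in> G" for g h
    using that unfolding G_def ring_hom_def by (auto simp: image_subset_iff Pi_iff)
  have key: "\<exists>S. finite S \<and> S \<subseteq> M \<and> (\<exists>f \<in> carrier (K[X]). f \<noteq> [] \<and> length f = Suc (card S) \<and> (\<forall>s\<in>S. eval f s = \<zero>)
     \<and> Irr K x pdivides f)" if x: "x \<in> M" for x
  proof -
    have xc: "x \<in> carrier R" using x Mc by blast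
    note I = IrrE[OF K xc alg[OF x]]
    define S where "S = (\<lambda>g. g x) ` G"
    have SM: "S \<subseteq> M" using x by (auto simp: S_def G_def)
    have "S \<subseteq> {a. is_root (Irr K x) a}"
    proof
      fix s assume "s \<in> S"
      then obtain g where g: "g \<in> G" "s = g x" by (auto simp: S_def)
      have "eval (Irr K x) s = g \<zero>"
        using hom_eval_fix[OF M _ poly_set[OF I(1)] KM _ x, of g] g I(4) by (auto simp: G_def)
      then have "eval (Irr K x) s = \<zero>" using hom_zero[OF M, of g] g by (simp add: G_def)
      then show "s \<in> {a. is_root (Irr K x) a}" unfolding is_root_def
        using \<open>s \<in> S\<close> SM Mc pirreducibleE(1)[OF subfieldE(1)[OF K] I(1,2)] by auto
    qed
    then have fS: "finite S"
      using finite_number_of_roots[OF carrier_polynomial_shell[OF subfieldE(1)[OF K] I(1)]] finite_subset by blast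
    obtain p where p: "length p = card S" "set p \<subseteq> M" "\<forall>s\<in>S. eval (\<one> # p) s = \<zero>"
      using exists_monic_vanishing[OF M fS SM] by blast
    have "c \<in> K" if c: "c \<in> set p" for c
    proof (rule fixed)
      show "c \<in> M" using c p by blast
      fix g assume "g \<in> ring_hom (R\<lparr>carrier := M\<rparr>) R" "g ` M \<subseteq> M" "\<forall>c\<in>K. g c = c"
      then have g: "g \<in> G" by (simp add: G_def)
      have gh: "g \<in> ring_hom (R\<lparr>carrier := M\<rparr>) R" using g by (simp add: G_def)
      have "g ` S \<subseteq> S"
      proof
        fix y assume "y \<in> g ` S"
        then obtain h where h: "h \<in> G" "y = (g \<circ> h) x" by (auto simp: S_def)
        then show "y \<in> S" using Gcomp[OF g h(1)] unfolding S_def by blast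
      qed
      moreover have "inj_on g S" using hom_inj[OF M gh] SM inj_on_subset by blast
      \<comment> \<open>Self-embeddings form a monoid only, but an injective map of a finite orbit
        into itself is a permutation.\<close>
      ultimately have gS: "g ` S = S" using fS endo_inj_surj by blast
      have "map g p = p"
      proof (rule monic_unique_of_roots[of _ _ S])
        show "set (map g p) \<subseteq> carrier R" using hom_simps(1)[OF gh] p by auto
        fix s assume "s \<in> S"
        show "eval (\<one> # p) s = \<zero>" using p \<open>s \<in> S\<close> by blast
        obtain t where t: "t \<in> S" "s = g t" using gS \<open>s \<in> S\<close> by blast
        have "\<one> \<in> M" using subringE(3)[OF subfieldE(1)[OF M]] .
        then have "eval (map g (\<one> # p)) (g t) = g (eval (\<one> # p) t)"
          using hom_eval[OF M gh, of "\<one> # p" t] p t SM by auto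
        then show "eval (\<one> # map g p) s = \<zero>" using p t hom_simps(4)[OF gh] hom_zero[OF M gh] by simp
      qed (use p fS SM Mc in auto)
      then show "g c = c" using c by (metis map_eq_conv map_ident)
    qed
    then have "set (\<one> # p) \<subseteq> K" using subringE(3)[OF subfieldE(1)[OF K]] by auto
    then have f: "\<one> # p \<in> carrier (K[X])" by (simp add: univ_poly_carrier[symmetric] polynomial_def)
    have "x \<in> S" unfolding S_def using Gid by (metis id_apply imageI)
    then have "Irr K x pdivides (\<one> # p)" using Irr_minimal[OF K xc alg[OF x] f] p by blast
    then show ?thesis using fS SM f p by (intro exI[of _ S] conjI bexI[of _ "\<one> # p"]) auto
  qed
  have both: "alg_mult (Irr K x) a \<le> 1 \<and> (is_root (Irr K x) a \<longrightarrow> a \<in> M)" if x: "x \<in> M" for x a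
  proof -
    have xc: "x \<in> carrier R" using x Mc by blast
    note I = IrrE[OF K xc alg[OF x]]
    note Ic = carrier_polynomial_shell[OF subfieldE(1)[OF K] I(1)]
    obtain S f where S: "finite S" "S \<subseteq> M" and f: "f \<in> carrier (K[X])" "f \<noteq> []" "length f = Suc (card S)"
      "\<forall>s\<in>S. eval f s = \<zero>" "Irr K x pdivides f" using key[OF x] by blast
    note fc = carrier_polynomial_shell[OF subfieldE(1)[OF K] f(1)]
    have SC: "S \<subseteq> carrier R" using S Mc by blast
    have 1: "alg_mult f a \<le> 1" "eval f a = \<zero> \<Longrightarrow> a \<in> carrier R \<Longrightarrow> a \<in> S"
      using alg_mult_le_1_of_many_roots[OF fc f(2) S(1) SC, of a] f(3,4) by auto
    have "roots (Irr K x) \<subseteq># roots f" using pdivides_imp_roots_incl[OF Ic fc f(2,5)] .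
    then have "alg_mult (Irr K x) a \<le> alg_mult f a"
      using alg_mult_eq_count_roots[OF Ic] alg_mult_eq_count_roots[OF fc] by (simp add: mset_subset_eq_count)
    moreover have "a \<in> M" if "is_root (Irr K x) a"
      using 1(2) that pdivides_imp_root_sharing[OF Ic f(5), of a] S by (auto simp: is_root_def)
    ultimately show ?thesis using 1(1) by auto
  qed
  then show ?thesis
    using M KM by (auto simp: galois_subextension_def separable_subextension_def normal_subextension_def)
qed

end

section \<open>Subrings, dimensions and counting\<close>

lemma (in ring) subring_a_inv: "subring S R \<Longrightarrow> x \<in> S \<Longrightarrow> \<ominus>\<^bsub>R\<lparr>carrier := S\<rparr>\<^esub> x = \<ominus> x"
proof -
  assume a: "subring S R" "x \<in> S"
  interpret S: ring "R\<lparr>carrier := S\<rparr>" by (rule subring_is_ring[OF a(1)])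
  have c: "x \<in> carrier R" "\<ominus>\<^bsub>R\<lparr>carrier := S\<rparr>\<^esub> x \<in> carrier R"
    using a subringE(1)[OF a(1)] S.a_inv_closed[of x] by auto
  have "(\<ominus>\<^bsub>R\<lparr>carrier := S\<rparr>\<^esub> x) \<oplus> x = \<zero>" using S.l_neg[of x] a by simp
  then show ?thesis using c minus_equality by metis
qed

lemma (in ring) subring_a_minus:
  "subring S R \<Longrightarrow> x \<in> S \<Longrightarrow> y \<in> S \<Longrightarrow> x \<ominus>\<^bsub>R\<lparr>carrier := S\<rparr>\<^esub> y = x \<ominus> y"
  using subring_a_inv by (simp add: a_minus_def)

lemma (in cring) add_diff_swap:
  assumes "a \<in> carrier R" "b \<in> carrier R" "x \<in> carrier R" "y \<in> carrier R" "a \<oplus> x = b \<oplus> y"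
  shows "a \<ominus> b = y \<ominus> x"
proof -
  have "a \<ominus> b = (a \<oplus> x) \<oplus> (\<ominus> x \<oplus> \<ominus> b)" using assms(1-4) by (simp add: minus_eq a_assoc r_neg2)
  also have "\<dots> = (y \<oplus> b) \<oplus> (\<ominus> b \<oplus> \<ominus> x)" using assms by (simp add: a_comm)
  also have "\<dots> = y \<ominus> x" using assms(1-4) by (simp add: minus_eq a_assoc r_neg2)
  finally show ?thesis .
qed

lemma (in cring) card_of_dimension:
  assumes "subfield K R" "finite K" "dimension n K E"
  shows "finite E \<and> card E = card K ^ n"
  using assms(3)
proof (induction n arbitrary: E)
  case 0
  then have "E = {\<zero>}" using dimension_zero[OF assms(1)] by blast
  then show ?case by simp
next
  case (Suc n E')
  obtain v E where Suc_dim: "v \<in> carrier R" "v \<notin> E" "dimension n K E" and E': "E' = line_extension K v E"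
    using dimension_backwards[OF assms(1) Suc.prems] by blast
  note E = space_subgroup_props[OF assms(1) Suc_dim(3)]
  note Kr = subringE[OF subfieldE(1)[OF assms(1)]]
  have vc: "v \<in> carrier R" "K \<subseteq> carrier R" "E \<subseteq> carrier R" using Suc_dim Kr E by auto
  have "inj_on (\<lambda>(k, x). k \<otimes> v \<oplus> x) (K \<times> E)"
  proof (rule inj_onI, clarify)
    fix k x k' x' assume a: "k \<in> K" "x \<in> E" "k' \<in> K" "x' \<in> E" "k \<otimes> v \<oplus> x = k' \<otimes> v \<oplus> x'"
    then have c: "k \<in> carrier R" "k' \<in> carrier R" "x \<in> carrier R" "x' \<in> carrier R" using vc by auto
    have "(k \<ominus> k') \<otimes> v = k \<otimes> v \<ominus> k' \<otimes> v"
      using c vc(1) by (simp add: minus_eq l_distr l_minus)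
    also have "\<dots> = x' \<ominus> x" using add_diff_swap[of "k \<otimes> v" "k' \<otimes> v" x x'] a c vc(1) by simp
    finally have e: "(k \<ominus> k') \<otimes> v = x' \<ominus> x" .
    have "x' \<ominus> x \<in> E" unfolding a_minus_def using a E by blast
    then have "(k \<ominus> k') \<otimes> v \<in> E" using e by simp
    moreover have "k \<ominus> k' \<in> K" unfolding a_minus_def using a Kr(5,7) by simp
    ultimately have "k \<ominus> k' = \<zero>" using E(6)[of "k \<ominus> k'" v] Suc_dim(1,2) by (metis DiffI singletonD)
    then have kk: "k = k'" using c by simp
    then show "k = k' \<and> x = x'" using a c vc by simp
  qed
  moreover have "line_extension K v E = (\<lambda>(k, x). k \<otimes> v \<oplus> x) ` (K \<times> E)"
    unfolding set_eq_iff line_extension_mem_iff image_iff by (simp add: split_def)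
  ultimately show ?case using Suc.IH[OF Suc_dim(3)] assms(2) E' by (simp add: card_image card_cartesian_product)
qed

text \<open>Serves to refute an infinite residue degree: a long independent family of residues would
  lift to one that is too long over \<open>K\<close>.\<close>

lemma (in ring) independent_of_infinite_dimension:
  assumes "subfield K R" "\<not> finite_dimension K (carrier R)"
  shows "\<exists>us. length us = m \<and> independent K us"
proof (induction m)
  case 0
  then show ?case by (intro exI[of _ "[]"]) simp
next
  case (Suc m)
  then obtain us where us: "length us = m" "independent K us" by blast
  have "finite_dimension K (Span K us)"
    using Span_finite_dimension[OF assms(1) independent_in_carrier[OF us(2)]] .
  then have "Span K us \<noteq> carrier R" using assms(2) by auto
  then obtain x where "x \<in> carrier R" "x \<notin> Span K us"
    using Span_in_carrier[of K us] subfieldE(3)[OF assms(1)] independent_in_carrier[OF us(2)] by blast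
  then have "independent K (x # us)" using us by (intro li_Cons)
  then show ?case using us by (intro exI[of _ "x # us"]) simp
qed

text \<open>The residue of an element of \<open>K\<close> is a coset in \<open>K\<close> or a coset
  in the larger field. Two maps that identify the same pairs have equinumerous images, which
  compares the two residue fields of \<open>K\<close> by size.\<close>

lemma card_image_eq_of_kernel_eq:
  assumes "\<And>x y. x \<in> A \<Longrightarrow> y \<in> A \<Longrightarrow> f x = f y \<longleftrightarrow> g x = g y"
  shows "card (f ` A) = card (g ` A)" "finite (f ` A) \<longleftrightarrow> finite (g ` A)"
proof -
  have inv: "inv_into A f (f x) \<in> A \<and> f (inv_into A f (f x)) = f x" if "x \<in> A" for x
    using that f_inv_into_f inv_into_into by (metis imageI)
  have "bij_betw (\<lambda>z. g (inv_into A f z)) (f ` A) (g ` A)"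
  proof (rule bij_betw_imageI)
    show "inj_on (\<lambda>z. g (inv_into A f z)) (f ` A)"
      using inv assms by (intro inj_onI) (metis (no_types, lifting) imageE)
    show "(\<lambda>z. g (inv_into A f z)) ` f ` A = g ` A"
    proof
      show "(\<lambda>z. g (inv_into A f z)) ` f ` A \<subseteq> g ` A" using inv by blast
      show "g ` A \<subseteq> (\<lambda>z. g (inv_into A f z)) ` f ` A"
      proof
        fix y assume "y \<in> g ` A"
        then obtain x where "x \<in> A" "y = g x" by blast
        then show "y \<in> (\<lambda>z. g (inv_into A f z)) ` f ` A" using inv assms by (metis imageI)
      qed
    qed
  qed
  then show "card (f ` A) = card (g ` A)" "finite (f ` A) \<longleftrightarrow> finite (g ` A)"
    using bij_betw_same_card bij_betw_finite by blast+
qed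

section \<open>Extensions of complete discretely valued fields\<close>

text \<open>The extension is the whole ring \<open>F\<close> and \<open>K\<close> a subset of it, so
  spans and dimensions can be formed inside \<open>F\<close>. An extension within \<Omega> enters as
  \<Omega> with restricted carrier.\<close>

locale valued_extension = normalised_valuation F w for F (structure) and w +
  fixes K :: "'a set" and u :: "'a \<Rightarrow> int" and e :: nat
  assumes K: "subfield K F" and K_local: "local_field (F\<lparr>carrier := K\<rparr>) u"
    and e_pos: "0 < e" and val_K: "x \<in> K - {\<zero>} \<Longrightarrow> w x = int e * u x"
begin

sublocale Kl: local_field "F\<lparr>carrier := K\<rparr>" u by (rule K_local)

lemmas K_ring = subfieldE(1)[OF K]
lemmas K_closed = subringE[OF K_ring]

lemma K_carrier: "x \<in> K \<Longrightarrow> x \<in> carrier F"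
  using K_closed(1) by blast

lemma K_minus: "x \<in> K \<Longrightarrow> y \<in> K \<Longrightarrow> x \<ominus> y \<in> K"
  unfolding a_minus_def using K_closed(5,7) by simp

lemma K_inv: "x \<in> K \<Longrightarrow> x \<noteq> \<zero> \<Longrightarrow> inv x \<in> K" "x \<in> K \<Longrightarrow> x \<noteq> \<zero> \<Longrightarrow> inv x \<noteq> \<zero>"
  "x \<in> K \<Longrightarrow> x \<noteq> \<zero> \<Longrightarrow> x \<otimes> inv x = \<one>" "x \<in> K \<Longrightarrow> x \<noteq> \<zero> \<Longrightarrow> inv x \<otimes> x = \<one>"
  using subfield_m_inv[OF K, of x] by auto

lemma K_ball: "x \<in> K \<Longrightarrow> x \<in> vball (F\<lparr>carrier := K\<rparr>) u n \<longleftrightarrow> x \<in> B (int e * n)"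
  using val_K[of x] e_pos K_carrier by (auto simp: vball_def)

lemma K_ball_0: "x \<in> K \<Longrightarrow> x \<in> vball (F\<lparr>carrier := K\<rparr>) u 0 \<longleftrightarrow> x \<in> B 0"
  using K_ball[of x 0] by simp

text \<open>\<open>K_ball\<close> would put the ball of radius \<open>e\<close> on the right. Values
  on \<open>K\<close> are multiples of \<open>e\<close>, so radius 1 cuts out the same elements, and
  the maximal ideals correspond.\<close>

lemma K_ball_1: "x \<in> K \<Longrightarrow> x \<in> vball (F\<lparr>carrier := K\<rparr>) u 1 \<longleftrightarrow> x \<in> B 1"
proof -
  assume x: "x \<in> K"
  have "0 < int e * u x \<longleftrightarrow> 0 < u x" using e_pos by (simp add: zero_less_mult_iff)
  then show ?thesis using val_K[of x] x K_carrier by (auto simp: vball_def)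
qed

lemma K_ball_carrier: "x \<in> vball (F\<lparr>carrier := K\<rparr>) u n \<Longrightarrow> x \<in> K"
  using Kl.vball_carrier by simp

lemma K_ball_eq: "Kl.B 0 = K \<inter> B 0"
  using K_ball_0 K_ball_carrier by blast

lemma K_close: "x \<in> K \<Longrightarrow> y \<in> K \<Longrightarrow> val_close (F\<lparr>carrier := K\<rparr>) u n x y \<longleftrightarrow> x \<ominus> y \<in> B (int e * n)"
  using Kl.val_close_iff[of x y n] K_ball[of "x \<ominus> y" n] K_minus subring_a_minus[OF K_ring] by simp

text \<open>Limits of sequences with a prescribed linear rate of convergence stay in \<open>S\<close>, with the same
  rate; the rate is what allows induction over a spanning list.\<close>
definition gclosed where "gclosed S \<longleftrightarrow>
  (\<forall>s c. (\<forall>n::nat. s n \<in> S) \<longrightarrow> (\<forall>n. s (Suc n) \<ominus> s n \<in> B (int n - c)) \<longrightarrow>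
    (\<exists>l\<in>S. \<forall>n. s n \<ominus> l \<in> B (int n - c)))"

lemma gclosedD: "gclosed S \<Longrightarrow> (\<And>n::nat. s n \<in> S) \<Longrightarrow> (\<And>n. s (Suc n) \<ominus> s n \<in> B (int n - c))
  \<Longrightarrow> \<exists>l\<in>S. \<forall>n. s n \<ominus> l \<in> B (int n - c)"
  unfolding gclosed_def by blast

lemma gclosed_K: "gclosed K"
  unfolding gclosed_def
proof (intro allI impI)
  fix s c assume s: "\<forall>n::nat. s n \<in> K" "\<forall>n. s (Suc n) \<ominus> s n \<in> B (int n - c)"
  have sc: "s n \<in> carrier F" for n using s K_carrier by blast
  have "\<forall>N. \<exists>M. \<forall>m\<ge>M. \<forall>n\<ge>M. val_close (F\<lparr>carrier := K\<rparr>) u N (s m) (s n)"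
    using geometric_cauchy[of s c] sc s K_close by simp
  then obtain l where l: "l \<in> K" "\<forall>N. \<exists>M. \<forall>n\<ge>M. val_close (F\<lparr>carrier := K\<rparr>) u N (s n) l"
    using Kl.complete[of s] s by auto
  have "\<exists>M. \<forall>n\<ge>M. s n \<ominus> l \<in> B N" for N
  proof -
    \<comment> \<open>The absolute value takes care of negative \<open>N\<close>, for which int e *
      N may lie below \<open>N\<close>.\<close>
    obtain M where M: "\<forall>n\<ge>M. val_close (F\<lparr>carrier := K\<rparr>) u \<bar>N\<bar> (s n) l" using l by blast
    have "N \<le> \<bar>N\<bar>" "1 * \<bar>N\<bar> \<le> int e * \<bar>N\<bar>" using e_pos by (simp, intro mult_right_mono) auto
    then have "N \<le> int e * \<bar>N\<bar>" by linarith
    then have "s n \<ominus> l \<in> B N" if "M \<le> n" for n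
      using M that s l K_close[of "s n" l "\<bar>N\<bar>"] vball_antimono by blast
    then show ?thesis by blast
  qed
  then have "s n \<ominus> l \<in> B (int n - c)" for n
    using geometric_limit_rate[of s c l n] sc s l K_carrier by blast
  then show "\<exists>l\<in>K. \<forall>n. s n \<ominus> l \<in> B (int n - c)" using l by blast
qed

text \<open>By induction the span \<open>S\<close> of the tail is closed, so a vector
  \<open>a\<close> outside it keeps a bounded distance from it. The coefficient of \<open>a\<close>
  in a small vector is then small up to a constant shift, and the coordinates converge separately.
  Their rates are worse than the given one, which is restored at the end by
  \<open>geometric_limit_rate\<close>.\<close>

lemma gclosed_Span: "set us \<subseteq> carrier F \<Longrightarrow> gclosed (Span K us)"
proof (induction us)
  case Nil
  have "\<exists>l\<in>{\<zero>}. \<forall>n. s n \<ominus> l \<in> B (int n - c)" if "\<forall>n::nat. s n \<in> {\<zero>}" for s c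
    using that by (simp add: minus_eq)
  then show ?case unfolding gclosed_def by simp
next
  case (Cons a us)
  define S where "S = Span K us"
  have us: "set us \<subseteq> carrier F" and a: "a \<in> carrier F" using Cons by auto
  have gS: "gclosed S" using Cons us by (simp add: S_def)
  note Sp = Span_subgroup_props[OF K us, folded S_def] and Sm = Span_smult_closed[OF K us, folded S_def]
  have Sc: "x \<in> carrier F" if "x \<in> S" for x using Sp that by blast
  have le: "Span K (a # us) = line_extension K a S" by (simp add: S_def)
  show ?case
  proof (cases "a \<in> S")
    case True
    have "line_extension K a S = S"
    proof
      show "line_extension K a S \<subseteq> S" using Sp Sm True by (auto simp: line_extension_mem_iff)
      show "S \<subseteq> line_extension K a S"
        using K_closed(2) a Sc by (force simp: line_extension_mem_iff)
    qed
    then show ?thesis using gS le by simp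
  next
    case aS: False
    have anz: "a \<noteq> \<zero>" using aS Sp by blast
    \<comment> \<open>Otherwise elements of \<open>S\<close> would approach \<open>a\<close> at a
      linear rate, and closedness of \<open>S\<close> would put \<open>a\<close> into it.\<close>
    have "\<exists>N. \<forall>y\<in>S. a \<oplus> y \<notin> B N"
    proof (rule ccontr)
      assume "\<nexists>N. \<forall>y\<in>S. a \<oplus> y \<notin> B N"
      then have "\<forall>n. \<exists>y\<in>S. a \<oplus> y \<in> B (int n)" by blast
      then obtain y where y: "\<And>n. y n \<in> S" "\<And>n. a \<oplus> y n \<in> B (int n)" by metis
      define t where "t n = \<ominus> y n" for n
      have tS: "t n \<in> S" for n using y Sp by (simp add: t_def)
      have at: "a \<ominus> t n \<in> B (int n)" for n using y Sc by (simp add: t_def minus_eq)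
      have tc: "t n \<in> carrier F" for n using tS Sc by blast
      have "t (Suc n) \<ominus> t n \<in> B (int n - 0)" for n
      proof -
        have "t (Suc n) \<ominus> a \<in> B (int n)" using at[of "Suc n"] vball_diff_commute[OF a tc]
            vball_antimono[of "int n" "int (Suc n)"] by simp
        then show ?thesis using vball_diff_trans[OF tc a tc] at by simp
      qed
      then obtain l where l: "l \<in> S" "\<And>n. t n \<ominus> l \<in> B (int n - 0)" using gclosedD[OF gS, of t 0] tS by blast
      have "a \<ominus> l \<in> B (int n - 0)" for n
        using vball_diff_trans[OF a tc Sc[OF l(1)]] at l(2) by (metis diff_zero)
      then have "a \<ominus> l = \<zero>" using vball_all_zero[of "a \<ominus> l" 0] a Sc l by simp
      then show False using a Sc l aS by simp
    qed
    then obtain N where N: "\<forall>y\<in>S. a \<oplus> y \<notin> B N" by blast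
    \<comment> \<open>Dividing by \<open>k\<close> turns the vector into \<open>a\<close> plus an
      element of \<open>S\<close>, which is outside \<open>B N\<close>; this bounds the value of
      \<open>k\<close> from below.\<close>
    have coord: "k \<in> B (n - N)" if k: "k \<in> K" "y \<in> S" "k \<otimes> a \<oplus> y \<in> B n" for k y n
    proof (cases "k = \<zero>")
      case False
      define z where "z = inv k \<otimes> y"
      have kc: "k \<in> carrier F - {\<zero>}" "inv k \<in> carrier F" using k False K_carrier K_inv by auto
      have zS: "z \<in> S" unfolding z_def using Sm K_inv k False by blast
      have "k \<otimes> (a \<oplus> z) = k \<otimes> a \<oplus> y"
        unfolding z_def using kc k a Sc K_inv(3)[of k] False
        by (simp add: r_distr m_assoc[symmetric])
      then have "a \<oplus> z \<in> B (n - w k)" using vball_cancel[of k "a \<oplus> z" n] kc a Sc zS k by simp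
      then have "\<not> N \<le> n - w k" using N zS vball_antimono by blast
      then show ?thesis using kc by (auto simp: vball_def)
    qed simp
    show ?thesis unfolding gclosed_def le
    proof (intro allI impI)
      fix s c assume s: "\<forall>n::nat. s n \<in> line_extension K a S" "\<forall>n. s (Suc n) \<ominus> s n \<in> B (int n - c)"
      then have "\<forall>n. \<exists>k y. k \<in> K \<and> y \<in> S \<and> s n = k \<otimes> a \<oplus> y"
        unfolding line_extension_mem_iff by metis
      then obtain \<kappa> y where ky: "\<And>n. \<kappa> n \<in> K" "\<And>n. y n \<in> S" "\<And>n. s n = \<kappa> n \<otimes> a \<oplus> y n" by metis
      have cc: "\<kappa> n \<in> carrier F" "y n \<in> carrier F" "s n \<in> carrier F" for n
        using ky K_carrier Sc a by auto
      have split: "s (Suc n) \<ominus> s n = (\<kappa> (Suc n) \<ominus> \<kappa> n) \<otimes> a \<oplus> (y (Suc n) \<ominus> y n)" for n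
        unfolding ky(3) using cc[of n] cc[of "Suc n"] a by algebra
      have yS: "y (Suc n) \<ominus> y n \<in> S" for n unfolding a_minus_def using ky Sp by blast
      have kd: "\<kappa> (Suc n) \<ominus> \<kappa> n \<in> B (int n - (c + N))" for n
      proof -
        have "(\<kappa> (Suc n) \<ominus> \<kappa> n) \<otimes> a \<oplus> (y (Suc n) \<ominus> y n) \<in> B (int n - c)"
          using s(2) split[of n] by metis
        then have "\<kappa> (Suc n) \<ominus> \<kappa> n \<in> B (int n - c - N)"
          by (rule coord[OF K_minus[OF ky(1) ky(1)] yS])
        then show ?thesis by (simp add: diff_diff_eq)
      qed
      obtain k0 where k0: "k0 \<in> K" "\<And>n. \<kappa> n \<ominus> k0 \<in> B (int n - (c + N))"
        using gclosedD[OF gclosed_K, of \<kappa>, OF ky(1) kd] by blast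
      \<comment> \<open>The differences of \<open>y\<close> are those of \<open>s\<close> minus
        those of \<open>\<kappa>\<close> times \<open>a\<close>; the larger of the two shifts serves
        both.\<close>
      define c' where "c' = max c (c + N - w a)"
      have aB: "a \<in> B (w a)" using a by (simp add: vball_def)
      have mono: "x \<in> B (int n - c')" if "x \<in> B (int n - c) \<or> x \<in> B (int n - (c + N) + w a)" for x n
        using that vball_antimono[of "int n - c'" "int n - c"] vball_antimono[of "int n - c'" "int n - (c + N) + w a"]
        by (auto simp: c'_def)
      have yd: "y (Suc n) \<ominus> y n \<in> B (int n - c')" for n
      proof -
        have "y (Suc n) \<ominus> y n = (s (Suc n) \<ominus> s n) \<ominus> (\<kappa> (Suc n) \<ominus> \<kappa> n) \<otimes> a"
          unfolding ky(3) using cc[of n] cc[of "Suc n"] a by algebra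
        moreover have "(\<kappa> (Suc n) \<ominus> \<kappa> n) \<otimes> a \<in> B (int n - c')" using vball_mult[OF kd aB] mono by blast
        moreover have "s (Suc n) \<ominus> s n \<in> B (int n - c')" using s mono by blast
        ultimately show ?thesis using vball_diff by simp
      qed
      obtain y0 where y0: "y0 \<in> S" "\<And>n. y n \<ominus> y0 \<in> B (int n - c')"
        using gclosedD[OF gS, of y, OF ky(2) yd] by blast
      define l where "l = k0 \<otimes> a \<oplus> y0"
      have lc: "l \<in> carrier F" "k0 \<in> carrier F" "y0 \<in> carrier F"
        using k0 y0 a K_carrier Sc by (auto simp: l_def)
      have sl: "s n \<ominus> l \<in> B (int n - c')" for n
      proof -
        have "s n \<ominus> l = (\<kappa> n \<ominus> k0) \<otimes> a \<oplus> (y n \<ominus> y0)"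
          unfolding ky(3) l_def using cc[of n] lc a by algebra
        moreover have "(\<kappa> n \<ominus> k0) \<otimes> a \<in> B (int n - c')" using vball_mult[OF k0(2) aB] mono by blast
        ultimately show ?thesis using vball_add y0(2) by simp
      qed
      have "\<exists>M. \<forall>n\<ge>M. s n \<ominus> l \<in> B N'" for N'
      proof (intro exI allI impI)
        fix n assume "nat (N' + c') \<le> n"
        then have "N' \<le> int n - c'" by linarith
        then show "s n \<ominus> l \<in> B N'" using sl vball_antimono by blast
      qed
      then have "s n \<ominus> l \<in> B (int n - c)" for n
        using geometric_limit_rate[of s c l n] cc s lc by blast
      moreover have "l \<in> line_extension K a S" using k0 y0 by (auto simp: l_def line_extension_mem_iff)
      ultimately show "\<exists>l\<in>line_extension K a S. \<forall>n. s n \<ominus> l \<in> B (int n - c)" by blast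
    qed
  qed
qed

lemma complete_of_Span:
  assumes "set us \<subseteq> carrier F" "Span K us = carrier F" "finite (carrier k)"
  shows "local_field F w"
proof -
  have g: "gclosed (carrier F)" using gclosed_Span assms by metis
  have "\<exists>l\<in>carrier F. \<forall>N. \<exists>M. \<forall>n\<ge>M. val_close F w N (s n) l"
    if s: "\<And>n::nat. s n \<in> carrier F" "\<forall>N. \<exists>M. \<forall>m\<ge>M. \<forall>n\<ge>M. val_close F w N (s m) (s n)" for s
  proof -
    have "\<exists>M. \<forall>m\<ge>M. \<forall>n\<ge>M. s m \<ominus> s n \<in> B N" for N using s(2) val_close_iff[OF s(1) s(1)] by simp
    then obtain M where M: "\<And>N m n. M N \<le> m \<Longrightarrow> M N \<le> n \<Longrightarrow> s m \<ominus> s n \<in> B N" by metis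
    \<comment> \<open>The Cauchy sequence is sampled so that consecutive samples differ by an
      element of \<open>B n\<close>. The indices \<open>M\<close> need not increase, so two samples
      are compared through a common later term.\<close>
    define t where "t n = s (M (int n))" for n
    have tc: "t n \<in> carrier F" for n using s by (simp add: t_def)
    have "t (Suc n) \<ominus> t n \<in> B (int n - 0)" for n
    proof -
      define i where "i = max (M (int n)) (M (int (Suc n)))"
      have "t (Suc n) \<ominus> s i \<in> B (int (Suc n))" "s i \<ominus> t n \<in> B (int n)"
        unfolding t_def by (rule M; simp add: i_def)+
      then show ?thesis using vball_diff_trans[OF tc s(1) tc] vball_antimono[of "int n" "int (Suc n)"]
        by (metis diff_zero of_nat_le_iff le_SucI order_refl)
    qed
    then obtain l where l: "l \<in> carrier F" "\<And>n. t n \<ominus> l \<in> B (int n - 0)" using gclosedD[OF g, of t 0] tc by blast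
    have "val_close F w N (s n) l" if "M (int (nat N)) \<le> n" for n N
    proof -
      have "s n \<ominus> t (nat N) \<in> B (int (nat N))" unfolding t_def by (rule M) (use that in auto)
      then have "s n \<ominus> l \<in> B (int (nat N))"
        using vball_diff_trans[OF s(1) tc l(1)] l(2)[of "nat N"] by (metis diff_zero)
      then have "s n \<ominus> l \<in> B N" using vball_antimono[of N "int (nat N)"] by simp
      then show ?thesis using val_close_iff s l by simp
    qed
    then show ?thesis using l by blast
  qed
  then show ?thesis
    using normalised_valuation_axioms assms(3) by (auto simp: local_field_def local_field_axioms_def)
qed

text \<open>An approximation that gains one order can be applied again to the error. The
  approximants converge at a linear rate, and their limit stays in the span because spans are
  closed.\<close>

lemma dense_Span:
  assumes us: "set us \<subseteq> carrier F"
    and dense: "\<And>x. x \<in> carrier F \<Longrightarrow> x \<noteq> \<zero> \<Longrightarrow> \<exists>y\<in>Span K us. x \<ominus> y \<in> B (w x + 1)"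
  shows "Span K us = carrier F"
proof
  note Sp = Span_subgroup_props[OF K us]
  show "Span K us \<subseteq> carrier F" using Sp by blast
  have Sc: "y \<in> carrier F" if "y \<in> Span K us" for y using Sp that by blast
  show "carrier F \<subseteq> Span K us"
  proof
    fix x assume x: "x \<in> carrier F"
    have "\<exists>y\<in>Span K us. x \<ominus> y \<in> B (w x + int n)" for n
    proof (induction n)
      case 0
      have "x \<ominus> \<zero> \<in> B (w x)" using x by (simp add: minus_eq vball_def)
      then show ?case using Sp by auto
    next
      case (Suc n)
      then obtain y where y: "y \<in> Span K us" "x \<ominus> y \<in> B (w x + int n)" by blast
      define d where "d = x \<ominus> y"
      have dc: "d \<in> carrier F" using x y Sc by (simp add: d_def)
      show ?case
      proof (cases "d \<in> B (w x + int (Suc n))")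
        case True then show ?thesis using y by (auto simp: d_def)
      next
        case False
        then have dz: "d \<noteq> \<zero>" by auto
        then have wd: "w d = w x + int n" using False y(2) dc by (auto simp: vball_def d_def)
        obtain z where z: "z \<in> Span K us" "d \<ominus> z \<in> B (w d + 1)" using dense[OF dc dz] by blast
        have zc: "z \<in> carrier F" "y \<in> carrier F" using z y Sc by auto
        have "x \<ominus> (y \<oplus> z) = d \<ominus> z" unfolding d_def using x zc by algebra
        then have "x \<ominus> (y \<oplus> z) \<in> B (w x + int (Suc n))" using z(2) wd by (simp add: algebra_simps)
        then show ?thesis using y z Sp by blast
      qed
    qed
    then obtain t where t: "\<And>n. t n \<in> Span K us" "\<And>n. x \<ominus> t n \<in> B (w x + int n)" by metis
    have tc: "t n \<in> carrier F" for n using t Sc by blast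
    have d: "x \<ominus> t n \<in> B (int n - (- w x))" for n using t(2)[of n] by (simp add: add.commute)
    have "t (Suc n) \<ominus> t n \<in> B (int n - (- w x))" for n
    proof -
      have "t (Suc n) \<ominus> x \<in> B (int n - (- w x))"
        using vball_diff_commute[OF x tc d[of "Suc n"]]
          vball_antimono[of "int n - (- w x)" "int (Suc n) - (- w x)"] by simp
      then show ?thesis using vball_diff_trans[OF tc x tc] d by blast
    qed
    then obtain l where l: "l \<in> Span K us" "\<And>n. t n \<ominus> l \<in> B (int n - (- w x))"
      using gclosedD[OF gclosed_Span[OF us], of t "- w x"] t by blast
    have "x \<ominus> l \<in> B (int n - (- w x))" for n
      by (rule vball_diff_trans[OF x tc[of n] Sc[OF l(1)] d[of n] l(2)[of n]])
    then have "x \<ominus> l = \<zero>" using vball_all_zero[of "x \<ominus> l" "- w x"] x Sc[OF l(1)] by blast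
    then have "x = l" using r_right_minus_eq[OF x Sc[OF l(1)]] by blast
    then show "x \<in> Span K us" using l(1) by blast
  qed
qed

section \<open>The residue extension\<close>

text \<open>The copy of the residue field of \<open>K\<close> inside that of \<open>F\<close>, where
  the degree is measured.\<close>

definition kK where "kK = res ` (K \<inter> B 0)"

lemma residue_degree_iff:
  "ring.dimension k n ((\<lambda>x. valuation_ideal F w +>\<^bsub>valuation_ring F w\<^esub> x) ` carrier (valuation_ring (F\<lparr>carrier := K\<rparr>) u)) (carrier k)
    \<longleftrightarrow> ring.dimension k n kK (carrier k)"
proof -
  have "carrier (valuation_ring (F\<lparr>carrier := K\<rparr>) u) = K \<inter> B 0"
    by (simp add: Kl.valuation_ring_eq K_ball_eq)
  moreover have "(\<lambda>x. valuation_ideal F w +>\<^bsub>valuation_ring F w\<^esub> x) = res"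
    by (rule ext) (simp add: res_def valuation_ring_eq valuation_ideal_eq)
  ultimately show ?thesis by (simp add: kK_def)
qed

lemma kK_subfield: "subfield kK k"
proof -
  interpret k: field k by (rule k_field)
  have sr: "subring kK k"
  proof (rule k.subringI)
    show "kK \<subseteq> carrier k" by (auto simp: kK_def)
    show "\<one>\<^bsub>k\<^esub> \<in> kK" unfolding kK_def res_one[symmetric] using K_closed by (intro imageI) simp
    fix x assume "x \<in> kK"
    then obtain a where a: "a \<in> K" "a \<in> B 0" "x = res a" by (auto simp: kK_def)
    have "res (\<ominus> a) \<oplus>\<^bsub>k\<^esub> res a = \<zero>\<^bsub>k\<^esub>"
      using res_add[of "\<ominus> a" a] a vball_minus vball_carrier l_neg res_zero_iff[of \<zero>] by simp
    then have "\<ominus>\<^bsub>k\<^esub> x = res (\<ominus> a)" using a k.minus_equality vball_minus by simp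
    then show "\<ominus>\<^bsub>k\<^esub> x \<in> kK" using a K_closed vball_minus by (auto simp: kK_def)
    fix y assume "y \<in> kK"
    then obtain b where b: "b \<in> K" "b \<in> B 0" "y = res b" by (auto simp: kK_def)
    have "x \<otimes>\<^bsub>k\<^esub> y = res (a \<otimes> b)" "x \<oplus>\<^bsub>k\<^esub> y = res (a \<oplus> b)" using a b res_mult res_add by auto
    then show "x \<otimes>\<^bsub>k\<^esub> y \<in> kK" "x \<oplus>\<^bsub>k\<^esub> y \<in> kK"
      using a b K_closed vball_mult0 vball_add by (auto simp: kK_def)
  qed
  show ?thesis
  proof (rule k.subfieldI'[OF sr])
    fix x assume x: "x \<in> kK - {\<zero>\<^bsub>k\<^esub>}"
    then obtain a where a: "a \<in> K" "a \<in> B 0" "x = res a" by (auto simp: kK_def)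
    then have a1: "a \<notin> B 1" using x res_zero_iff by auto
    then have ac: "a \<in> carrier F - {\<zero>}" using a K_carrier by auto
    then have "w a = 0" using a a1 by (auto simp: vball_def)
    then have ib: "inv a \<in> B 0" using val_inv[OF ac] K_inv[of a] K_carrier a ac by (auto simp: vball_def)
    have "res a \<otimes>\<^bsub>k\<^esub> res (inv a) = \<one>\<^bsub>k\<^esub>" using res_mult[OF a(2) ib] K_inv[of a] a ac res_one by simp
    then have "inv\<^bsub>k\<^esub> x = res (inv a)" using a ib k.comm_inv_char[of "res a" "res (inv a)"] by simp
    then show "inv\<^bsub>k\<^esub> x \<in> kK" using ib K_inv a ac by (auto simp: kK_def)
  qed
qed

lemma kK_card: "finite kK" "card kK = Kl.Q"
proof -
  have eq: "Kl.res x = Kl.res y \<longleftrightarrow> res x = res y" if "x \<in> K \<inter> B 0" "y \<in> K \<inter> B 0" for x y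
    using that Kl.res_eq_iff[of x y] res_eq_iff[of x y] K_ball_0 K_ball_1[of "x \<ominus> y"] K_minus
      subring_a_minus[OF K_ring] by auto
  have "carrier Kl.k = Kl.res ` (K \<inter> B 0)"
    by (simp add: Kl.k_carrier K_ball_eq)
  then show "finite kK" "card kK = Kl.Q"
    using card_image_eq_of_kernel_eq[of "K \<inter> B 0" Kl.res res, OF eq] Kl.fin_k
    by (auto simp: kK_def Kl.Q_def)
qed

lemma residue_card:
  assumes "ring.dimension k n kK (carrier k)"
  shows "finite (carrier k)" "card (carrier k) = Kl.Q ^ n"
proof -
  interpret k: field k by (rule k_field)
  show "finite (carrier k)" "card (carrier k) = Kl.Q ^ n"
    using k.card_of_dimension[OF kK_subfield kK_card(1) assms] kK_card by auto
qed

text \<open>Dividing by a nonzero coefficient of least value makes the list primitive: everything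
  becomes integral, and one coefficient becomes 1 and survives reduction.\<close>

lemma normalise_coeffs:
  assumes "set ks \<subseteq> K" "\<not> set ks \<subseteq> {\<zero>}"
  shows "\<exists>c\<in>K - {\<zero>}. (\<forall>x\<in>set ks. c \<otimes> x \<in> B 0) \<and> (\<exists>x\<in>set ks. c \<otimes> x = \<one>)"
proof -
  define A where "A = set ks - {\<zero>}"
  have A: "finite A" "A \<noteq> {}" using assms by (auto simp: A_def)
  define m where "m = Min (w ` A)"
  obtain a where a: "a \<in> A" "w a = m"
  proof -
    have "m \<in> w ` A" unfolding m_def by (rule Min_in) (use A in auto)
    then show thesis using that by blast
  qed
  have aK: "a \<in> K" "a \<noteq> \<zero>" using a assms by (auto simp: A_def)
  have ac: "a \<in> carrier F - {\<zero>}" using aK K_carrier by auto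
  have "inv a \<otimes> x \<in> B 0" if x: "x \<in> set ks" for x
  proof (cases "x = \<zero>")
    case False
    then have "m \<le> w x" using A x by (auto simp: m_def A_def)
    moreover have "x \<in> carrier F - {\<zero>}" "inv a \<in> carrier F - {\<zero>}" using x False assms K_carrier aK K_inv by auto
    moreover have "w (inv a) = - m" using val_inv[OF ac] a by simp
    ultimately show ?thesis using val_mult[of "inv a" x] by (auto simp: vball_def)
  qed (use aK K_inv K_carrier in simp)
  moreover have "\<exists>x\<in>set ks. inv a \<otimes> x = \<one>" using a K_inv(4)[OF aK] by (auto simp: A_def)
  ultimately show ?thesis using aK K_inv by (intro bexI[of _ "inv a"]) auto
qed

lemma res_combine:
  assumes "set ks \<subseteq> B 0" "set us \<subseteq> B 0"
  shows "combine ks us \<in> B 0 \<and> res (combine ks us) = ring.combine k (map res ks) (map res us)"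
  using assms
proof (induction ks us rule: combine.induct)
  case (1 c ks x us)
  interpret k: field k by (rule k_field)
  show ?case using 1 vball_add vball_mult0 by (auto simp: res_add res_mult)
next
  case ("2_1" us)
  interpret k: field k by (rule k_field)
  show ?case using res_zero_iff[of \<zero>] by simp
next
  case ("2_2" ks)
  interpret k: field k by (rule k_field)
  show ?case using res_zero_iff[of \<zero>] by (cases ks) auto
qed

text \<open>A nontrivial relation over \<open>K\<close> can be made primitive and then reduces to a
  nontrivial relation among the residues.\<close>

lemma independent_lift:
  assumes us: "set us \<subseteq> B 0" and ind: "ring.independent k kK (map res us)"
  shows "independent K us"
proof (rule trivial_combine_imp_independent[OF K])
  interpret k: field k by (rule k_field)
  show uc: "set us \<subseteq> carrier F" using us vball_carrier by blast
  fix Ks assume Ks: "set Ks \<subseteq> K" "combine Ks us = \<zero>"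
  \<comment> \<open>Entries beyond the length of \<open>us\<close> do not enter
    \<open>combine\<close>. They are cut off first, since normalising must produce a 1 among the
    entries that count.\<close>
  define ks where "ks = take (length us) Ks"
  have ks: "set ks \<subseteq> K" "combine ks us = \<zero>" "length ks \<le> length us"
    using Ks combine_take[of us Ks] set_take_subset[of "length us" Ks] by (auto simp: ks_def)
  show "set (take (length us) Ks) \<subseteq> {\<zero>}"
  proof (rule ccontr)
    assume "\<not> set (take (length us) Ks) \<subseteq> {\<zero>}"
    then obtain c x where c: "c \<in> K - {\<zero>}" "\<forall>x\<in>set ks. c \<otimes> x \<in> B 0" "x \<in> set ks" "c \<otimes> x = \<one>"
      using normalise_coeffs[OF ks(1)] ks_def by blast
    define js where "js = map ((\<otimes>) c) ks"
    have jB: "set js \<subseteq> B 0" "set js \<subseteq> K" using c ks K_closed by (auto simp: js_def)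
    have "combine js us = \<zero>"
    proof -
      have "set ks \<subseteq> carrier F" "c \<in> carrier F" using ks c K_carrier by auto
      then show ?thesis using combine_r_distr[of ks us c] ks uc by (simp add: js_def)
    qed
    then have "k.combine (map res js) (map res us) = \<zero>\<^bsub>k\<^esub>"
      using res_combine[OF jB(1) us] res_zero_iff[of \<zero>] by simp
    moreover have "set (map res js) \<subseteq> kK" using jB by (auto simp: kK_def)
    ultimately have "set (take (length us) (map res js)) \<subseteq> {\<zero>\<^bsub>k\<^esub>}"
      using k.independent_imp_trivial_combine[OF kK_subfield ind, of "map res js"] by simp
    then have "set (map res js) \<subseteq> {\<zero>\<^bsub>k\<^esub>}" using ks(3) by (simp add: js_def)
    moreover have "res \<one> \<in> set (map res js)" using c by (auto simp: js_def image_iff intro!: bexI[of _ x])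
    ultimately show False using res_zero_iff[of \<one>] vball_one_iff[of 1] by auto
  qed
qed

lemma lift_list: "set ys \<subseteq> res ` A \<Longrightarrow> \<exists>xs. set xs \<subseteq> A \<and> map res xs = ys"
proof (induction ys)
  case (Cons y ys)
  then obtain xs where "set xs \<subseteq> A" "map res xs = ys" by auto
  moreover obtain x where "x \<in> A" "y = res x" using Cons by auto
  ultimately show ?case by (intro exI[of _ "x # xs"]) auto
qed simp

text \<open>Lifting bounds the residue degree by \<open>n\<close>. Conversely, as e = 1, some
  element of \<open>K\<close> has any prescribed value, so every \<open>x\<close> is such an element
  times a unit, and the unit is approximated by lifts of a residue basis. By
  \<open>dense_Span\<close> these lifts span, so both degrees count the same basis.\<close>

lemma unramified_residue_degree:
  assumes "e = 1" "dimension n K (carrier F)"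
  shows "ring.dimension k n kK (carrier k)"
proof -
  interpret k: field k by (rule k_field)
  have fin: "k.finite_dimension kK (carrier k)"
  proof (rule ccontr)
    assume "\<not> k.finite_dimension kK (carrier k)"
    then obtain ys where ys: "length ys = Suc n" "k.independent kK ys"
      using k.independent_of_infinite_dimension[OF kK_subfield] by blast
    obtain xs where xs: "set xs \<subseteq> B 0" "map res xs = ys"
      using lift_list[of ys "B 0"] k.independent_in_carrier[OF ys(2)] k_carrier by auto
    have "independent K xs" using independent_lift xs ys by blast
    then have "length xs \<le> n"
      using independent_length_le_dimension[OF K assms(2)] xs vball_carrier by blast
    then show False using ys xs by auto
  qed
  then obtain g where g: "k.dimension g kK (carrier k)" by blast
  obtain ys where ys: "k.independent kK ys" "length ys = g" "k.Span kK ys = carrier k"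
    using k.exists_base[OF kK_subfield g] by blast
  note ysc = k.independent_in_carrier[OF ys(1)]
  obtain xs where xs: "set xs \<subseteq> B 0" "map res xs = ys"
    using lift_list[of ys "B 0"] ysc k_carrier by auto
  have ind: "independent K xs" using independent_lift xs ys by blast
  have xc: "set xs \<subseteq> carrier F" using xs vball_carrier by blast
  have "Span K xs = carrier F"
  proof (rule dense_Span[OF xc])
    fix x assume x: "x \<in> carrier F" "x \<noteq> \<zero>"
    obtain c where c: "c \<in> K - {\<zero>}" "u c = w x"
    proof -
      have "w x \<in> u ` (K - {\<zero>})" using Kl.val_surj by simp
      then show thesis using that by (elim imageE) simp
    qed
    have wc: "w c = w x" using val_K c assms(1) by simp
    define y where "y = inv c \<otimes> x"
    have cc: "c \<in> carrier F - {\<zero>}" "inv c \<in> carrier F - {\<zero>}" using c K_carrier K_inv by auto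
    have yc: "y \<in> carrier F" using cc x by (simp add: y_def)
    have xy: "x = c \<otimes> y" using K_inv(3)[of c] c cc x by (simp add: y_def m_assoc[symmetric])
    have "w y = 0" using val_mult[of "inv c" x] val_inv[OF cc(1)] wc cc x by (simp add: y_def)
    then have yB: "y \<in> B 0" using yc by (simp add: vball_def)
    then have "res y \<in> k.Span kK ys" using ys by simp
    then obtain js where js: "set js \<subseteq> kK" "res y = k.combine js ys"
      using k.Span_mem_iff_length_version[OF kK_subfield ysc] by blast
    obtain ks where ks: "set ks \<subseteq> K \<inter> B 0" "map res ks = js" using lift_list js(1) unfolding kK_def by blast
    define z where "z = combine ks xs"
    have zS: "z \<in> Span K xs" unfolding z_def using Span_eq_combine_set[OF K xc] ks by auto
    have z: "z \<in> B 0" "res z = res y" using res_combine[of ks xs] ks xs js by (auto simp: z_def)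
    then have "y \<ominus> z \<in> B 1" using res_eq_iff[of y z] yB by simp
    then have "c \<otimes> (y \<ominus> z) \<in> B (w x + 1)"
      using vball_mult[of c "w x" "y \<ominus> z" 1] cc wc by (simp add: vball_def)
    moreover have "c \<otimes> (y \<ominus> z) = x \<ominus> c \<otimes> z"
      unfolding xy using cc yc vball_carrier[OF z(1)] by (simp add: minus_eq r_distr r_minus)
    ultimately show "\<exists>y\<in>Span K xs. x \<ominus> y \<in> B (w x + 1)"
      using Span_smult_closed[OF K xc] zS c by auto
  qed
  then have "dimension (length xs) K (carrier F)" using dimensionI[OF K ind] by simp
  then have "length xs = n" using dimension_is_inj[OF K] assms(2) by blast
  then show ?thesis using g ys xs by auto
qed

end

section \<open>Frobenius and the reduction of polynomials\<close>

lemma pow_carrier_update [simp]: "x [^]\<^bsub>R\<lparr>carrier := E\<rparr>\<^esub> (n::nat) = x [^]\<^bsub>R\<^esub> n"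
  by (simp add: nat_pow_def)

lemma add_pow_carrier_update [simp]: "add_pow (R\<lparr>carrier := E\<rparr>) (n::nat) x = add_pow R n x"
  by (simp add: add_pow_def nat_pow_def)

lemma (in field) frobenius_subfield:
  assumes "subfield k0 R" "finite k0"
  shows "x \<in> k0 \<Longrightarrow> x [^] card k0 = x"
    and "x \<in> carrier R \<Longrightarrow> y \<in> carrier R \<Longrightarrow> (x \<oplus> y) [^] card k0 = x [^] card k0 \<oplus> y [^] card k0"
proof -
  interpret k0: field "R\<lparr>carrier := k0\<rparr>" by (rule subfield_iff(2)[OF assms(1)])
  show "x \<in> k0 \<Longrightarrow> x [^] card k0 = x" using k0.finite_field_pow_card[of x] assms(2) by simp
  obtain p s where p: "Factorial_Ring.prime (p::nat)" "[p] \<cdot> \<one> = \<zero>" "card k0 = p ^ s"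
    using k0.finite_field_char assms(2) by auto
  assume "x \<in> carrier R" "y \<in> carrier R"
  then show "(x \<oplus> y) [^] card k0 = x [^] card k0 \<oplus> y [^] card k0"
    using freshmans_dream[of x y p s] p by simp
qed

lemma (in field) eval_frobenius:
  assumes "subfield k0 R" "finite k0" "set P \<subseteq> k0" "y \<in> carrier R"
  shows "eval P (y [^] card k0) = (eval P y) [^] card k0"
  using assms(3)
proof (induction P)
  case Nil
  have "\<zero> \<in> k0" using subringE(2)[OF subfieldE(1)[OF assms(1)]] .
  then show ?case using frobenius_subfield(1)[OF assms(1,2)] by simp
next
  case (Cons c P)
  have c: "c \<in> k0" "c \<in> carrier R" "set P \<subseteq> carrier R" using Cons subfieldE(3)[OF assms(1)] by auto
  have e: "eval P y \<in> carrier R" using eval_in_carrier c assms by blast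
  have "(c \<otimes> y [^] length P) [^] card k0 = c \<otimes> (y [^] card k0) [^] length P"
    using frobenius_subfield(1)[OF assms(1,2) c(1)] c assms(4)
    by (simp add: nat_pow_distrib nat_pow_pow mult.commute)
  then show ?case using Cons frobenius_subfield(2)[OF assms(1,2), of "c \<otimes> y [^] length P" "eval P y"] c e assms(4)
    by simp
qed

context valued_extension begin

text \<open>Modulo the maximal ideal a polynomial over \<open>K\<close> has coefficients fixed by the \<open>Q\<close>-power map,
  so the residues of its root \<open>\<omega>\<close> and of all \<open>\<omega> ^ (Q ^ i)\<close> are roots of the reduction.\<close>
lemma conjugates_mod_maximal:
  assumes k_fin: "finite (carrier k)"
    and P: "set P \<subseteq> K" "\<not> set P \<subseteq> {\<zero>}" and \<omega>: "\<omega> \<in> B 0" "eval P \<omega> = \<zero>"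
    and inj: "inj_on (\<lambda>i::nat. res (\<omega> [^] (Kl.Q ^ i))) {..<N}"
  shows "N < length P"
    and "length P = Suc N \<Longrightarrow> \<tau> \<in> B 0 \<Longrightarrow> eval P \<tau> = \<zero> \<Longrightarrow> \<exists>i<N. res \<tau> = res (\<omega> [^] (Kl.Q ^ i))"
proof -
  interpret k: field k by (rule k_field)
  interpret rh: ring_hom_ring "F\<lparr>carrier := B 0\<rparr>" k res by (rule res_ring_hom)
  obtain c x where c: "c \<in> K - {\<zero>}" "\<forall>x\<in>set P. c \<otimes> x \<in> B 0" "x \<in> set P" "c \<otimes> x = \<one>"
    using normalise_coeffs[OF P] by blast
  define P' where "P' = map ((\<otimes>) c) P"
  define S where "S = (\<lambda>i::nat. res (\<omega> [^] (Kl.Q ^ i))) ` {..<N}"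
  have P': "set P' \<subseteq> B 0" "set P' \<subseteq> K" using c P K_closed by (auto simp: P'_def)
  have Pc: "set P \<subseteq> carrier F" "c \<in> carrier F" using P c K_carrier by auto
  have ev: "eval P' t = c \<otimes> eval P t" if t: "t \<in> carrier F" for t
  proof -
    have "eval (map ((\<otimes>) c) ps) t = c \<otimes> eval ps t" if "set ps \<subseteq> carrier F" for ps
      using that
    proof (induction ps)
      case (Cons a ps)
      then have "eval ps t \<in> carrier F" using t eval_in_carrier by simp
      then show ?case using Cons Pc t by (simp add: r_distr m_assoc)
    qed (use Pc in simp)
    then show ?thesis using Pc by (simp add: P'_def)
  qed
  have rev: "k.eval (map res P') (res t) = res (eval P' t)" if "t \<in> B 0" for t
    using rh.eval_hom'[of t P'] that P' eval_consistent[OF subring_vball] by simp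
  have root: "k.eval (map res P') (res t) = \<zero>\<^bsub>k\<^esub>" if "t \<in> B 0" "eval P t = \<zero>" for t
    using rev[OF that(1)] ev[OF vball_carrier[OF that(1)]] that(2) Pc res_zero_iff[of \<zero>] by simp
  have setk: "set (map res P') \<subseteq> kK" using P' by (auto simp: kK_def)
  have kKc: "kK \<subseteq> carrier k" using subfieldE(3)[OF kK_subfield] .
  have Sroot: "k.eval (map res P') (res (\<omega> [^] (Kl.Q ^ i))) = \<zero>\<^bsub>k\<^esub>" for i
  proof (induction i)
    case 0
    then show ?case using root \<omega> vball_carrier by simp
  next
    case (Suc i)
    let ?y = "res (\<omega> [^] (Kl.Q ^ i))"
    have oc: "\<omega> \<in> carrier F" "\<omega> [^] (Kl.Q ^ i) \<in> B 0" using \<omega> vball_carrier vball_pow by auto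
    have "\<omega> [^] (Kl.Q ^ Suc i) = (\<omega> [^] (Kl.Q ^ i)) [^] Kl.Q" using oc by (simp add: nat_pow_pow mult.commute)
    then have "res (\<omega> [^] (Kl.Q ^ Suc i)) = ?y [^]\<^bsub>k\<^esub> card kK" using res_pow[OF oc(2)] kK_card by simp
    then have "k.eval (map res P') (res (\<omega> [^] (Kl.Q ^ Suc i))) = (k.eval (map res P') ?y) [^]\<^bsub>k\<^esub> card kK"
      using k.eval_frobenius[OF kK_subfield kK_card(1) setk, of ?y] oc by simp
    also have "\<dots> = \<zero>\<^bsub>k\<^esub>" unfolding Suc.IH using k.nat_pow_zero[of "card kK"] Kl.Q_gt_1 kK_card by simp
    finally show ?case .
  qed
  have one: "\<not> set (map res P') \<subseteq> {\<zero>\<^bsub>k\<^esub>}"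
  proof
    assume "set (map res P') \<subseteq> {\<zero>\<^bsub>k\<^esub>}"
    moreover have "\<one> \<in> set P'" using c by (auto simp: P'_def image_iff intro!: bexI[of _ x])
    ultimately show False using res_zero_iff[of \<one>] vball_one_iff[of 1] by auto
  qed
  have Sc: "finite S" "S \<subseteq> carrier k" "card S = N"
    using inj \<omega> vball_pow by (auto simp: S_def card_image)
  have lenP: "length (map res P') = length P" by (simp add: P'_def)
  have SR: "k.eval (map res P') s = \<zero>\<^bsub>k\<^esub>" if "s \<in> S" for s using that Sroot by (auto simp: S_def)
  show "N < length P"
  proof (rule ccontr)
    assume "\<not> N < length P"
    then have "set (map res P') \<subseteq> {\<zero>\<^bsub>k\<^esub>}"
      using k.coeffs_zero_of_many_roots[of "map res P'" S] setk kKc Sc lenP SR by simp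
    then show False using one by simp
  qed
  assume len: "length P = Suc N" and t: "\<tau> \<in> B 0" "eval P \<tau> = \<zero>"
  show "\<exists>i<N. res \<tau> = res (\<omega> [^] (Kl.Q ^ i))"
  proof (rule ccontr)
    assume "\<not> (\<exists>i<N. res \<tau> = res (\<omega> [^] (Kl.Q ^ i)))"
    then have nS: "res \<tau> \<notin> S" by (auto simp: S_def)
    \<comment> \<open>The N conjugate residues already exhaust the degree of the reduction; a
      further root would make all its coefficients vanish, although one of them is 1.\<close>
    have "set (map res P') \<subseteq> {\<zero>\<^bsub>k\<^esub>}"
      by (rule k.coeffs_zero_of_many_roots[of "map res P'" "insert (res \<tau>) S"])
        (use setk kKc Sc lenP len nS SR root t in auto)
    then show False using one by simp
  qed
qed

end

section \<open>Roots of unity and restricted carriers\<close>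

context field begin

text \<open>The polynomial X^n - c for positive \<open>n\<close>: appending a constant term to the
  monomial of degree n - 1 multiplies that monomial by X.\<close>

definition binom_poly where "binom_poly n c = monom \<one> (n - 1) @ [\<ominus> c]"

lemma binom_poly_length: "0 < n \<Longrightarrow> length (binom_poly n c) = Suc n"
  by (simp add: binom_poly_def monom_def)

lemma binom_poly_eval: "0 < n \<Longrightarrow> c \<in> carrier R \<Longrightarrow> x \<in> carrier R \<Longrightarrow> eval (binom_poly n c) x = x [^] n \<ominus> c"
proof -
  assume a: "0 < n" "c \<in> carrier R" "x \<in> carrier R"
  have m: "set (monom \<one> (n - 1)) \<subseteq> carrier R" by (rule monom_in_carrier) simp
  have "x [^] (n - 1) \<otimes> x = x [^] n" using a nat_pow_Suc[of x "n - 1"] by simp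
  then show ?thesis
    unfolding binom_poly_def eval_append_aux[OF m a_inv_closed[OF a(2)] a(3)] eval_monom[OF one_closed a(3)]
    using a by (simp add: minus_eq)
qed

lemma binom_poly_closed:
  assumes "subring K R" "c \<in> K" shows "binom_poly n c \<in> carrier (K[X])" "binom_poly n c \<noteq> []" "set (binom_poly n c) \<subseteq> K"
    "hd (binom_poly n c) = \<one>"
  using subringE[OF assms(1)] assms(2)
  by (auto simp: binom_poly_def monom_def univ_poly_carrier[symmetric] polynomial_def)

lemma roots_of_unity_bound:
  assumes "0 < n" "c \<in> carrier R" "finite S" "S \<subseteq> carrier R" "\<And>x. x \<in> S \<Longrightarrow> x [^] n = c"
  shows "card S \<le> n"
proof (rule ccontr)
  assume "\<not> card S \<le> n"
  then have "set (binom_poly n c) \<subseteq> {\<zero>}"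
    using coeffs_zero_of_many_roots[of "binom_poly n c" S] assms binom_poly_length[OF assms(1)]
      binom_poly_eval[OF assms(1,2)] binom_poly_closed(3)[OF carrier_is_subring assms(2)]
    by (simp add: subset_iff minus_eq r_neg)
  then show False using binom_poly_closed(2,4)[OF carrier_is_subring assms(2), of n]
    by (metis hd_in_set one_not_zero singletonD subsetD)
qed

lemma primitive_root_inj:
  assumes "x \<in> carrier R" "\<And>i. x [^] (i::nat) = \<one> \<longleftrightarrow> n dvd i" "0 < n"
  shows "inj_on (\<lambda>i::nat. x [^] i) {..<n}" "x \<noteq> \<zero>"
proof -
  have "x [^] n = \<one>" using assms by simp
  then show nz: "x \<noteq> \<zero>" using nat_pow_zero[of n] assms(3) one_not_zero by (metis not_gr_zero)
  have w: "i = j" if ij: "i \<le> j" "j < n" "x [^] i = x [^] j" for i j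
  proof -
    have "x [^] i \<otimes> x [^] (j - i) = x [^] j" using ij assms(1) nat_pow_mult[of x i "j - i"] by simp
    then have "x [^] i \<otimes> \<one> = x [^] i \<otimes> x [^] (j - i)" using ij(3) assms(1) by (metis nat_pow_closed r_one)
    then have "x [^] (j - i) = \<one>" using m_lcancel[of "x [^] i" "\<one>" "x [^] (j - i)"] assms(1) pow_non_zero[OF assms(1) nz] by auto
    then show ?thesis using assms ij dvd_imp_le[of n "j - i"] by fastforce
  qed
  show "inj_on (\<lambda>i::nat. x [^] i) {..<n}"
    using w by (intro inj_onI) (metis lessThan_iff nat_le_linear)
qed

text \<open>The n distinct powers of \<open>x\<close> leave no room for a further root of X^n -
  1.\<close>

lemma root_of_unity_is_power:
  assumes x: "x \<in> carrier R" "\<And>i. x [^] (i::nat) = \<one> \<longleftrightarrow> n dvd i" "0 < n"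
    and z: "z \<in> carrier R" "z [^] n = \<one>"
  shows "\<exists>s<n. z = x [^] s"
proof (rule ccontr)
  assume a: "\<not> (\<exists>s<n. z = x [^] s)"
  define S where "S = (\<lambda>i::nat. x [^] i) ` {..<n}"
  have S: "finite S" "card S = n" "S \<subseteq> carrier R" "z \<notin> S"
    using primitive_root_inj[OF x] a x(1) by (auto simp: S_def card_image)
  have "x [^] n = \<one>" using x by simp
  then have "(x [^] i) [^] n = \<one>" for i :: nat
    using x(1) by (metis mult.commute nat_pow_one nat_pow_pow)
  then have "y [^] n = \<one>" if "y \<in> insert z S" for y using that z(2) by (auto simp: S_def)
  then have "card (insert z S) \<le> n" using roots_of_unity_bound[of n \<one> "insert z S"] x z S by simp
  then show False using S by simp
qed

lemma independent_carrier_update: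
  assumes "subring E R" "K \<subseteq> E"
  shows "ring.independent (R\<lparr>carrier := E\<rparr>) K us \<longleftrightarrow> independent K us \<and> set us \<subseteq> E"
proof -
  interpret E: ring "R\<lparr>carrier := E\<rparr>" by (rule subring_is_ring[OF assms(1)])
  show ?thesis
  proof (induction us)
    case (Cons a us)
    show ?case
    proof
      assume "E.independent K (a # us)"
      then have "a \<in> E" "a \<notin> Span K us" "independent K us" "set us \<subseteq> E"
        using E.independent_backwards[of K a us] Cons Span_consistent[OF assms(1)] by auto
      then show "independent K (a # us) \<and> set (a # us) \<subseteq> E" using li_Cons subringE(1)[OF assms(1)] by auto
    next
      assume "independent K (a # us) \<and> set (a # us) \<subseteq> E"
      then show "E.independent K (a # us)"
        using independent_backwards[of K a us] Cons Span_consistent[OF assms(1)] E.li_Cons[of a K us] by auto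
    qed
  qed auto
qed

lemma dimension_carrier_update:
  assumes "subring E R" "K \<subseteq> E" "subfield K R" "dimension n K E"
  shows "ring.dimension (R\<lparr>carrier := E\<rparr>) n K E"
proof -
  interpret E: ring "R\<lparr>carrier := E\<rparr>" by (rule subring_is_ring[OF assms(1)])
  obtain us where us: "independent K us" "length us = n" "Span K us = E"
    using exists_base[OF assms(3,4)] by blast
  have "set us \<subseteq> E" using Span_base_incl[OF assms(3) independent_in_carrier[OF us(1)]] us by simp
  then have "E.independent K us" using us independent_carrier_update[OF assms(1,2)] by blast
  moreover have "E.Span K us = E" using us Span_consistent[OF assms(1)] by simp
  ultimately show ?thesis using E.dimension_independent us by metis
qed

lemma subfield_carrier_update:
  assumes "subfield E R" "subfield K R" "K \<subseteq> E"
  shows "subfield K (R\<lparr>carrier := E\<rparr>)"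
proof -
  interpret E: field "R\<lparr>carrier := E\<rparr>" by (rule subfield_iff(2)[OF assms(1)])
  have "field (R\<lparr>carrier := E\<rparr>\<lparr>carrier := K\<rparr>)" using subfield_iff(2)[OF assms(2)] by simp
  then show ?thesis using E.subfield_iff(1) assms by simp
qed

end

text \<open>Modulo q^n - 1 the power q^j becomes q^(j mod n), and q^(j mod n) - 1 is too small to be
  a nonzero multiple. This trades orders of roots of unity for degrees of unramified
  extensions.\<close>

lemma pow_minus_one_dvd_iff:
  fixes q n j :: nat
  assumes "1 < q" "0 < n"
  shows "(q ^ n - 1) dvd (q ^ j - 1) \<longleftrightarrow> n dvd j"
proof -
  define M where "M = q ^ n - 1"
  define a b where "a = j div n" and "b = j mod n"
  have j: "j = n * a + b" by (simp add: a_def b_def)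
  have b: "b < n" using assms by (simp add: b_def)
  have qn: "1 \<le> q ^ n" "1 \<le> q ^ b" "1 \<le> q ^ j" using assms by auto
  have "[q ^ n = 1] (mod M)" using qn by (simp add: M_def cong_altdef_nat)
  then have "[(q ^ n) ^ a * q ^ b = 1 ^ a * q ^ b] (mod M)" by (intro cong_mult cong_pow) auto
  then have c: "[q ^ j = q ^ b] (mod M)" by (simp add: j power_add power_mult)
  have "M dvd (q ^ j - 1) \<longleftrightarrow> [q ^ j = 1] (mod M)" using qn by (simp add: cong_altdef_nat)
  also have "\<dots> \<longleftrightarrow> [q ^ b = 1] (mod M)" using c cong_sym cong_trans by blast
  also have "\<dots> \<longleftrightarrow> M dvd (q ^ b - 1)" using qn by (simp add: cong_altdef_nat)
  also have "\<dots> \<longleftrightarrow> b = 0"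
  proof
    assume d: "M dvd (q ^ b - 1)"
    have "q ^ b < q ^ n" using assms b by simp
    then have "q ^ b - 1 < M" using qn by (simp add: M_def)
    then have "q ^ b - 1 = 0" using d by (meson nat_dvd_not_less not_gr_zero)
    then have "q ^ b \<le> 1" by simp
    then show "b = 0" using assms by (metis One_nat_def leD not_gr_zero one_less_power)
  qed simp
  also have "\<dots> \<longleftrightarrow> n dvd j" by (simp add: b_def dvd_eq_mod_eq_0)
  finally show ?thesis by (simp add: M_def)
qed

section \<open>Unramified extensions\<close>

locale local_closure = field \<Omega> for \<Omega> (structure) +
  fixes K :: "'a set" and v :: "'a \<Rightarrow> int"
  assumes closure: "algebraic_closure \<Omega> K" and local: "local_field (\<Omega>\<lparr>carrier := K\<rparr>) v"
begin

sublocale Kl: local_field "\<Omega>\<lparr>carrier := K\<rparr>" v by (rule local)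

abbreviation q where "q \<equiv> Kl.Q"

lemma K: "subfield K \<Omega>"
  using closure by (simp add: algebraic_closure_def)

lemma alg: "x \<in> carrier \<Omega> \<Longrightarrow> (algebraic over K) x"
  using closure by (simp add: algebraic_closure_def algebraic_closure_axioms_def)

lemma splits: "P \<in> carrier (K[X]) \<Longrightarrow> splitted P"
  using closure by (simp add: algebraic_closure_def algebraic_closure_axioms_def)

lemma K_carrier: "x \<in> K \<Longrightarrow> x \<in> carrier \<Omega>"
  using subfieldE(3)[OF K] by blast

lemma alg_over: "K \<subseteq> E \<Longrightarrow> x \<in> carrier \<Omega> \<Longrightarrow> (algebraic over E) x"
  using algebraic_mono[of K E x] alg by (simp add: over_def)

lemma q_gt_1: "1 < q" by (rule Kl.Q_gt_1)

lemma valued_extensionI: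
  assumes "subfield E \<Omega>" "K \<subseteq> E" "valuation_extends \<Omega> K v E w e"
  shows "valued_extension (\<Omega>\<lparr>carrier := E\<rparr>) w K v e"
  using assms subfield_carrier_update[OF assms(1) K assms(2)] local
  by (auto simp: valuation_extends_def valued_extension_def valued_extension_axioms_def)

text \<open>Bundles the given data of an unramified extension with consequences that
  \<open>unramI\<close> derives once: completeness and the size of the residue field.\<close>

definition unram :: "nat \<Rightarrow> 'a set \<Rightarrow> ('a \<Rightarrow> int) \<Rightarrow> bool" where
  "unram n E w \<longleftrightarrow> subfield E \<Omega> \<and> K \<subseteq> E \<and> dimension n K E \<and> 0 < n \<and>
     valued_extension (\<Omega>\<lparr>carrier := E\<rparr>) w K v 1 \<and> local_field (\<Omega>\<lparr>carrier := E\<rparr>) w \<and>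
     card (carrier (residue_field (\<Omega>\<lparr>carrier := E\<rparr>) w)) = q ^ n"

lemma complete_of_finite:
  assumes "finite_subextension \<Omega> K E" "valued_extension (\<Omega>\<lparr>carrier := E\<rparr>) w K v e"
    and "finite (carrier (residue_field (\<Omega>\<lparr>carrier := E\<rparr>) w))"
  shows "local_field (\<Omega>\<lparr>carrier := E\<rparr>) w"
proof -
  interpret V: valued_extension "\<Omega>\<lparr>carrier := E\<rparr>" w K v e by (rule assms(2))
  have E: "subfield E \<Omega>" "K \<subseteq> E" "finite_dimension K E"
    using assms(1) by (auto simp: finite_subextension_def)
  obtain n where "dimension n K E" using E by blast
  then obtain us where us: "independent K us" "Span K us = E" using exists_base[OF K] by blast
  have "set us \<subseteq> E" using Span_base_incl[OF K independent_in_carrier[OF us(1)]] us by simp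
  then show ?thesis using V.complete_of_Span[of us] us Span_consistent[OF subfieldE(1)[OF E(1)]] assms(3) by simp
qed

lemma unramI:
  assumes "finite_subextension \<Omega> K E" "dimension n K E" "valuation_extends \<Omega> K v E w 1"
  shows "unram n E w"
proof -
  have E: "subfield E \<Omega>" "K \<subseteq> E" using assms(1) by (auto simp: finite_subextension_def)
  note ve = valued_extensionI[OF E assms(3)]
  interpret V: valued_extension "\<Omega>\<lparr>carrier := E\<rparr>" w K v 1 by (rule ve)
  have d: "V.dimension n K (carrier (\<Omega>\<lparr>carrier := E\<rparr>))"
    using dimension_carrier_update[OF subfieldE(1)[OF E(1)] E(2) K assms(2)] by simp
  note r = V.residue_card[OF V.unramified_residue_degree[OF refl d]]
  have "n \<noteq> 0"
  proof
    assume "n = 0"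
    then have "E = {\<zero>}" using dimension_zero[OF K, of E] assms(2) by simp
    then show False using subringE(3)[OF subfieldE(1)[OF E(1)]] by simp
  qed
  moreover have "V.Kl.Q = q" by simp
  ultimately show ?thesis using E assms(2) ve complete_of_finite[OF assms(1) ve r(1)] r(2)
    by (simp add: unram_def)
qed

lemma unramD: "unram n E w \<Longrightarrow> subfield E \<Omega>" "unram n E w \<Longrightarrow> K \<subseteq> E" "unram n E w \<Longrightarrow> dimension n K E"
  "unram n E w \<Longrightarrow> 0 < n" "unram n E w \<Longrightarrow> valued_extension (\<Omega>\<lparr>carrier := E\<rparr>) w K v 1"
  "unram n E w \<Longrightarrow> local_field (\<Omega>\<lparr>carrier := E\<rparr>) w" "unram n E w \<Longrightarrow> E \<subseteq> carrier \<Omega>"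
  using subfieldE(3) by (auto simp: unram_def)

lemma unram_Q: "unram n E w \<Longrightarrow> finite_residue_valuation.Q (\<Omega>\<lparr>carrier := E\<rparr>) w = q ^ n"
proof -
  assume a: "unram n E w"
  interpret L: local_field "\<Omega>\<lparr>carrier := E\<rparr>" w using unramD(6)[OF a] .
  show ?thesis using a by (simp add: L.Q_def unram_def)
qed

lemma qn_pos: "0 < n \<Longrightarrow> 0 < q ^ n - 1"
  using one_less_power[OF q_gt_1] by simp

lemma unram_primitive_root:
  assumes "unram n E w"
  obtains x where "x \<in> E" "\<And>i. x [^] (i::nat) = \<one> \<longleftrightarrow> (q ^ n - 1) dvd i"
proof -
  interpret L: local_field "\<Omega>\<lparr>carrier := E\<rparr>" w using unramD(6)[OF assms] .
  show thesis using L.primitive_root_exists that unram_Q[OF assms] by auto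
qed

lemma unram_root_of_unity_mem:
  assumes "unram n E w" "z \<in> carrier \<Omega>" "z [^] (q ^ n - 1) = \<one>"
  shows "z \<in> E"
proof -
  obtain x where x: "x \<in> E" "\<And>i. x [^] (i::nat) = \<one> \<longleftrightarrow> (q ^ n - 1) dvd i"
    using unram_primitive_root[OF assms(1)] by blast
  have "\<exists>s<q ^ n - 1. z = x [^] s"
    by (rule root_of_unity_is_power)
      (use x assms(2,3) qn_pos unramD(4)[OF assms(1)] subsetD[OF unramD(7)[OF assms(1)]] in auto)
  then show ?thesis using subfield_pow[OF unramD(1)[OF assms(1)] x(1)] by blast
qed

lemma fixed_of_root_of_unity:
  assumes "z \<in> carrier \<Omega>" "0 < n" shows "z [^] (q ^ n - 1) = \<one> \<Longrightarrow> z [^] (q ^ n) = z"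
    and "z [^] (q ^ n) = z \<Longrightarrow> z \<noteq> \<zero> \<Longrightarrow> z [^] (q ^ n - 1) = \<one>"
proof -
  have "q ^ n = Suc (q ^ n - 1)" using qn_pos[OF assms(2)] by simp
  then have s: "z [^] (q ^ n) = z [^] (q ^ n - 1) \<otimes> z" using nat_pow_Suc[of z "q ^ n - 1"] by metis
  then show "z [^] (q ^ n - 1) = \<one> \<Longrightarrow> z [^] (q ^ n) = z" using assms by simp
  assume a: "z [^] (q ^ n) = z" "z \<noteq> \<zero>"
  then have "z [^] (q ^ n - 1) \<otimes> z = \<one> \<otimes> z" using s assms by simp
  then show "z [^] (q ^ n - 1) = \<one>" using m_rcancel[of z "z [^] (q ^ n - 1)" \<one>] a assms by simp
qed

text \<open>The hypothesis on \<open>x\<close> says that x^(q^i) first returns to \<open>x\<close>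
  at i = n. These n powers have distinct residues, all of them roots of the reduced minimal
  polynomial, so its degree is at least n; the degree of \<open>E\<close> gives the opposite bound.
  Conversely every root of the minimal polynomial is a root of unity of \<open>E\<close> with one of
  these residues, hence one of the powers. In particular x^q is a conjugate of
  \<open>x\<close>.\<close>

lemma unram_generator:
  assumes un: "unram n E w" and x: "x \<in> carrier \<Omega>" "\<And>j. x [^] (q ^ j - 1) = \<one> \<longleftrightarrow> n dvd j"
  shows "adjoin \<Omega> K x = E" "degree (Irr K x) = n" "is_root (Irr K x) (x [^] q)"
    "inj_on (\<lambda>i::nat. x [^] (q ^ i)) {..<n}"
proof -
  interpret L: local_field "\<Omega>\<lparr>carrier := E\<rparr>" w using unramD(6)[OF un] .
  interpret V: valued_extension "\<Omega>\<lparr>carrier := E\<rparr>" w K v 1 using unramD(5)[OF un] .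
  note E = unramD[OF un]
  have Er: "subring E \<Omega>" using subfieldE(1)[OF E(1)] .
  have x1: "x [^] (q ^ n - 1) = \<one>" using x(2) by simp
  have xQ: "x [^] (q ^ n) = x" using fixed_of_root_of_unity(1)[OF x(1) E(4) x1] .
  have xE: "x \<in> E" using unram_root_of_unity_mem[OF un x(1) x1] .
  have xnz: "x \<noteq> \<zero>" using x1 nat_pow_zero[of "q ^ n - 1"] qn_pos[OF E(4)] one_not_zero by (metis not_gr_zero)
  have teich: "(x [^] m) [^] (q ^ n) = x [^] m" for m :: nat using xQ x(1) by (metis mult.commute nat_pow_pow)
  have LB: "y \<in> L.B 0" if "y \<in> E" "y [^] (q ^ n) = y" for y
    using L.teichmuller_vball[of y] unram_Q[OF un] that by simp
  have res_inj: "y = z" if "y \<in> E" "z \<in> E" "y [^] (q ^ n) = y" "z [^] (q ^ n) = z" "L.res y = L.res z" for y z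
    using L.teichmuller_unique[of y z] L.res_eq_iff[of y z] LB unram_Q[OF un] that by simp
  have inj0: "inj_on (\<lambda>i::nat. x [^] (q ^ i)) {..<n}"
  proof -
    have "i = j" if ij: "i \<le> j" "j < n" "x [^] (q ^ i) = x [^] (q ^ j)" for i j
    proof -
      define y where "y = x [^] (q ^ (j - i) - 1)"
      have yc: "y \<in> carrier \<Omega>" using x by (simp add: y_def)
      have "1 \<le> q ^ (j - i)" using q_gt_1 by simp
      then have e: "q ^ j = q ^ i * (q ^ (j - i) - 1) + q ^ i"
        using ij(1) power_increasing[of i j q] q_gt_1 by (simp add: algebra_simps power_add[symmetric])
      have "x [^] (q ^ j) = y [^] (q ^ i) \<otimes> x [^] (q ^ i)"
        unfolding e y_def using x(1) by (simp add: nat_pow_mult[symmetric] nat_pow_pow mult.commute)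
      then have "y [^] (q ^ i) \<otimes> x [^] (q ^ i) = \<one> \<otimes> x [^] (q ^ i)" using ij x by simp
      then have "y [^] (q ^ i) = \<one>"
        using m_rcancel[of "x [^] (q ^ i)" "y [^] (q ^ i)" \<one>] yc x(1) pow_non_zero[OF x(1) xnz] by simp
      \<comment> \<open>Raising on to the power q^n, which fixes powers of \<open>x\<close>, shows
        that \<open>y\<close> itself is 1.\<close>
      then have "(y [^] (q ^ i)) [^] (q ^ (n - i)) = \<one>" by simp
      then have "y [^] (q ^ n) = \<one>" using yc ij by (simp add: nat_pow_pow power_add[symmetric])
      then have "y = \<one>" using teich by (simp add: y_def)
      then have "n dvd (j - i)" using x(2) by (simp add: y_def)
      then show "i = j" using ij dvd_imp_le[of n "j - i"] by fastforce
    qed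
    then show ?thesis by (intro inj_onI) (metis lessThan_iff nat_le_linear)
  qed
  then show "inj_on (\<lambda>i::nat. x [^] (q ^ i)) {..<n}" .
  have pE: "x [^] m \<in> E" for m :: nat using subfield_pow[OF E(1) xE] .
  have inj: "inj_on (\<lambda>i::nat. L.res (x [^]\<^bsub>\<Omega>\<lparr>carrier := E\<rparr>\<^esub> (V.Kl.Q ^ i))) {..<n}"
  proof (rule inj_onI)
    fix i j assume a: "i \<in> {..<n}" "j \<in> {..<n}" "L.res (x [^]\<^bsub>\<Omega>\<lparr>carrier := E\<rparr>\<^esub> (V.Kl.Q ^ i)) = L.res (x [^]\<^bsub>\<Omega>\<lparr>carrier := E\<rparr>\<^esub> (V.Kl.Q ^ j))"
    then have "x [^] (q ^ i) = x [^] (q ^ j)"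
      using res_inj[OF pE pE teich teich, of "q ^ i" "q ^ j"] by simp
    then show "i = j" using inj0 a by (meson inj_onD)
  qed
  define P where "P = Irr K x"
  note I = IrrE[OF K x(1) alg[OF x(1)], folded P_def]
  have Pnz: "P \<noteq> []" using pirreducibleE(1)[OF subfieldE(1)[OF K] I(1,2)] .
  have PK: "set P \<subseteq> K" using poly_set[OF I(1)] .
  have Pne: "\<not> set P \<subseteq> {\<zero>}" using I(3) Pnz one_not_zero by (metis hd_in_set singletonD subsetD)
  have evc: "ring.eval (\<Omega>\<lparr>carrier := E\<rparr>) = eval" using eval_consistent[OF Er] .
  note cm = V.conjugates_mod_maximal[OF L.fin_k, of P x n]
  have nlen: "n < length P"
    by (rule cm(1)) (use PK Pne LB[OF xE xQ] I(4) evc inj in simp_all)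
  have adjE: "adjoin \<Omega> K x \<subseteq> E" using adjoin_subset[OF K E(1,2) xE] .
  have ind: "independent K (exp_base x (degree P))"
    using exp_base_independent[OF K x(1) alg[OF x(1)]] by (simp add: P_def)
  have spn: "Span K (exp_base x (degree P)) = adjoin \<Omega> K x"
    using Span_exp_base[OF K x(1) alg[OF x(1)]] adjoin_eq_simple_extension[OF K x(1) alg[OF x(1)]] by (simp add: P_def)
  have sub: "set (exp_base x (degree P)) \<subseteq> E"
    using Span_base_incl[OF K exp_base_closed[OF x(1)], of "degree P"] spn adjE by simp
  have elen: "length (exp_base x (degree P)) = degree P" by (simp add: exp_base_def)
  have "degree P \<le> n" using independent_length_le_dimension[OF K E(3) ind sub] elen by simp
  then have deg: "degree P = n" using nlen by simp
  then show "degree (Irr K x) = n" by (simp add: P_def)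
  show "adjoin \<Omega> K x = E"
    using independent_length_eq_dimension[OF K E(3) ind sub] elen deg spn by simp
  define T where "T = (\<lambda>i::nat. x [^] (q ^ i)) ` {..<n}"
  have T: "finite T" "card T = n" using inj0 by (auto simp: T_def card_image)
  define m where "m = q ^ n - 1"
  have m: "0 < m" using qn_pos[OF E(4)] by (simp add: m_def)
  note Kr = subfieldE(1)[OF K]
  have oneK: "\<one> \<in> K" using subringE(3)[OF Kr] .
  note bp = binom_poly_closed[OF Kr oneK, of m]
  note bpc = carrier_polynomial_shell[OF Kr bp(1)]
  note Pc = carrier_polynomial_shell[OF Kr I(1)]
  have bev: "eval (binom_poly m \<one>) z = z [^] m \<ominus> \<one>" if "z \<in> carrier \<Omega>" for z
    using binom_poly_eval[OF m _ that] by simp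
  \<comment> \<open>X^m - 1 has m distinct roots in \<open>E\<close>. Thus the roots of
    \<open>P\<close> are simple, lie in \<open>E\<close>, and are determined by their
    residues.\<close>
  have div: "P pdivides (binom_poly m \<one>)" unfolding P_def
    by (rule Irr_minimal[OF K x(1) alg[OF x(1)] bp(1)]) (use bev[OF x(1)] x1 in \<open>simp add: m_def minus_eq r_neg\<close>)
  obtain z where z: "z \<in> E" "\<And>i. z [^] (i::nat) = \<one> \<longleftrightarrow> m dvd i"
    using unram_primitive_root[OF un] by (auto simp: m_def)
  have zc: "z \<in> carrier \<Omega>" using z E(7) by blast
  define S where "S = (\<lambda>i::nat. z [^] i) ` {..<m}"
  have S: "finite S" "card S = m" "S \<subseteq> carrier \<Omega>"
    using primitive_root_inj(1)[OF zc z(2) m] zc by (auto simp: S_def card_image)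
  have Sroot: "eval (binom_poly m \<one>) s = \<zero>" if "s \<in> S" for s
  proof -
    have "z [^] m = \<one>" using z by simp
    then have "s [^] m = \<one>" using that zc unfolding S_def by (metis (no_types, lifting) imageE mult.commute nat_pow_one nat_pow_pow)
    then show ?thesis using bev[of s] that S by (auto simp: minus_eq r_neg)
  qed
  have mult1: "count (roots P) a \<le> 1" for a
  proof -
    have "alg_mult (binom_poly m \<one>) a \<le> 1"
      by (rule alg_mult_le_1_of_many_roots(1)[OF bpc bp(2) S(1,3) Sroot]) (use S binom_poly_length[OF m] in auto)
    moreover have "roots P \<subseteq># roots (binom_poly m \<one>)" using pdivides_imp_roots_incl[OF Pc bpc bp(2) div] .
    ultimately show ?thesis using alg_mult_eq_count_roots[OF bpc] by (metis le_trans mset_subset_eq_count)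
  qed
  have rT: "a \<in> T" if "a \<in># roots P" for a
  proof -
    have a: "a \<in> carrier \<Omega>" "eval P a = \<zero>"
      using that roots_mem_iff_is_root[OF Pc, of a] by (auto simp: is_root_def)
    then have "eval (binom_poly m \<one>) a = \<zero>" using pdivides_imp_root_sharing[OF Pc div] by blast
    then have a1: "a [^] m = \<one>" using bev[OF a(1)] a by simp
    have aE: "a \<in> E" using unram_root_of_unity_mem[OF un a(1)] a1 by (simp add: m_def)
    have aQ: "a [^] (q ^ n) = a" using fixed_of_root_of_unity(1)[OF a(1) E(4)] a1 by (simp add: m_def)
    have "\<exists>i<n. L.res a = L.res (x [^]\<^bsub>\<Omega>\<lparr>carrier := E\<rparr>\<^esub> (V.Kl.Q ^ i))"
      by (rule cm(2)) (use PK Pne LB[OF xE xQ] LB[OF aE aQ] I(4) evc inj a deg nlen in simp_all)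
    then obtain i where i: "i < n" "L.res a = L.res (x [^] (q ^ i))" by auto
    then have "a = x [^] (q ^ i)" using res_inj[OF aE pE aQ teich] by blast
    then show ?thesis using i by (auto simp: T_def)
  qed
  \<comment> \<open>\<open>P\<close> splits in \<Omega> and has degree n. Its simple roots lie in
    the set \<open>T\<close> of size n, so every element of \<open>T\<close> is a root.\<close>
  have "roots P \<subseteq># mset_set T"
  proof (rule mset_subset_eqI)
    fix a show "count (roots P) a \<le> count (mset_set T) a"
      using mult1[of a] rT[of a] T by (cases "a \<in># roots P") (auto simp: not_in_iff)
  qed
  moreover have "size (roots P) = n" using splits[OF I(1)] deg by (simp add: splitted_def)
  ultimately have "roots P = mset_set T" using T
    by (metis mset_subset_size nat_less_le size_mset_set subset_mset.le_imp_less_or_eq)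
  moreover have "x [^] q \<in> T"
  proof (cases "n = 1")
    \<comment> \<open>For n = 1 the index 1 is out of range, but then x^q = x.\<close>
    case True
    then have "x [^] q = x [^] (q ^ 0)" using xQ x(1) by simp
    then show ?thesis using True by (auto simp: T_def)
  next
    case False
    then show ?thesis using E(4) unfolding T_def by (intro image_eqI[of _ _ 1]) auto
  qed
  ultimately have "x [^] q \<in># roots P" using T by simp
  then show "is_root (Irr K x) (x [^] q)" using roots_mem_iff_is_root[OF Pc] by (simp add: P_def)
qed

text \<open>If \<open>x\<close> and \<open>y\<close> are the powers \<open>z ^ s\<close> and \<open>z ^ t\<close> of a primitive root of unity \<open>z\<close> of \<open>E\<close>,
  then \<open>A\<close> contains \<open>z ^ gcd s t\<close>, which generates \<open>E\<close> even if neither \<open>x\<close> nor \<open>y\<close> does.\<close>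
lemma unram_subset_of_roots:
  assumes un: "unram n E w" and A: "subfield A \<Omega>" "K \<subseteq> A" "x \<in> A" "y \<in> A"
    and xy: "\<And>j. x [^] (q ^ j - 1) = \<one> \<and> y [^] (q ^ j - 1) = \<one> \<longleftrightarrow> n dvd j"
  shows "E \<subseteq> A"
proof -
  note E = unramD[OF un]
  have xc: "x \<in> carrier \<Omega>" "y \<in> carrier \<Omega>" using A subfieldE(3) by blast+
  obtain z where z: "z \<in> E" "\<And>i. z [^] (i::nat) = \<one> \<longleftrightarrow> (q ^ n - 1) dvd i"
    using unram_primitive_root[OF un] by blast
  have zc: "z \<in> carrier \<Omega>" using z E by blast
  note rp = root_of_unity_is_power[OF zc z(2) qn_pos[OF E(4)]]
  obtain s :: nat where s: "x = z [^] s" using rp[OF xc(1)] xy[of n] by auto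
  obtain t :: nat where t: "y = z [^] t" using rp[OF xc(2)] xy[of n] by auto
  have znz: "z \<noteq> \<zero>" using primitive_root_inj(2)[OF zc z(2) qn_pos[OF E(4)]] .
  have "z [^] gcd s t \<in> A"
  proof (cases "s = 0")
    case True then show ?thesis using t A by simp
  next
    case False
    \<comment> \<open>With natural exponents Bezout reads s a = t b + gcd, so the power with
      exponent gcd is a quotient of two elements of \<open>A\<close>.\<close>
    obtain a b where ab: "s * a = t * b + gcd s t" using bezout_nat[OF False] by blast
    have 1: "z [^] (t * b) \<in> A" "z [^] (s * a) \<in> A"
      using subfield_pow[OF A(1,4), of b] subfield_pow[OF A(1,3), of a] zc s t by (auto simp: nat_pow_pow)
    have nz: "z [^] (t * b) \<noteq> \<zero>" using pow_non_zero[OF zc znz] .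
    have 2: "z [^] (s * a) = z [^] (t * b) \<otimes> z [^] gcd s t" using ab zc by (simp add: nat_pow_mult)
    then show ?thesis
      using subfield_m_inv_simprule[OF A(1), of "z [^] (t * b)" "z [^] gcd s t"] 1 nz zc by auto
  qed
  moreover have "adjoin \<Omega> K (z [^] gcd s t) = E"
  proof (rule unram_generator(1)[OF un])
    show "z [^] gcd s t \<in> carrier \<Omega>" using zc by simp
    fix j
    have "(z [^] gcd s t) [^] (q ^ j - 1) = \<one> \<longleftrightarrow> (q ^ n - 1) dvd gcd s t * (q ^ j - 1)"
      using zc z(2) by (simp add: nat_pow_pow)
    also have "\<dots> \<longleftrightarrow> (q ^ n - 1) dvd gcd (s * (q ^ j - 1)) (t * (q ^ j - 1))"
    proof -
      have "gcd (s * (q ^ j - 1)) (t * (q ^ j - 1)) = gcd s t * (q ^ j - 1)"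
        by (metis gcd_mult_distrib_nat mult.commute)
      then show ?thesis by simp
    qed
    also have "\<dots> \<longleftrightarrow> x [^] (q ^ j - 1) = \<one> \<and> y [^] (q ^ j - 1) = \<one>"
      unfolding gcd_greatest_iff using zc z(2) s t by (simp add: nat_pow_pow)
    finally show "(z [^] gcd s t) [^] (q ^ j - 1) = \<one> \<longleftrightarrow> n dvd j" using xy by simp
  qed
  ultimately show ?thesis using adjoin_subset[OF K A(1,2)] by blast
qed

lemma unram_subset:
  assumes "unram n E w" "subfield A \<Omega>" "K \<subseteq> A" "x \<in> A" "\<And>i. x [^] (i::nat) = \<one> \<longleftrightarrow> (q ^ n - 1) dvd i"
  shows "E \<subseteq> A"
  by (rule unram_subset_of_roots[OF assms(1-4,4)])
    (use assms(5) pow_minus_one_dvd_iff[OF q_gt_1 unramD(4)[OF assms(1)]] in simp)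

lemma unram_mono:
  assumes "unram n E w" "unram N E' w'" "n dvd N"
  shows "E \<subseteq> E'"
proof -
  obtain x where x: "x \<in> E" "\<And>i. x [^] (i::nat) = \<one> \<longleftrightarrow> (q ^ n - 1) dvd i"
    using unram_primitive_root[OF assms(1)] by blast
  have "x [^] (q ^ N - 1) = \<one>"
    using x(2) pow_minus_one_dvd_iff[OF q_gt_1 unramD(4)[OF assms(1)]] assms(3) by simp
  then have "x \<in> E'" using unram_root_of_unity_mem[OF assms(2)] x(1) unramD(7)[OF assms(1)] by blast
  then show ?thesis using unram_subset[OF assms(1) unramD(1,2)[OF assms(2)] _ x(2)] by blast
qed

text \<open>The identity of \<open>K\<close> is extended by sending a primitive root of unity to its
  conjugate x^q. Every (q^n - 1)-th root of unity is a power of it, so the formula holds for all of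
  them.\<close>

lemma frobenius_hom:
  assumes un: "unram n E w"
  obtains g where "g \<in> ring_hom (\<Omega>\<lparr>carrier := E\<rparr>) \<Omega>" "\<And>c. c \<in> K \<Longrightarrow> g c = c"
    "\<And>z. z \<in> carrier \<Omega> \<Longrightarrow> z [^] (q ^ n - 1) = \<one> \<Longrightarrow> g z = z [^] q"
proof -
  note E = unramD[OF un]
  obtain x where x: "x \<in> E" "\<And>i. x [^] (i::nat) = \<one> \<longleftrightarrow> (q ^ n - 1) dvd i"
    using unram_primitive_root[OF un] by blast
  have xc: "x \<in> carrier \<Omega>" using x E by blast
  have gen: "x [^] (q ^ j - 1) = \<one> \<longleftrightarrow> n dvd j" for j
    using x(2) pow_minus_one_dvd_iff[OF q_gt_1 E(4)] by simp
  note ug = unram_generator[OF un xc gen]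
  have idh: "id \<in> ring_hom (\<Omega>\<lparr>carrier := K\<rparr>) \<Omega>"
    using K_carrier by (auto simp: ring_hom_def)
  obtain g where g: "g \<in> ring_hom (\<Omega>\<lparr>carrier := E\<rparr>) \<Omega>" "\<forall>c\<in>K. g c = c" "g x = x [^] q"
    using extend_hom[OF K xc alg[OF xc] idh, of "x [^] q"] ug xc by (auto simp: is_root_def)
  have "g z = z [^] q" if z: "z \<in> carrier \<Omega>" "z [^] (q ^ n - 1) = \<one>" for z
  proof -
    obtain s :: nat where s: "z = x [^] s"
      using root_of_unity_is_power[OF xc x(2) qn_pos[OF E(4)] z] by blast
    then show ?thesis using hom_pow(1)[OF E(1) g(1) x(1)] g(3) xc by (simp add: nat_pow_pow mult.commute)
  qed
  then show thesis using that g by blast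
qed

end

section \<open>Adjoining a root of a uniformiser\<close>

context field begin

text \<open>\<open>A\<close> plays the role of the valuation ring and \<open>t\<close> that of a prime element; the normal form of
  \<open>dec\<close> is \<open>x = t ^ (j - i) y\<close> with \<open>y\<close> a unit, written without negative powers.\<close>
lemma valuation_of_prime_element:
  assumes A: "A \<subseteq> carrier R" "\<one> \<in> A" "\<And>x y. x \<in> A \<Longrightarrow> y \<in> A \<Longrightarrow> x \<oplus> y \<in> A" "\<And>x y. x \<in> A \<Longrightarrow> y \<in> A \<Longrightarrow> x \<otimes> y \<in> A"
    and t: "t \<in> A" "t \<noteq> \<zero>"
    and prime: "\<And>y z. y \<in> A \<Longrightarrow> z \<in> A \<Longrightarrow> y \<notin> (\<otimes>) t ` A \<Longrightarrow> z \<notin> (\<otimes>) t ` A \<Longrightarrow> y \<otimes> z \<notin> (\<otimes>) t ` A"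
    and dec: "\<And>x. x \<in> carrier R \<Longrightarrow> x \<noteq> \<zero> \<Longrightarrow>
      \<exists>(i::nat) (j::nat). \<exists>y\<in>A. y \<notin> (\<otimes>) t ` A \<and> x \<otimes> t [^] i = t [^] j \<otimes> y"
  shows "\<exists>w. normalised_valuation R w \<and> (\<forall>x\<in>carrier R. \<forall>(i::nat) (j::nat). \<forall>y\<in>A. y \<notin> (\<otimes>) t ` A \<longrightarrow>
    x \<otimes> t [^] i = t [^] j \<otimes> y \<longrightarrow> w x = int j - int i)"
proof -
  define Pr where "Pr y \<longleftrightarrow> y \<in> A \<and> y \<notin> (\<otimes>) t ` A" for y
  define rel where "rel x i j y \<longleftrightarrow> Pr y \<and> x \<otimes> t [^] (i::nat) = t [^] (j::nat) \<otimes> y" for x i j y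
  have tc: "t \<in> carrier R" using A t by blast
  have tp: "t [^] (n::nat) \<in> A" for n by (induction n) (use A t in auto)
  have tpc: "t [^] (n::nat) \<in> carrier R" for n using tc by simp
  have tpnz: "t [^] (n::nat) \<noteq> \<zero>" for n using pow_non_zero tc t by simp
  have Prc: "y \<in> carrier R" if "Pr y" for y using that A by (auto simp: Pr_def)
  have big: "\<not> Pr (t [^] d \<otimes> y)" if dy: "0 < d" "y \<in> A" for d :: nat and y
  proof -
    obtain d' where d: "d = Suc d'" using gr0_implies_Suc[OF dy(1)] by blast
    have "t [^] d \<otimes> y = t \<otimes> (t [^] d' \<otimes> y)" unfolding d using tc subsetD[OF A(1) dy(2)] by (simp add: m_ac)
    then show ?thesis using A(4)[OF tp[of d'] dy(2)] unfolding Pr_def by blast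
  qed
  have shift: "x \<otimes> t [^] (i + d) = t [^] (j + d) \<otimes> y" if "rel x i j y" "x \<in> carrier R" for x i j y and d :: nat
  proof -
    have yc: "y \<in> carrier R" "x \<otimes> t [^] i = t [^] j \<otimes> y" using that Prc by (auto simp: rel_def)
    have "x \<otimes> t [^] (i + d) = (x \<otimes> t [^] i) \<otimes> t [^] d"
      using that(2) tc by (simp add: nat_pow_mult[symmetric] m_assoc)
    also have "\<dots> = t [^] (j + d) \<otimes> y"
      unfolding yc(2) using tc yc(1) by (simp add: nat_pow_mult[symmetric] m_ac)
    finally show ?thesis .
  qed
  have cmp: "b \<le> a" if yz: "t [^] a \<otimes> y = t [^] b \<otimes> z" "Pr y" "z \<in> A" for a b :: nat and y z
  proof (rule ccontr)
    assume ab: "\<not> b \<le> a"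
    have c: "y \<in> carrier R" "z \<in> carrier R" using yz A Prc by auto
    have "t [^] b = t [^] a \<otimes> t [^] (b - a)" using ab tc by (simp add: nat_pow_mult)
    then have "t [^] a \<otimes> y = t [^] a \<otimes> (t [^] (b - a) \<otimes> z)" using yz(1) c tc by (simp add: m_assoc)
    then have "y = t [^] (b - a) \<otimes> z"
      using m_lcancel[of "t [^] a" y "t [^] (b - a) \<otimes> z"] tpnz c tc by simp
    then show False using big[of "b - a" z] ab yz by simp
  qed
  define w where "w x = (THE n. \<exists>i j y. rel x i j y \<and> n = int j - int i)" for x
  have wI: "w x = int j - int i" if x: "x \<in> carrier R" "rel x i j y" for x i j y
    unfolding w_def
  proof (rule the_equality)
    show "\<exists>i' j' y. rel x i' j' y \<and> int j - int i = int j' - int i'" using that by blast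
    fix n assume "\<exists>i j y. rel x i j y \<and> n = int j - int i"
    then obtain i' j' y' where r: "rel x i' j' y'" "n = int j' - int i'" by blast
    have e: "t [^] (j + i') \<otimes> y = t [^] (j' + i) \<otimes> y'"
      using shift[OF x(2,1), of i'] shift[OF r(1) x(1), of i] by (simp add: add.commute)
    have "j' + i \<le> j + i'" using cmp[OF e] x r by (simp add: rel_def Pr_def)
    moreover have "j + i' \<le> j' + i" using cmp[OF e[symmetric]] x r by (simp add: rel_def Pr_def)
    ultimately show "n = int j - int i" using r by linarith
  qed
  have ex: "\<exists>i j y. rel x i j y" if "x \<in> carrier R - {\<zero>}" for x
    using dec[of x] that unfolding rel_def Pr_def by blast
  have Pr1: "Pr \<one>"
  proof (rule ccontr)
    \<comment> \<open>If 1 were a multiple of \<open>t\<close>, every element of \<open>A\<close>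
      would be, and the normal form of 1 could have no cofactor outside t A.\<close>
    assume "\<not> Pr \<one>"
    then obtain s where s: "s \<in> A" "\<one> = t \<otimes> s" using A by (auto simp: Pr_def)
    obtain i j y where r: "rel \<one> i j y" using ex[of \<one>] by auto
    then have y: "y \<in> A" "Pr y" by (auto simp: rel_def Pr_def)
    have "y = t \<otimes> (s \<otimes> y)" using s Prc[OF y(2)] tc A by (metis l_one m_assoc subsetD)
    then show False using y A(4)[OF s(1) y(1)] by (auto simp: Pr_def)
  qed
  have "normalised_valuation R w"
  proof (intro normalised_valuation.intro normalised_valuation_axioms.intro field_axioms)
    fix x x' assume x: "x \<in> carrier R - {\<zero>}" "x' \<in> carrier R - {\<zero>}"
    obtain i j y where r: "rel x i j y" using ex[OF x(1)] by blast
    obtain i' j' y' where r': "rel x' i' j' y'" using ex[OF x(2)] by blast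
    have c: "y \<in> carrier R" "y' \<in> carrier R" "x \<in> carrier R" "x' \<in> carrier R"
      using r r' Prc x by (auto simp: rel_def)
    have e: "x \<otimes> t [^] i = t [^] j \<otimes> y" "x' \<otimes> t [^] i' = t [^] j' \<otimes> y'"
      using r r' by (auto simp: rel_def)
    have "(x \<otimes> x') \<otimes> t [^] (i + i') = (x \<otimes> t [^] i) \<otimes> (x' \<otimes> t [^] i')"
      using c tc by (simp add: nat_pow_mult[symmetric] m_ac)
    also have "\<dots> = t [^] (j + j') \<otimes> (y \<otimes> y')"
      unfolding e using c tc by (simp add: nat_pow_mult[symmetric] m_ac)
    finally have "rel (x \<otimes> x') (i + i') (j + j') (y \<otimes> y')"
      using r r' prime A(4) by (auto simp: rel_def Pr_def)
    then show "w (x \<otimes> x') = w x + w x'" using wI r r' c by simp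
  next
    fix x x' assume x: "x \<in> carrier R - {\<zero>}" "x' \<in> carrier R - {\<zero>}" "x \<oplus> x' \<noteq> \<zero>"
    obtain i j y where r: "rel x i j y" using ex[OF x(1)] by blast
    obtain i' j' y' where r': "rel x' i' j' y'" using ex[OF x(2)] by blast
    have c: "y \<in> carrier R" "y' \<in> carrier R" "x \<in> carrier R" "x' \<in> carrier R" "y \<in> A" "y' \<in> A"
      using r r' Prc x by (auto simp: rel_def Pr_def)
    obtain k l z where s: "rel (x \<oplus> x') k l z" using ex[of "x \<oplus> x'"] x by auto
    have zc: "z \<in> carrier R" "Pr z" using s Prc by (auto simp: rel_def)
    \<comment> \<open>After the denominators of \<open>x\<close>, \<open>x'\<close> and their sum
      are cleared together, t^m is the largest power of \<open>t\<close> visible in both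
      summands.\<close>
    define m where "m = min (j + k + i') (j' + k + i)"
    have "(x \<oplus> x') \<otimes> t [^] (k + (i + i')) = x \<otimes> t [^] (i + (k + i')) \<oplus> x' \<otimes> t [^] (i' + (k + i))"
      using c tc by (simp add: l_distr ac_simps)
    then have "t [^] (l + (i + i')) \<otimes> z = t [^] (j + (k + i')) \<otimes> y \<oplus> t [^] (j' + (k + i)) \<otimes> y'"
      using shift[OF r c(3)] shift[OF r' c(4)] shift[OF s, of "i + i'"] c by simp
    also have "\<dots> = t [^] m \<otimes> (t [^] (j + (k + i') - m) \<otimes> y \<oplus> t [^] (j' + (k + i) - m) \<otimes> y')"
    proof -
      have "t [^] (j + (k + i')) = t [^] m \<otimes> t [^] (j + (k + i') - m)"
        "t [^] (j' + (k + i)) = t [^] m \<otimes> t [^] (j' + (k + i) - m)"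
        using tc by (auto simp: nat_pow_mult m_def)
      then show ?thesis using c tc by (simp add: r_distr m_assoc)
    qed
    finally have "m \<le> l + (i + i')" using cmp[of "l + (i + i')" z m] zc A tp c by simp
    then show "min (w x) (w x') \<le> w (x \<oplus> x')"
      using wI[OF c(3) r] wI[OF c(4) r'] wI[of "x \<oplus> x'", OF _ s] c by (simp add: m_def min_def split: if_splits)
  next
    show "w ` (carrier R - {\<zero>}) = UNIV"
    proof (intro equalityI subsetI UNIV_I)
      fix n :: int
      show "n \<in> w ` (carrier R - {\<zero>})"
      proof (cases "0 \<le> n")
        case True
        have "rel (t [^] nat n) 0 (nat n) \<one>" using Pr1 tpc by (simp add: rel_def)
        then have "w (t [^] nat n) = int (nat n) - int 0" by (rule wI[OF tpc])
        also have "\<dots> = n" using True by simp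
        finally have "w (t [^] nat n) = n" .
        then show ?thesis using tpc tpnz by (metis DiffI imageI singletonD)
      next
        case False
        define x where "x = inv (t [^] nat (- n))"
        have u: "t [^] nat (- n) \<in> Units R" using tpc tpnz field_Units by simp
        then have x: "x \<in> carrier R" "x \<otimes> t [^] nat (- n) = \<one>" by (simp_all add: x_def Units_l_inv)
        then have "x \<noteq> \<zero>" using tpc by auto
        have "rel x (nat (- n)) 0 \<one>" using Pr1 x by (simp add: rel_def)
        then have "w x = n" using wI[OF x(1)] False by simp
        then show ?thesis using x \<open>x \<noteq> \<zero>\<close> by blast
      qed
    qed
  qed
  moreover have "w x = int j - int i" if "x \<in> carrier R" "y \<in> A" "y \<notin> (\<otimes>) t ` A" "x \<otimes> t [^] i = t [^] j \<otimes> y"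
    for x y and i j :: nat
    using wI[of x i j y] that by (simp add: rel_def Pr_def)
  ultimately show ?thesis by blast
qed

text \<open>Comparing valuations in the conclusion shows that a factor of \<open>X ^ e - a\<close>, with \<open>a\<close> a
  uniformiser, has degree divisible by \<open>e\<close>.\<close>
lemma const_term_power_of_roots:
  assumes "p \<in> carrier (poly_ring R)" "p \<noteq> []" "hd p = \<one>" "splitted p" "a \<in> carrier R"
    and "\<And>r. r \<in> carrier R \<Longrightarrow> eval p r = \<zero> \<Longrightarrow> r [^] (e::nat) = a"
  shows "const_term p [^] e = a [^] degree p \<or> const_term p [^] e = \<ominus> (a [^] degree p)"
  using assms(1-4,6)
proof (induction "degree p" arbitrary: p)
  case 0
  then have "p = [\<one>]" by (cases p) auto
  then show ?case by (simp add: const_term_def)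
next
  case (Suc n)
  have "size (roots p) = Suc n" using Suc by (simp add: splitted_def)
  then have "roots p \<noteq> {#}" by auto
  then obtain r where r: "r \<in> carrier R" "r \<in># roots p" "[\<one>, \<ominus> r] \<in> carrier (poly_ring R)" "[\<one>, \<ominus> r] pdivides p"
    using not_empty_rootsE[OF Suc.prems(1)] by blast
  obtain s where s: "s \<in> carrier (poly_ring R)" "p = [\<one>, \<ominus> r] \<otimes>\<^bsub>poly_ring R\<^esub> s"
    using r(4) by (auto simp: pdivides_def factor_def)
  have pm: "p = poly_mult [\<one>, \<ominus> r] s" using s(2) by (simp add: univ_poly_mult)
  have snz: "s \<noteq> []" using Suc.prems(2) s(2) poly_mult_zero(2)[of "[\<one>, \<ominus> r]"] r(1) pm by (auto simp del: poly_mult.simps)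
  have pol: "polynomial (carrier R) s" "polynomial (carrier R) [\<one>, \<ominus> r]" using s(1) r(3) by (auto simp: univ_poly_carrier)
  have deg: "degree s = n"
    using poly_mult_degree_eq[OF carrier_is_subring pol(2,1)] pm snz Suc.hyps(2) by (simp del: poly_mult.simps)
  have hs: "hd s = \<one>"
    using poly_mult_lead_coeff[OF carrier_is_subring pol(2,1)] pm snz Suc.prems(3) pol(1) polynomial_incl[OF pol(1)]
    by (cases s) (auto simp del: poly_mult.simps)
  have "roots p = add_mset r (roots s)"
    using poly_mult_degree_one_monic_imp_same_roots[OF r(1) s(1) snz] s(2) by simp
  then have sp: "splitted s" using \<open>size (roots p) = Suc n\<close> deg by (simp add: splitted_def)
  have er: "eval p r = \<zero>" using r roots_mem_iff_is_root[OF Suc.prems(1)] by (simp add: is_root_def)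
  have sc: "set s \<subseteq> carrier R" using polynomial_incl[OF pol(1)] .
  have "eval p x = eval [\<one>, \<ominus> r] x \<otimes> eval s x" if "x \<in> carrier R" for x
    unfolding pm by (rule eval_poly_mult) (use r sc that in auto)
  then have IH: "const_term s [^] e = a [^] n \<or> const_term s [^] e = \<ominus> (a [^] n)"
    using Suc.hyps(1)[of s] deg s(1) snz hs sp Suc.prems(5) r(1) by auto
  have cs: "const_term s \<in> carrier R" using const_term_simprules(1)[OF sc] .
  have ct: "const_term p = \<ominus> r \<otimes> const_term s"
    unfolding pm using const_term_simprules(2)[of "[\<one>, \<ominus> r]" s] r(1) sc by (simp add: const_term_def del: poly_mult.simps)
  have ra: "r [^] e = a" using Suc.prems(5) r(1) er by blast
  \<comment> \<open>The sign is left open because it does not affect valuations.\<close>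
  have "(\<ominus> r) [^] m = r [^] m \<or> (\<ominus> r) [^] m = \<ominus> (r [^] m)" for m :: nat
    by (induction m) (use r(1) in \<open>auto simp: l_minus r_minus\<close>)
  then have "(\<ominus> r) [^] e = a \<or> (\<ominus> r) [^] e = \<ominus> a" using ra by metis
  moreover have "const_term p [^] e = (\<ominus> r) [^] e \<otimes> const_term s [^] e"
    using ct r(1) cs by (simp add: nat_pow_distrib)
  moreover have "a [^] degree p = a \<otimes> a [^] n" unfolding Suc.hyps(2)[symmetric] using assms(5) by (simp add: m_comm)
  ultimately show ?case using IH assms(5) by (auto simp: l_minus r_minus)
qed

end

context local_closure begin

lemma algebraically_splits: "P \<in> carrier (poly_ring \<Omega>) \<Longrightarrow> splitted P"
proof -
  interpret A: algebraic_closure \<Omega> K by (rule closure)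
  show "P \<in> carrier (poly_ring \<Omega>) \<Longrightarrow> splitted P" by (rule A.roots_over_carrier)
qed

end

locale uniformiser_root = local_closure +
  fixes F :: "'a set" and u :: "'a \<Rightarrow> int" and a \<alpha> :: 'a and e :: nat
  assumes F: "subfield F \<Omega>" "K \<subseteq> F" and val_F: "normalised_valuation (\<Omega>\<lparr>carrier := F\<rparr>) u"
    and a: "a \<in> F" "a \<noteq> \<zero>" "u a = 1" and \<alpha>: "\<alpha> \<in> carrier \<Omega>" "\<alpha> [^] e = a" and e: "0 < e"
begin

sublocale N: normalised_valuation "\<Omega>\<lparr>carrier := F\<rparr>" u by (rule val_F)

lemmas F_ring = subfieldE(1)[OF F(1)]

lemma F_carrier: "x \<in> F \<Longrightarrow> x \<in> carrier \<Omega>"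
  using subfieldE(3)[OF F(1)] by blast

lemma alg_F: "x \<in> carrier \<Omega> \<Longrightarrow> (algebraic over F) x"
  using alg_over F(2) by blast

text \<open>Eisenstein's criterion by valuations. All roots of the minimal polynomial have e-th
  power \<open>a\<close>, so its constant term c satisfies c^e = a^deg up to sign. Comparing values
  gives e u(c) = deg, so \<open>e\<close> divides the degree of a factor of X^e - a, which must then
  be the whole polynomial.\<close>

lemma Irr_eq_binom_poly: "Irr F \<alpha> = binom_poly e a"
proof -
  define P where "P = Irr F \<alpha>"
  note I = IrrE[OF F(1) \<alpha>(1) alg_F[OF \<alpha>(1)], folded P_def]
  note Pc = carrier_polynomial_shell[OF F_ring I(1)]
  have Pnz: "P \<noteq> []" using pirreducibleE(1)[OF F_ring I(1,2)] .
  have ac: "a \<in> carrier \<Omega>" using F_carrier a by blast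
  note b = binom_poly_closed[OF F_ring a(1), of e]
  have bev: "eval (binom_poly e a) x = x [^] e \<ominus> a" if "x \<in> carrier \<Omega>" for x
    using binom_poly_eval[OF e ac that] .
  have div: "P pdivides (binom_poly e a)" unfolding P_def
    by (rule Irr_minimal[OF F(1) \<alpha>(1) alg_F[OF \<alpha>(1)] b(1)]) (use bev[OF \<alpha>(1)] \<alpha>(2) ac in \<open>simp add: minus_eq r_neg\<close>)
  have "r [^] e = a" if "r \<in> carrier \<Omega>" "eval P r = \<zero>" for r
    using pdivides_imp_root_sharing[OF Pc div that] bev[OF that(1)] that(1) ac by simp
  then have c: "const_term P [^] e = a [^] degree P \<or> const_term P [^] e = \<ominus> (a [^] degree P)"
    using const_term_power_of_roots[OF Pc Pnz I(3) algebraically_splits[OF Pc] ac] by blast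
  have cF: "const_term P \<in> F" using const_term_simprules_shell(1)[OF F_ring I(1)] .
  have aF: "a [^] degree P \<in> F" using subfield_pow[OF F(1) a(1)] .
  have anz: "a [^] degree P \<noteq> \<zero>" using pow_non_zero ac a by blast
  have "u (\<ominus> (a [^] degree P)) = u (a [^] degree P)"
    using N.val_minus[of "a [^] degree P"] aF unfolding subring_a_inv[OF F_ring aF] by simp
  then have "u (const_term P [^] e) = u (a [^] degree P)" using c by metis
  also have "\<dots> = int (degree P)" using N.val_pow[of a "degree P"] a by simp
  finally have "u (const_term P [^] e) = int (degree P)" .
  moreover have "const_term P \<noteq> \<zero>"
  proof
    assume z: "const_term P = \<zero>"
    have "\<ominus> (a [^] degree P) \<noteq> \<zero>" using anz ac by (metis minus_minus minus_zero nat_pow_closed)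
    moreover have "const_term P [^] e = \<zero>" using z nat_pow_zero[of e] e by simp
    ultimately show False using c anz by metis
  qed
  ultimately have "int e * u (const_term P) = int (degree P)"
    using N.val_pow[of "const_term P" e] cF by simp
  then have "int e dvd int (degree P)" by (metis dvd_triv_left)
  then have "e dvd degree P" by simp
  moreover have "1 \<le> degree P" using pirreducible_degree[OF F(1) I(1,2)] .
  ultimately have "e \<le> degree P" by (simp add: dvd_imp_le)
  moreover obtain s where s: "s \<in> carrier (poly_ring \<Omega>)" "binom_poly e a = P \<otimes>\<^bsub>poly_ring \<Omega>\<^esub> s"
    using div by (auto simp: pdivides_def factor_def)
  have pol: "polynomial (carrier \<Omega>) P" "polynomial (carrier \<Omega>) s" using s(1) Pc by (auto simp: univ_poly_carrier)
  have pm: "binom_poly e a = poly_mult P s" using s(2) by (simp add: univ_poly_mult)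
  have snz: "s \<noteq> []" using b(2) pm poly_mult_zero(2)[OF polynomial_incl[OF pol(1)]] by metis
  have "e = degree P + degree s"
    using poly_mult_degree_eq[OF carrier_is_subring pol] pm Pnz snz binom_poly_length[OF e, of a] by simp
  ultimately have "degree s = 0" by linarith
  then obtain k where k: "s = [k]" using snz by (cases s) auto
  then have "k = \<one>"
    using poly_mult_lead_coeff[OF carrier_is_subring pol Pnz snz] b(4) pm I(3) polynomial_incl[OF pol(2)] by simp
  then show ?thesis
    using pm k poly_mult_one(2)[OF carrier_is_subring pol(1)] by (simp add: P_def)
qed

lemma degree_Irr: "degree (Irr F \<alpha>) = e"
  using Irr_eq_binom_poly binom_poly_length[OF e] by simp

lemma independent_powers:
  assumes "set p \<subseteq> F" "length p \<le> e" "eval p \<alpha> = \<zero>"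
  shows "set p \<subseteq> {\<zero>}"
proof -
  have q: "normalize p \<in> carrier (F[X])"
    using normalize_gives_polynomial[OF assms(1)] by (simp add: univ_poly_carrier)
  have "normalize p = []"
  proof (rule ccontr)
    assume nz: "normalize p \<noteq> []"
    have pc: "set p \<subseteq> carrier \<Omega>" using assms(1) F_carrier by blast
    have I: "Irr F \<alpha> \<in> carrier (F[X])" using IrrE(1)[OF F(1) \<alpha>(1) alg_F[OF \<alpha>(1)]] .
    have "Irr F \<alpha> pdivides (normalize p)"
      using Irr_minimal[OF F(1) \<alpha>(1) alg_F[OF \<alpha>(1)] q] eval_normalize[OF pc \<alpha>(1)] assms(3) by simp
    then have "e \<le> degree (normalize p)"
      using pdivides_imp_degree_le[OF F_ring I q nz] degree_Irr by simp
    moreover have "length (normalize p) \<noteq> 0" using nz by simp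
    ultimately show False using normalize_length_le[of p] assms(2) by linarith
  qed
  then show ?thesis using normalize_trick[of p] by (metis append_Nil2 set_replicate_conv_if subset_refl empty_subsetI)
qed

text \<open>Multiplication by \<open>\<alpha>\<close> shifts the coefficients; the one that
  overflows comes back as c a because \<alpha>^e = a.\<close>

lemma times_\<alpha>:
  assumes "set p \<subseteq> carrier \<Omega>" "length (c # p) = e" "c \<in> carrier \<Omega>" "b \<in> carrier \<Omega>"
  shows "eval (c # p) \<alpha> \<otimes> \<alpha> \<oplus> b = eval (p @ [c \<otimes> a \<oplus> b]) \<alpha>"
proof -
  have ac: "a \<in> carrier \<Omega>" using F_carrier a by blast
  have ev: "eval p \<alpha> \<in> carrier \<Omega>" using eval_in_carrier assms \<alpha> by blast
  have "\<alpha> [^] length p \<otimes> \<alpha> = a" using \<alpha> assms(2) nat_pow_Suc[of \<alpha> "length p"] by auto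
  then have "c \<otimes> \<alpha> [^] length p \<otimes> \<alpha> = c \<otimes> a" using assms \<alpha> by (simp add: m_assoc)
  moreover have "eval (c # p) \<alpha> = c \<otimes> \<alpha> [^] length p \<oplus> eval p \<alpha>" by simp
  ultimately have "eval (c # p) \<alpha> \<otimes> \<alpha> \<oplus> b = (c \<otimes> a \<oplus> eval p \<alpha> \<otimes> \<alpha>) \<oplus> b"
    using ev assms(1,3,4) \<alpha>(1) by (simp add: l_distr del: eval.simps)
  also have "\<dots> = eval p \<alpha> \<otimes> \<alpha> \<oplus> (c \<otimes> a \<oplus> b)" using ev assms \<alpha> ac by (simp add: a_ac)
  also have "\<dots> = eval (p @ [c \<otimes> a \<oplus> b]) \<alpha>"
    using eval_append_aux[of p "c \<otimes> a \<oplus> b" \<alpha>] assms \<alpha> ac by simp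
  finally show ?thesis .
qed

text \<open>Stated for subrings in order to cover the ring of integers as well as \<open>F\<close>.
  The induction is Horner's scheme, with the overflow reduced by \<open>times_\<alpha>\<close> at
  each step.\<close>

lemma simple_extension_reduced:
  assumes S: "subring S \<Omega>" "a \<in> S" and z: "z \<in> simple_extension S \<alpha>"
  shows "\<exists>p. set p \<subseteq> S \<and> length p = e \<and> z = eval p \<alpha>"
  using z
proof (induction rule: simple_extension.induct)
  case zero
  note Sr = subringE[OF S(1)]
  have "eval (replicate n \<zero>) \<alpha> = \<zero>" for n by (induction n) (use \<alpha> in auto)
  then show ?case using Sr by (intro exI[of _ "replicate e \<zero>"]) auto
next
  case (lin k1 k2)
  note Sr = subringE[OF S(1)]
  obtain p where p: "set p \<subseteq> S" "length p = e" "k1 = eval p \<alpha>" using lin by blast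
  obtain c p' where cp: "p = c # p'" using p e by (cases p) auto
  have "k1 \<otimes> \<alpha> \<oplus> k2 = eval (p' @ [c \<otimes> a \<oplus> k2]) \<alpha>"
    unfolding p(3) cp using p(1,2) lin(2) Sr(1) unfolding cp by (intro times_\<alpha>) auto
  moreover have "c \<in> S" "set p' \<subseteq> S" "length (p' @ [c \<otimes> a \<oplus> k2]) = e" using p cp by auto
  moreover have "c \<otimes> a \<oplus> k2 \<in> S" using Sr(6,7) S(2) lin(2) \<open>c \<in> S\<close> by simp
  ultimately show ?case by (intro exI[of _ "p' @ [c \<otimes> a \<oplus> k2]"]) auto
qed

lemma eval_mem_simple_extension:
  assumes S: "subring S \<Omega>" and p: "set p \<subseteq> S"
  shows "eval p \<alpha> \<in> simple_extension S \<alpha>"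
proof -
  have "normalize p \<in> carrier (S[X])"
    using normalize_gives_polynomial[OF p] by (simp add: univ_poly_carrier)
  then have "eval (normalize p) \<alpha> \<in> simple_extension S \<alpha>"
    using simple_extension_as_eval_img[OF subringE(1)[OF S] \<alpha>(1)] by blast
  then show ?thesis using eval_normalize[of p \<alpha>] p \<alpha> subringE(1)[OF S] by auto
qed

lemma adjoin_reduced:
  assumes "x \<in> adjoin \<Omega> F \<alpha>"
  shows "\<exists>p. set p \<subseteq> F \<and> length p = e \<and> x = eval p \<alpha>"
  using assms adjoin_eq_simple_extension[OF F(1) \<alpha>(1) alg_F[OF \<alpha>(1)]]
    simple_extension_reduced[OF F_ring a(1)] by simp

lemma dimension_adjoin: "dimension e F (adjoin \<Omega> F \<alpha>)"
  using dimension_simple_extension[OF F(1) \<alpha>(1) alg_F[OF \<alpha>(1)]] degree_Irr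
    adjoin_eq_simple_extension[OF F(1) \<alpha>(1) alg_F[OF \<alpha>(1)]] by simp

lemma ring_of_integers_subring: "subring (N.B 0) \<Omega>"
proof -
  note O = subringE[OF N.subring_vball]
  show ?thesis
  proof (rule subringI)
    show "N.B 0 \<subseteq> carrier \<Omega>" using O(1) F_carrier by auto
    fix x assume x: "x \<in> N.B 0"
    then have "x \<in> F" using O(1) by auto
    then show "\<ominus> x \<in> N.B 0" using O(5)[OF x] subring_a_inv[OF F_ring] by simp
  qed (use O in auto)
qed

text \<open>In A = O[\<alpha>] every element is a multiple of \<open>\<alpha>\<close> plus an
  integer of \<open>F\<close>, and it is divisible by \<open>\<alpha>\<close> exactly when that
  integer is not a unit. So \<open>\<alpha>\<close> is prime and
  \<open>valuation_of_prime_element\<close> applies. For the normal form of an element, denominators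
  are cleared by powers of a = \<alpha>^e and then \<open>\<alpha>\<close> is divided out as often
  as possible.\<close>

lemma valuation_adjoin:
  "\<exists>w. normalised_valuation (\<Omega>\<lparr>carrier := adjoin \<Omega> F \<alpha>\<rparr>) w \<and> (\<forall>c\<in>F - {\<zero>}. w c = int e * u c)"
proof -
  define M where "M = adjoin \<Omega> F \<alpha>"
  define A where "A = simple_extension (N.B 0) \<alpha>"
  have M: "subfield M \<Omega>" using adjoin_subfield[OF F(1) \<alpha>(1)] by (simp add: M_def)
  have FM: "F \<subseteq> M" "\<alpha> \<in> M" using adjoin_incl by (auto simp: M_def)
  have Mc: "x \<in> carrier \<Omega>" if "x \<in> M" for x using that subfieldE(3)[OF M] by blast
  interpret Mf: field "\<Omega>\<lparr>carrier := M\<rparr>" by (rule subfield_iff(2)[OF M])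
  note Or = ring_of_integers_subring
  have OF': "x \<in> F" if "x \<in> N.B n" for x n using that N.vball_carrier by simp
  have As: "subring A \<Omega>" unfolding A_def using simple_extension_is_subring[OF Or \<alpha>(1)] .
  note Ar = subringE[OF As]
  have AM: "A \<subseteq> M"
    unfolding A_def by (rule simple_extension_subring_incl[OF subfieldE(1)[OF M]]) (use OF' FM in auto)
  have aO: "a \<in> N.B 0" "a \<in> N.B 1" using a by (auto simp: vball_def)
  have OA: "x \<in> A" if "x \<in> N.B 0" for x
    using simple_extension_incl[OF subringE(1)[OF Or] \<alpha>(1)] that by (auto simp: A_def)
  have \<alpha>A: "\<alpha> \<in> A" unfolding A_def using simple_extension_mem[OF Or \<alpha>(1)] .
  have ac: "a \<in> carrier \<Omega>" using F_carrier a by blast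
  have anz: "\<alpha> \<noteq> \<zero>" using \<alpha>(2) a(2) nat_pow_zero[of e] e by auto
  have apnz: "\<alpha> [^] (n::nat) \<noteq> \<zero>" for n using pow_non_zero[OF \<alpha>(1) anz] .
  have apc: "\<alpha> [^] (n::nat) \<in> carrier \<Omega>" for n using \<alpha> by simp
  have ap: "\<alpha> [^] (e * n) = a [^] n" for n :: nat using \<alpha> by (metis nat_pow_pow)
  have \<alpha>pA: "\<alpha> [^] (n::nat) \<in> A" for n by (induction n) (use Ar \<alpha>A in auto)
  \<comment> \<open>If c = \<alpha> r, comparing coefficients in the basis of powers of
    \<open>\<alpha>\<close> gives c = b a with \<open>b\<close> integral. Conversely,
    \<open>a\<close> is a multiple of \<open>\<alpha>\<close>.\<close>
  have div_const: "c \<in> (\<otimes>) \<alpha> ` A \<longleftrightarrow> c \<in> N.B 1" if c: "c \<in> N.B 0" for c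
  proof
    assume "c \<in> (\<otimes>) \<alpha> ` A"
    then obtain r where r: "r \<in> A" "c = \<alpha> \<otimes> r" by blast
    obtain p where p: "set p \<subseteq> N.B 0" "length p = e" "r = eval p \<alpha>"
      using simple_extension_reduced[OF Or aO(1)] r by (auto simp: A_def)
    obtain b p' where bp: "p = b # p'" using p e by (cases p) auto
    have cc: "c \<in> F" "c \<in> carrier \<Omega>" "b \<in> carrier \<Omega>" "set p' \<subseteq> carrier \<Omega>" "b \<in> F" "set p' \<subseteq> F" "b \<in> N.B 0"
      using c p bp OF' F_carrier by auto
    have "eval p \<alpha> \<otimes> \<alpha> \<oplus> \<ominus> c = eval (p' @ [b \<otimes> a \<oplus> \<ominus> c]) \<alpha>"
      unfolding bp by (rule times_\<alpha>) (use cc p bp in auto)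
    moreover have "eval p \<alpha> \<otimes> \<alpha> = c" using r p Ar(1) \<alpha> by (metis m_comm subsetD)
    ultimately have z: "eval (p' @ [b \<otimes> a \<oplus> \<ominus> c]) \<alpha> = \<zero>" using cc by (simp add: r_neg)
    have "b \<otimes> a \<oplus> \<ominus> c \<in> F" using cc a(1) subringE(5-7)[OF F_ring] by simp
    then have "set (p' @ [b \<otimes> a \<oplus> \<ominus> c]) \<subseteq> {\<zero>}"
      by (intro independent_powers[OF _ _ z]) (use cc p bp in auto)
    then have "b \<otimes> a \<ominus> c = \<zero>" by (simp add: minus_eq)
    then have "c = b \<otimes> a" using cc ac by simp
    then show "c \<in> N.B 1" using N.vball_mult0[OF cc(7) aO(2)] by simp
  next
    assume c1: "c \<in> N.B 1"
    have cc: "c \<in> F" "c \<in> carrier \<Omega>" using c OF' F_carrier by auto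
    have ia: "inv a \<in> F" "a \<otimes> inv a = \<one>" "inv a \<noteq> \<zero>" using subfield_m_inv[OF F(1), of a] a by auto
    have iac: "inv a \<in> carrier \<Omega>" using ia F_carrier by blast
    define d where "d = inv a \<otimes> c"
    have dF: "d \<in> F" unfolding d_def using ia cc subringE(6)[OF F_ring] by blast
    have cad: "c = a \<otimes> d" unfolding d_def using ia cc ac iac by (simp add: m_assoc[symmetric])
    have "d \<in> N.B 0" using N.vball_cancel[of a d 1] cad c1 a dF by simp
    moreover have "a = \<alpha> \<otimes> \<alpha> [^] (e - 1)" using \<alpha> e nat_pow_Suc[of \<alpha> "e - 1"] m_comm[OF \<alpha>(1) apc] by simp
    ultimately show "c \<in> (\<otimes>) \<alpha> ` A"
      using cad OA \<alpha>pA Ar(6) \<alpha>(1) apc F_carrier[OF dF] by (intro image_eqI[of _ _ "\<alpha> [^] (e - 1) \<otimes> d"]) (auto simp: m_assoc)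
  qed
  have split: "\<exists>c\<in>N.B 0. \<exists>r\<in>A. y = \<alpha> \<otimes> r \<oplus> c" if "y \<in> A" for y
    using that[unfolded A_def]
  proof (cases rule: simple_extension.cases)
    case zero
    then show ?thesis using \<alpha>(1) Ar(2) N.vball_zero[of 0] by (intro bexI[of _ \<zero>]) auto
  next
    case (lin k1 k2)
    have "k1 \<in> carrier \<Omega>" using lin(2) Ar(1) by (auto simp: A_def)
    then have "y = \<alpha> \<otimes> k1 \<oplus> k2" using lin(1) \<alpha>(1) by (simp add: m_comm)
    moreover have "k1 \<in> A" using lin(2) by (simp add: A_def)
    ultimately show ?thesis using lin(3) by blast
  qed
  have sub_iff: "y \<in> (\<otimes>) \<alpha> ` A \<longleftrightarrow> c \<in> N.B 1" if "c \<in> N.B 0" "r \<in> A" "y = \<alpha> \<otimes> r \<oplus> c" for y c r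
  proof -
    have cc: "c \<in> carrier \<Omega>" "r \<in> carrier \<Omega>" using that OF' F_carrier Ar by auto
    have "y \<in> (\<otimes>) \<alpha> ` A \<longleftrightarrow> c \<in> (\<otimes>) \<alpha> ` A"
    proof
      assume "y \<in> (\<otimes>) \<alpha> ` A"
      then obtain s where s: "s \<in> A" "y = \<alpha> \<otimes> s" by blast
      have sc: "s \<in> carrier \<Omega>" using s Ar by blast
      have "c = (\<alpha> \<otimes> r \<oplus> c) \<ominus> \<alpha> \<otimes> r" using cc \<alpha>(1) by algebra
      also have "\<dots> = \<alpha> \<otimes> s \<ominus> \<alpha> \<otimes> r" using s that by simp
      also have "\<dots> = \<alpha> \<otimes> (s \<oplus> \<ominus> r)" using sc cc \<alpha>(1) by algebra
      finally show "c \<in> (\<otimes>) \<alpha> ` A" using Ar(7)[OF s(1) Ar(5)[OF that(2)]] by blast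
    next
      assume "c \<in> (\<otimes>) \<alpha> ` A"
      then obtain s where s: "s \<in> A" "c = \<alpha> \<otimes> s" by blast
      then have "y = \<alpha> \<otimes> (r \<oplus> s)" using that(3) cc \<alpha>(1) subsetD[OF Ar(1) s(1)] by (simp add: r_distr)
      then show "y \<in> (\<otimes>) \<alpha> ` A" using Ar(7)[OF that(2) s(1)] by blast
    qed
    then show ?thesis using div_const that by simp
  qed
  have val0: "c \<notin> N.B 1 \<Longrightarrow> c \<in> N.B 0 \<Longrightarrow> c \<noteq> \<zero> \<and> u c = 0" for c
    using N.vball_carrier[of c 0] by (auto simp: vball_def)
  have prime: "y \<otimes> z \<notin> (\<otimes>) \<alpha> ` A"
    if yz: "y \<in> A" "z \<in> A" "y \<notin> (\<otimes>) \<alpha> ` A" "z \<notin> (\<otimes>) \<alpha> ` A" for y z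
  proof -
    obtain c r where c: "c \<in> N.B 0" "r \<in> A" "y = \<alpha> \<otimes> r \<oplus> c" using split[OF yz(1)] by blast
    obtain d s where d: "d \<in> N.B 0" "s \<in> A" "z = \<alpha> \<otimes> s \<oplus> d" using split[OF yz(2)] by blast
    have cc: "c \<in> carrier \<Omega>" "r \<in> carrier \<Omega>" "d \<in> carrier \<Omega>" "s \<in> carrier \<Omega>"
      using c d OF' F_carrier Ar(1) by auto
    have cF: "c \<in> F" "d \<in> F" using c d OF' by auto
    have u0: "c \<noteq> \<zero>" "u c = 0" "d \<noteq> \<zero>" "u d = 0"
      using val0 sub_iff[OF c] sub_iff[OF d] yz c d by auto
    have "y \<otimes> z = \<alpha> \<otimes> (r \<otimes> (\<alpha> \<otimes> s) \<oplus> r \<otimes> d \<oplus> s \<otimes> c) \<oplus> c \<otimes> d"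
      unfolding c(3) d(3) using cc \<alpha>(1) by algebra
    moreover have "r \<otimes> (\<alpha> \<otimes> s) \<oplus> r \<otimes> d \<oplus> s \<otimes> c \<in> A" using c d Ar \<alpha>A OA by simp
    moreover have "c \<otimes> d \<in> N.B 0" using N.vball_mult0[OF c(1) d(1)] by simp
    ultimately have iff: "y \<otimes> z \<in> (\<otimes>) \<alpha> ` A \<longleftrightarrow> c \<otimes> d \<in> N.B 1" using sub_iff by blast
    have "u (c \<otimes> d) = 0" "c \<otimes> d \<noteq> \<zero>" using N.val_mult[of c d] u0 cF cc by (auto simp: integral_iff)
    then show ?thesis using iff by (simp add: vball_def)
  qed
  have dec: "\<exists>(i::nat) (j::nat). \<exists>y\<in>A. y \<notin> (\<otimes>) \<alpha> ` A \<and> x \<otimes> \<alpha> [^] i = \<alpha> [^] j \<otimes> y"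
    if x: "x \<in> M" "x \<noteq> \<zero>" for x
  proof -
    obtain p where p: "set p \<subseteq> F" "length p = e" "x = eval p \<alpha>" using adjoin_reduced x(1) by (auto simp: M_def)
    have pc: "set p \<subseteq> carrier \<Omega>" using p F_carrier by blast
    have "eval p \<alpha> = \<zero>" if "set p \<subseteq> {\<zero>}" for p using that \<alpha>(1) by (induction p) auto
    then obtain b where b: "b \<in> set p" "b \<noteq> \<zero>" using p x(2) by blast
    \<comment> \<open>Multiplication by a^n makes all coefficients integral. Zero coefficients
      contribute an arbitrary value of \<open>u\<close>, which can only enlarge
      \<open>n\<close>.\<close>
    define n where "n = nat (Max ((\<lambda>c. - u c) ` set p))"
    have n: "- u c \<le> int n" if "c \<in> set p" for c
    proof -
      have "- u c \<le> Max ((\<lambda>c. - u c) ` set p)" using that by simp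
      then show ?thesis by (simp add: n_def)
    qed
    define z where "z = eval (map ((\<otimes>) (a [^] n)) p) \<alpha>"
    have anF: "a [^] m \<in> F" "a [^] m \<in> carrier \<Omega>" for m :: nat using subfield_pow[OF F(1) a(1)] ac by auto
    have anz': "a [^] m \<noteq> \<zero>" for m :: nat using pow_non_zero[OF ac a(2)] .
    have ev: "eval (map ((\<otimes>) c) ps) \<alpha> = c \<otimes> eval ps \<alpha>" if "set ps \<subseteq> carrier \<Omega>" "c \<in> carrier \<Omega>" for ps c
      using that
    proof (induction ps)
      case (Cons b ps)
      then have "eval ps \<alpha> \<in> carrier \<Omega>" using \<alpha> eval_in_carrier by simp
      then show ?case using Cons \<alpha> by (simp add: r_distr m_assoc)
    qed simp
    have zx: "z = a [^] n \<otimes> x" unfolding z_def p(3) using ev pc anF by blast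
    have xc: "x \<in> carrier \<Omega>" using x Mc by blast
    have "set (map ((\<otimes>) (a [^] n)) p) \<subseteq> N.B 0"
    proof
      fix c assume "c \<in> set (map ((\<otimes>) (a [^] n)) p)"
      then obtain d where d: "d \<in> set p" "c = a [^] n \<otimes> d" by auto
      have "u (a [^] n) = int n" using N.val_pow[of a n] a by simp
      then show "c \<in> N.B 0"
        using N.vball_cancel[of "a [^] n" d 0] n[OF d(1)] d p anF anz' by (auto simp: vball_def)
    qed
    then have zA: "z \<in> A" unfolding z_def A_def by (rule eval_mem_simple_extension[OF Or])
    define Q where "Q j \<longleftrightarrow> (\<exists>y\<in>A. z = \<alpha> [^] j \<otimes> y)" for j :: nat
    have Q0: "Q 0" using zA subsetD[OF Ar(1) zA] unfolding Q_def by (intro bexI[of _ z]) auto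
    have "\<exists>J. \<not> Q J"
    proof (rule ccontr)
      assume "\<not> (\<exists>J. \<not> Q J)"
      \<comment> \<open>The exponent is one more than the value of a^n b: divisibility by this power
        of \<open>a\<close> contradicts the value of that one nonzero coefficient.\<close>
      then have "Q (e * nat (int n + u b + 1))" by blast
      then obtain y where y: "y \<in> A" "z = a [^] nat (int n + u b + 1) \<otimes> y" by (auto simp: Q_def ap)
      define m where "m = nat (int n + u b + 1)"
      obtain r where r: "set r \<subseteq> N.B 0" "length r = e" "y = eval r \<alpha>"
        using simple_extension_reduced[OF Or aO(1)] y by (auto simp: A_def)
      have rF: "set r \<subseteq> F" "set r \<subseteq> carrier \<Omega>" using r OF' F_carrier by blast+
      define p1 where "p1 = map ((\<otimes>) (a [^] n)) p"
      define r1 where "r1 = map ((\<otimes>) (a [^] m)) r"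
      have c1: "set p1 \<subseteq> F" "set r1 \<subseteq> F" "length p1 = e" "length r1 = e"
        using p rF anF subringE(6)[OF F_ring] r by (auto simp: p1_def r1_def)
      have c2: "set p1 \<subseteq> carrier \<Omega>" "set r1 \<subseteq> carrier \<Omega>" using c1 F_carrier by blast+
      have "eval p1 \<alpha> = eval r1 \<alpha>" using y r ev[OF rF(2) anF(2)] by (simp add: p1_def r1_def z_def m_def)
      then have "eval (map2 (\<lambda>a b. a \<ominus> b) p1 r1) \<alpha> = \<zero>"
        using eval_map2_diff[of p1 r1 \<alpha>] c1 c2 \<alpha>(1) eval_in_carrier[OF c2(2) \<alpha>(1)] by (simp add: minus_eq r_neg)
      moreover have "set (map2 (\<lambda>a b. a \<ominus> b) p1 r1) \<subseteq> F"
      proof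
        fix x assume "x \<in> set (map2 (\<lambda>a b. a \<ominus> b) p1 r1)"
        then obtain s t where st: "(s, t) \<in> set (zip p1 r1)" "x = s \<oplus> \<ominus> t" by (auto simp: minus_eq)
        then have "s \<in> F" "t \<in> F" using c1(1,2) set_zip_leftD set_zip_rightD by fast+
        then show "x \<in> F" unfolding st(2) using subringE(5,7)[OF F_ring] by simp
      qed
      ultimately have zz: "set (map2 (\<lambda>a b. a \<ominus> b) p1 r1) \<subseteq> {\<zero>}"
        using c1(3,4) by (intro independent_powers) simp_all
      obtain i where i: "i < e" "b = p ! i" using b(1) p(2) by (metis in_set_conv_nth)
      have "p1 ! i \<ominus> r1 ! i = \<zero>" using zz c1 i nth_mem[of i "map2 (\<lambda>a b. a \<ominus> b) p1 r1"] by auto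
      moreover have "p1 ! i \<in> carrier \<Omega>" "r1 ! i \<in> carrier \<Omega>" using c1 c2 i by (metis nth_mem subsetD)+
      ultimately have "p1 ! i = r1 ! i" by simp
      then have "a [^] n \<otimes> b = a [^] m \<otimes> r ! i" using i p r by (simp add: p1_def r1_def)
      moreover have "a [^] m \<otimes> r ! i \<in> N.B (int m)"
      proof -
        have "u (a [^] m) = int m" using N.val_pow[of a m] a by simp
        moreover have "r ! i \<in> N.B 0" using r i by (metis nth_mem subsetD)
        ultimately show ?thesis using N.vball_mult[of "a [^] m" "int m" "r ! i" 0] anF by (simp add: vball_def)
      qed
      ultimately have mem: "a [^] n \<otimes> b \<in> N.B (int m)" by simp
      have bF: "b \<in> F" using b p by blast
      have "u (a [^] n) = int n" using N.val_pow[of a n] a by simp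
      then have "b \<in> N.B (int m - int n)" using mem N.vball_cancel[of "a [^] n" b "int m"] anF anz' bF by simp
      then have "int m - int n \<le> u b" using b(2) by (simp add: vball_def)
      moreover have "0 \<le> int n + u b" using n[OF b(1)] by linarith
      ultimately show False by (simp add: m_def)
    qed
    then obtain J where "\<not> Q J" by blast
    then obtain j where j: "Q j" "\<not> Q (Suc j)" using Q0 by (induction J) auto
    then obtain y where y: "y \<in> A" "z = \<alpha> [^] j \<otimes> y" by (auto simp: Q_def)
    have "y \<notin> (\<otimes>) \<alpha> ` A"
    proof
      assume "y \<in> (\<otimes>) \<alpha> ` A"
      then obtain s where s: "s \<in> A" "y = \<alpha> \<otimes> s" by blast
      then have "z = \<alpha> [^] Suc j \<otimes> s" using y \<alpha>(1) Ar(1) by (simp add: m_assoc subsetD)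
      then show False using j(2) s by (auto simp: Q_def)
    qed
    moreover have "x \<otimes> \<alpha> [^] (e * n) = \<alpha> [^] j \<otimes> y" using y zx ap xc anF by (simp add: m_comm)
    ultimately show ?thesis using y by blast
  qed
  have "\<exists>w. normalised_valuation (\<Omega>\<lparr>carrier := M\<rparr>) w \<and> (\<forall>x\<in>M. \<forall>(i::nat) (j::nat). \<forall>y\<in>A. y \<notin> (\<otimes>) \<alpha> ` A \<longrightarrow>
    x \<otimes> \<alpha> [^] i = \<alpha> [^] j \<otimes> y \<longrightarrow> w x = int j - int i)"
    using Mf.valuation_of_prime_element[of A \<alpha>] AM Ar(3,6,7) \<alpha>A anz prime dec by simp
  then obtain w where w: "normalised_valuation (\<Omega>\<lparr>carrier := M\<rparr>) w"
    "\<And>x (i::nat) (j::nat) y. x \<in> M \<Longrightarrow> y \<in> A \<Longrightarrow> y \<notin> (\<otimes>) \<alpha> ` A \<Longrightarrow> x \<otimes> \<alpha> [^] i = \<alpha> [^] j \<otimes> y \<Longrightarrow> w x = int j - int i"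
    by blast
  have "w c = int e * u c" if c: "c \<in> F - {\<zero>}" for c
  proof -
    have cc: "c \<in> carrier \<Omega>" "c \<in> M" using c F_carrier FM by auto
    \<comment> \<open>The positive and negative parts of \<open>u c\<close>, so that c a^m = a^n
      \<epsilon> with a unit \<open>\<epsilon>\<close>, in the normal form that determines
      \<open>w\<close>.\<close>
    define n m where "n = nat (u c)" and "m = nat (- u c)"
    have anF: "a [^] k \<in> F - {\<zero>}" "a [^] k \<in> carrier \<Omega>" for k :: nat
      using subfield_pow[OF F(1) a(1)] pow_non_zero[OF ac a(2)] ac by auto
    have ia: "inv (a [^] n) \<in> F - {\<zero>}" "a [^] n \<otimes> inv (a [^] n) = \<one>"
      using subfield_m_inv[OF F(1) anF(1)] by auto
    define \<epsilon> where "\<epsilon> = inv (a [^] n) \<otimes> (c \<otimes> a [^] m)"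
    have ec: "inv (a [^] n) \<in> carrier \<Omega>" using ia F_carrier by blast
    have eF: "\<epsilon> \<in> F" unfolding \<epsilon>_def using ia c anF subringE(6)[OF F_ring] by simp
    have e1: "a [^] n \<otimes> \<epsilon> = c \<otimes> a [^] m"
      unfolding \<epsilon>_def using ia ec cc anF by (simp add: m_assoc[symmetric])
    have nz: "c \<otimes> a [^] m \<noteq> \<zero>" using c anF cc by (auto simp: integral_iff)
    then have enz: "\<epsilon> \<noteq> \<zero>" using e1 anF by auto
    have up: "u (a [^] k) = int k" for k :: nat using N.val_pow[of a k] a by simp
    have "u (a [^] n) + u \<epsilon> = u c + u (a [^] m)"
      using N.val_mult[of "a [^] n" \<epsilon>] N.val_mult[of c "a [^] m"] e1 eF enz c anF by simp
    then have "u \<epsilon> = 0" unfolding up n_def m_def by linarith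
    then have "\<epsilon> \<in> N.B 0" "\<epsilon> \<notin> N.B 1" using eF enz by (auto simp: vball_def)
    then have eA: "\<epsilon> \<in> A" "\<epsilon> \<notin> (\<otimes>) \<alpha> ` A" using OA div_const by auto
    have "c \<otimes> \<alpha> [^] (e * m) = \<alpha> [^] (e * n) \<otimes> \<epsilon>" using e1 ap by simp
    then have "w c = int (e * n) - int (e * m)" using w(2)[OF cc(2) eA] by blast
    also have "\<dots> = int e * (int n - int m)" by (simp add: right_diff_distrib)
    also have "int n - int m = u c" by (simp add: n_def m_def)
    finally show ?thesis .
  qed
  then show ?thesis using w(1) by (auto simp: M_def)
qed

end

section \<open>The Galois closure of a tamely ramified extension\<close>

context field begin

lemma eval_mem_subfield: "subfield M R \<Longrightarrow> set p \<subseteq> M \<Longrightarrow> x \<in> M \<Longrightarrow> eval p x \<in> M"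
  by (induction p) (auto simp: subringE[OF subfieldE(1)] subfield_pow)

lemma hom_image_adjoin:
  assumes "subfield E R" "a \<in> carrier R" "(algebraic over E) a" "g \<in> ring_hom (R\<lparr>carrier := adjoin R E a\<rparr>) R"
    and "subfield M R" "g ` E \<subseteq> M" "g a \<in> M"
  shows "g ` adjoin R E a \<subseteq> M"
proof
  fix y assume "y \<in> g ` adjoin R E a"
  then obtain x where x: "x \<in> adjoin R E a" "y = g x" by blast
  obtain p where p: "p \<in> carrier (E[X])" "x = eval p a" using adjoin_elem[OF assms(1-3) x(1)] by metis
  note ps = poly_set[OF p(1)]
  have "g x = eval (map g p) (g a)"
    unfolding p(2) by (rule hom_eval[OF adjoin_subfield[OF assms(1,2)] assms(4)]) (use ps adjoin_incl[where K=E and a=a] in auto)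
  then show "y \<in> M" using eval_mem_subfield[OF assms(5), of "map g p" "g a"] ps assms(6,7) x by auto
qed

text \<open>A polynomial that takes one value at as many points as it has coefficients is constant,
  so the value is its last coefficient. In this way elements fixed by enough conjugations are seen
  to lie in the field of coefficients.\<close>

lemma eval_const_of_many_values:
  assumes "set p \<subseteq> carrier R" "p \<noteq> []" "finite S" "S \<subseteq> carrier R" "length p \<le> card S" "x \<in> carrier R"
    and "\<And>s. s \<in> S \<Longrightarrow> eval p s = x"
  shows "x = last p"
proof -
  obtain p' c where p: "p = p' @ [c]" using assms(2) by (metis append_butlast_last_id)
  have c: "set p' \<subseteq> carrier R" "c \<in> carrier R" using assms(1) p by auto
  have "set (p' @ [c \<ominus> x]) \<subseteq> {\<zero>}"
  proof (rule coeffs_zero_of_many_roots[OF _ assms(3,4)])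
    fix s assume s: "s \<in> S"
    then have sc: "s \<in> carrier R" "eval p' s \<in> carrier R" using assms(4) c eval_in_carrier by auto
    have "eval p' s \<otimes> s \<oplus> c = x" using assms(7)[OF s] eval_append_aux[OF c sc(1)] p by simp
    moreover have "eval (p' @ [c \<ominus> x]) s = eval p' s \<otimes> s \<oplus> (c \<ominus> x)"
      using eval_append_aux[OF c(1) _ sc(1), of "c \<ominus> x"] c assms(6) by simp
    moreover have "eval p' s \<otimes> s \<oplus> (c \<ominus> x) = (eval p' s \<otimes> s \<oplus> c) \<ominus> x"
      using sc c assms(6) by (simp add: minus_eq a_assoc)
    ultimately show "eval (p' @ [c \<ominus> x]) s = \<zero>" using assms(6) by (simp add: minus_eq r_neg)
  qed (use assms p c in auto)
  then show ?thesis using c assms(6) p by simp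
qed

lemma pow_cong_exponent:
  assumes "x \<in> carrier R" "x [^] (n::nat) = \<one>" "[a = b] (mod n)"
  shows "x [^] a = x [^] (b::nat)"
proof -
  have red: "x [^] a = x [^] (a mod n)" for a
  proof -
    have "x [^] a = x [^] (n * (a div n)) \<otimes> x [^] (a mod n)" using assms(1) by (simp add: nat_pow_mult)
    also have "x [^] (n * (a div n)) = (x [^] n) [^] (a div n)" using assms(1) by (simp add: nat_pow_pow)
    finally show ?thesis using assms by simp
  qed
  show ?thesis using red[of a] red[of b] assms(3) by (simp add: cong_def)
qed

end

text \<open>Since \<open>Q ^ i - 1 = (Q - 1) (1 + Q + \<dots> + Q ^ (i - 1))\<close> and each \<open>Q ^ j\<close> is \<open>1\<close> modulo
  \<open>Q - 1\<close>.\<close>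
lemma geometric_quotient_cong:
  fixes Q e :: nat
  assumes "1 < Q" "e dvd Q - 1" "0 < e"
  shows "[(Q ^ i - 1) div e = i * ((Q - 1) div e)] (mod (Q - 1))" "e dvd Q ^ i - 1"
proof -
  define c where "c = (Q - 1) div e"
  have c: "Q - 1 = e * c" using assms by (simp add: c_def)
  define s where "s i = (\<Sum>j<i. Q ^ j)" for i
  have s: "Q ^ i - 1 = (Q - 1) * s i" for i
  proof (induction i)
    case (Suc i)
    have "1 \<le> Q ^ i" using assms by simp
    then have "Q ^ Suc i - 1 = (Q ^ i - 1) + Q ^ i * (Q - 1)"
      using assms by (simp add: diff_mult_distrib2 algebra_simps)
    also have "\<dots> = (Q - 1) * s (Suc i)" unfolding Suc by (simp add: s_def algebra_simps)
    finally show ?case .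
  qed (simp add: s_def)
  show "e dvd Q ^ i - 1" using s c by simp
  have si: "[s i = i] (mod (Q - 1))" for i
  proof (induction i)
    case (Suc i)
    have "[Q = 1] (mod (Q - 1))" using assms by (simp add: cong_altdef_nat)
    then have "[Q ^ i = 1] (mod (Q - 1))" using cong_pow by fastforce
    then have "[s i + Q ^ i = i + 1] (mod (Q - 1))" using Suc cong_add by blast
    then show ?case by (simp add: s_def)
  qed (simp add: s_def)
  have "(Q ^ i - 1) div e = c * s i" using s c assms(3) by simp
  moreover have "[c * s i = c * i] (mod (Q - 1))" using si cong_mult cong_refl by blast
  ultimately show "[(Q ^ i - 1) div e = i * ((Q - 1) div e)] (mod (Q - 1))" by (simp add: c_def mult.commute)
qed

context local_closure begin

lemma primitive_root_of_divisor:
  assumes x: "x \<in> carrier \<Omega>" "\<And>i. x [^] (i::nat) = \<one> \<longleftrightarrow> m dvd i" and e: "e dvd m" "0 < m"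
  shows "(x [^] (m div e)) [^] (i::nat) = \<one> \<longleftrightarrow> e dvd i"
proof -
  obtain c where c: "m = e * c" using e by blast
  then have "m div e = c" "0 < c" using e by auto
  then show ?thesis using x c by (simp add: nat_pow_pow mult.commute)
qed

lemma binom_poly_root: "0 < e \<Longrightarrow> c \<in> carrier \<Omega> \<Longrightarrow> b \<in> carrier \<Omega> \<Longrightarrow> b [^] e = c \<Longrightarrow> eval (binom_poly e c) b = \<zero>"
  by (simp add: binom_poly_eval minus_eq r_neg)

lemma hom_binom_poly:
  assumes "subfield E \<Omega>" "h \<in> ring_hom (\<Omega>\<lparr>carrier := E\<rparr>) \<Omega>" "c \<in> E"
  shows "map h (binom_poly n c) = binom_poly n (h c)"
proof -
  have cc: "\<ominus> c \<in> E" "c \<in> carrier \<Omega>"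
    using subringE(5)[OF subfieldE(1)[OF assms(1)] assms(3)] subsetD[OF subfieldE(3)[OF assms(1)] assms(3)] by auto
  have "h (\<ominus> c) \<oplus> h c = \<zero>"
    using hom_simps(3)[OF assms(2) cc(1) assms(3)] hom_zero[OF assms(1,2)] cc by (simp add: l_neg)
  then have "h (\<ominus> c) = \<ominus> h c"
    using hom_simps(1)[OF assms(2)] cc assms(3) minus_equality by metis
  then show ?thesis
    using hom_simps(4)[OF assms(2)] hom_zero[OF assms(1,2)] by (simp add: binom_poly_def monom_def)
qed

end

text \<open>The last assumption says that \<open>d\<close> is the order of \<open>\<xi> ^ (q - 1)\<close> modulo \<open>e\<close>-th powers: in a
  cyclic group of order \<open>N\<close> divisible by \<open>e\<close> an element \<open>x\<close> is an \<open>e\<close>-th power if and only if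
  \<open>x ^ (N / e) = 1\<close>.\<close>
locale tame_tower = local_closure +
  fixes f e d :: nat and Kf Kn :: "'a set" and wf wn :: "'a \<Rightarrow> int" and \<xi> \<pi> \<alpha> :: 'a
  assumes unram_f: "unram f Kf wf" and unram_n: "unram (d * f) Kn wn"
    and e: "0 < e" "e dvd q ^ f - 1" and d: "0 < d"
    and \<xi>: "\<xi> \<in> carrier \<Omega>" "\<xi> [^] (q ^ f - 1) = \<one>" and \<pi>: "\<pi> \<in> K" "\<pi> \<noteq> \<zero>" "v \<pi> = 1"
    and \<alpha>: "\<alpha> \<in> carrier \<Omega>" "\<alpha> [^] e = \<xi> \<otimes> \<pi>"
    and d_iff: "\<And>i. \<xi> [^] ((q - 1) * i * ((q ^ f - 1) div e)) = \<one> \<longleftrightarrow> d dvd i"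
begin

abbreviation n where "n \<equiv> d * f"
abbreviation M where "M \<equiv> adjoin \<Omega> Kn \<alpha>"

lemmas Kf = unramD[OF unram_f]
lemmas Kn = unramD[OF unram_n]

lemma Kf_Kn: "Kf \<subseteq> Kn"
  using unram_mono[OF unram_f unram_n] by simp

lemma \<xi>_Kf: "\<xi> \<in> Kf"
  using unram_root_of_unity_mem[OF unram_f \<xi>] .

lemma q_pow_gt_1: "1 < q ^ f"
  using one_less_power[OF q_gt_1 Kf(4)] .

lemma e_dvd: "e dvd q ^ n - 1"
proof -
  have "q ^ n = (q ^ f) ^ d" by (simp add: power_mult[symmetric] mult.commute)
  then show ?thesis using geometric_quotient_cong(2)[OF q_pow_gt_1 e(2,1), of d] by simp
qed

text \<open>Translates \<open>d_iff\<close> to the exponents that occur for K_{fi}: modulo q^f - 1,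
  which kills \<open>\<xi>\<close>, the quotient (q^(fi) - 1)/e is i times (q^f - 1)/e.\<close>

lemma \<xi>_pow: "\<xi> [^] ((q - 1) * ((q ^ (f * i) - 1) div e)) = \<one> \<longleftrightarrow> d dvd i"
proof -
  have "[(q - 1) * ((q ^ (f * i) - 1) div e) = (q - 1) * (i * ((q ^ f - 1) div e))] (mod (q ^ f - 1))"
    using geometric_quotient_cong(1)[OF q_pow_gt_1 e(2,1), of i] by (intro cong_mult) (simp_all add: power_mult)
  then have "\<xi> [^] ((q - 1) * ((q ^ (f * i) - 1) div e)) = \<xi> [^] ((q - 1) * (i * ((q ^ f - 1) div e)))"
    by (rule pow_cong_exponent[OF \<xi>])
  then show ?thesis using d_iff[of i] by (simp add: mult.assoc)
qed

lemma a_val: "\<xi> \<otimes> \<pi> \<in> Kf" "\<xi> \<otimes> \<pi> \<noteq> \<zero>" "wf (\<xi> \<otimes> \<pi>) = 1" "\<xi> \<otimes> \<pi> \<in> Kn" "wn (\<xi> \<otimes> \<pi>) = 1"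
proof -
  have nz: "\<xi> \<noteq> \<zero>" using \<xi>(2) nat_pow_zero[of "q ^ f - 1"] qn_pos[OF Kf(4)] one_not_zero by (metis not_gr_zero)
  have \<pi>c: "\<pi> \<in> carrier \<Omega>" "\<pi> \<in> Kf" "\<pi> \<in> Kn" using \<pi> K_carrier Kf(2) Kn(2) by auto
  show "\<xi> \<otimes> \<pi> \<noteq> \<zero>" using nz \<pi> \<pi>c \<xi> by (simp add: integral_iff)
  show "\<xi> \<otimes> \<pi> \<in> Kf" using \<xi>_Kf \<pi>c subringE(6)[OF subfieldE(1)[OF Kf(1)]] by blast
  then show "\<xi> \<otimes> \<pi> \<in> Kn" using Kf_Kn by blast
  have "w (\<xi> \<otimes> \<pi>) = 1" if "unram m E w" "\<xi> \<in> E" for m E w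
  proof -
    interpret V: valued_extension "\<Omega>\<lparr>carrier := E\<rparr>" w K v 1 using unramD(5)[OF that(1)] .
    have "w \<xi> = 0" using V.val_root_of_unity(1)[of \<xi> "q ^ f - 1"] \<xi> that(2) qn_pos[OF Kf(4)] by simp
    moreover have "w \<pi> = 1" using V.val_K[of \<pi>] \<pi> by simp
    ultimately show ?thesis using V.val_mult[of \<xi> \<pi>] that(2) nz \<pi> unramD(2)[OF that(1)] by auto
  qed
  then show "wf (\<xi> \<otimes> \<pi>) = 1" "wn (\<xi> \<otimes> \<pi>) = 1" using unram_f unram_n \<xi>_Kf Kf_Kn by blast+
qed

sublocale Un: uniformiser_root \<Omega> K v Kn wn "\<xi> \<otimes> \<pi>" \<alpha> e
proof (intro uniformiser_root.intro uniformiser_root_axioms.intro local_closure_axioms)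
  show "normalised_valuation (\<Omega>\<lparr>carrier := Kn\<rparr>) wn"
    using Kn(5) by (simp add: valued_extension_def)
qed (use Kn a_val \<alpha> e in auto)

lemma M_subfield: "subfield M \<Omega>" "K \<subseteq> M" "Kn \<subseteq> M" "\<alpha> \<in> M"
  using adjoin_subfield[OF Kn(1) \<alpha>(1)] adjoin_incl[where K=Kn and a=\<alpha>] Kn(2) by auto

lemma M_dimension: "dimension (n * e) K M"
  using telescopic_base[OF K Kn(1) Kn(3) Un.dimension_adjoin] .

text \<open>The index is \<open>e\<close> from \<open>Kn\<close> to \<open>M\<close> and 1 from
  \<open>K\<close> to \<open>Kn\<close>.\<close>

lemma M_ramification: "has_ramification_index \<Omega> K v M e"
proof -
  obtain w where w: "normalised_valuation (\<Omega>\<lparr>carrier := M\<rparr>) w" "\<forall>c\<in>Kn - {\<zero>}. w c = int e * wn c"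
    using Un.valuation_adjoin by blast
  interpret V: valued_extension "\<Omega>\<lparr>carrier := Kn\<rparr>" wn K v 1 using Kn(5) .
  have "w c = int e * v c" if "c \<in> K - {\<zero>}" for c
    using w(2) V.val_K[of c] that Kn(2) by auto
  then have "valuation_extends \<Omega> K v M w e" using w(1) e(1) by (simp add: valuation_extends_def)
  then show ?thesis
    using M_subfield M_dimension by (auto simp: has_ramification_index_def finite_subextension_def finite_dimension_def)
qed

lemma alpha_nz: "\<alpha> \<noteq> \<zero>"
  using \<alpha>(2) a_val(2) nat_pow_zero[of e] e(1) by auto

lemma \<xi>_pow_n: "\<xi> [^] (q ^ n - 1) = \<one>"
proof -
  have "q ^ f - 1 dvd q ^ n - 1" using pow_minus_one_dvd_iff[OF q_gt_1 Kf(4)] by simp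
  then obtain c where "q ^ n - 1 = (q ^ f - 1) * c" by blast
  then have "\<xi> [^] (q ^ n - 1) = (\<xi> [^] (q ^ f - 1)) [^] c" using \<xi>(1) by (simp add: nat_pow_pow)
  then show ?thesis using \<xi> by simp
qed

text \<open>By the choice of \<open>d\<close>, the exponent (q^n - 1)/e kills \<xi>^(q-1). In the
  cyclic group of order q^n - 1 this is the condition for being an e-th power: with \<xi> = x^s it
  says that \<open>e\<close> divides s (q - 1).\<close>

lemma exists_\<rho>: "\<exists>\<rho>\<in>Kn. \<rho> [^] (q ^ n - 1) = \<one> \<and> \<rho> [^] e = \<xi> [^] (q - 1)"
proof -
  obtain x where x: "x \<in> Kn" "\<And>i. x [^] (i::nat) = \<one> \<longleftrightarrow> (q ^ n - 1) dvd i"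
    using unram_primitive_root[OF unram_n] by blast
  have xc: "x \<in> carrier \<Omega>" using x Kn(7) by blast
  obtain s :: nat where s: "\<xi> = x [^] s"
    using \<xi>_pow_n root_of_unity_is_power[OF xc x(2) qn_pos[OF Kn(4)] \<xi>(1)] by blast
  define c where "c = (q ^ n - 1) div e"
  have c: "q ^ n - 1 = e * c" using e_dvd by (simp add: c_def)
  then have cpos: "0 < c" using qn_pos[OF Kn(4)] by (metis mult_is_0 not_gr_zero)
  have "\<xi> [^] ((q - 1) * c) = \<one>" using \<xi>_pow[of d] by (simp add: c_def mult.commute)
  then have "(q ^ n - 1) dvd s * ((q - 1) * c)" using x(2) s xc by (simp add: nat_pow_pow)
  then have "e * c dvd (s * (q - 1)) * c" using c by (simp add: mult.assoc)
  then have "e dvd s * (q - 1)" using cpos by simp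
  then obtain t where t: "s * (q - 1) = e * t" by blast
  have "(x [^] t) [^] e = \<xi> [^] (q - 1)" unfolding s using xc t by (simp add: nat_pow_pow mult.commute)
  moreover have "(x [^] t) [^] (q ^ n - 1) = \<one>" using xc x(2) by (simp add: nat_pow_pow)
  ultimately show ?thesis using subfield_pow[OF Kn(1) x(1)] by blast
qed

lemma frobenius_extension:
  obtains \<rho> g where "\<rho> \<in> Kn" "\<rho> [^] e = \<xi> [^] (q - 1)" "g \<in> ring_hom (\<Omega>\<lparr>carrier := M\<rparr>) \<Omega>" "g ` M \<subseteq> M"
    "\<And>c. c \<in> K \<Longrightarrow> g c = c" "g \<alpha> = \<rho> \<otimes> \<alpha>" "\<And>z. z \<in> Kn \<Longrightarrow> z [^] (q ^ n - 1) = \<one> \<Longrightarrow> g z = z [^] q"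
proof -
  obtain \<rho> where \<rho>: "\<rho> \<in> Kn" "\<rho> [^] (q ^ n - 1) = \<one>" "\<rho> [^] e = \<xi> [^] (q - 1)" using exists_\<rho> by blast
  obtain h where h: "h \<in> ring_hom (\<Omega>\<lparr>carrier := Kn\<rparr>) \<Omega>" "\<And>c. c \<in> K \<Longrightarrow> h c = c"
    "\<And>z. z \<in> carrier \<Omega> \<Longrightarrow> z [^] (q ^ n - 1) = \<one> \<Longrightarrow> h z = z [^] q" using frobenius_hom[OF unram_n] by blast
  have \<rho>c: "\<rho> \<in> carrier \<Omega>" "\<pi> \<in> carrier \<Omega>" "\<pi> \<in> Kn" using \<rho> Kn(2,7) \<pi> K_carrier by auto
  have h\<xi>: "h (\<xi> \<otimes> \<pi>) = \<xi> [^] q \<otimes> \<pi>"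
    using \<xi>_pow_n hom_simps(2)[OF h(1)] \<xi>_Kf Kf_Kn \<rho>c h \<pi> \<xi> by (simp add: subsetD)
  have be: "(\<rho> \<otimes> \<alpha>) [^] e = h (\<xi> \<otimes> \<pi>)"
  proof -
    have "(\<rho> \<otimes> \<alpha>) [^] e = \<xi> [^] (q - 1) \<otimes> (\<xi> \<otimes> \<pi>)" using \<rho>c \<alpha> \<rho> by (simp add: nat_pow_distrib)
    also have "\<dots> = (\<xi> [^] (q - 1) \<otimes> \<xi>) \<otimes> \<pi>" using \<xi> \<rho>c by (simp add: m_assoc)
    also have "\<xi> [^] (q - 1) \<otimes> \<xi> = \<xi> [^] q" using \<xi> nat_pow_Suc[of \<xi> "q - 1"] q_gt_1 by simp
    finally show ?thesis using h\<xi> by simp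
  qed
  have "eval (map h (Irr Kn \<alpha>)) (\<rho> \<otimes> \<alpha>) = \<zero>"
    unfolding Un.Irr_eq_binom_poly hom_binom_poly[OF Kn(1) h(1) a_val(4)]
    by (rule binom_poly_root[OF e(1) _ _ be]) (use hom_simps(1)[OF h(1) a_val(4)] \<rho>c \<alpha> in auto)
  then obtain g where g: "g \<in> ring_hom (\<Omega>\<lparr>carrier := M\<rparr>) \<Omega>" "\<forall>x\<in>Kn. g x = h x" "g \<alpha> = \<rho> \<otimes> \<alpha>"
    using extend_hom[OF Kn(1) \<alpha>(1) Un.alg_F[OF \<alpha>(1)] h(1), of "\<rho> \<otimes> \<alpha>"] \<rho>c \<alpha>(1) by auto
  obtain x where x: "x \<in> Kn" "\<And>i. x [^] (i::nat) = \<one> \<longleftrightarrow> (q ^ n - 1) dvd i"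
    using unram_primitive_root[OF unram_n] by blast
  have xc: "x \<in> carrier \<Omega>" using x Kn by blast
  have gen: "x [^] (q ^ j - 1) = \<one> \<longleftrightarrow> n dvd j" for j
    using x(2) pow_minus_one_dvd_iff[OF q_gt_1 Kn(4)] by simp
  note adj = unram_generator(1)[OF unram_n xc gen]
  have hx: "h x = x [^] q" using h(3)[OF xc] x(2) by simp
  \<comment> \<open>\<open>Kn\<close> is generated over \<open>K\<close> by \<open>x\<close>, and
    \<open>h\<close> sends \<open>x\<close> to x^q; hence \<open>h\<close> preserves
    \<open>Kn\<close>.\<close>
  have "h ` adjoin \<Omega> K x \<subseteq> Kn"
    by (rule hom_image_adjoin[OF K xc alg[OF xc]])
      (use h hx x Kn(1,2) subfield_pow[OF Kn(1) x(1)] adj in auto)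
  then have "g ` Kn \<subseteq> M" using g(2) adj M_subfield(3) by auto
  moreover have "\<rho> \<otimes> \<alpha> \<in> M" using \<rho> M_subfield subringE(6)[OF subfieldE(1)[OF M_subfield(1)]] by blast
  ultimately have "g ` M \<subseteq> M"
    using hom_image_adjoin[OF Kn(1) \<alpha>(1) Un.alg_F[OF \<alpha>(1)] g(1) M_subfield(1)] g(3) by simp
  moreover have "g c = c" if "c \<in> K" for c using g(2) h(2) Kn(2) that by auto
  moreover have "g z = z [^] q" if "z \<in> Kn" "z [^] (q ^ n - 1) = \<one>" for z using g(2) h(3)[of z] Kn(7) that by auto
  ultimately show thesis using that[OF \<rho>(1,3) g(1) _ _ g(3)] by blast
qed

lemma M_galois: "galois_subextension \<Omega> K M"
proof (rule galois_of_fixed_field[OF K M_subfield(1,2)])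
  have Mc: "M \<subseteq> carrier \<Omega>" using subfieldE(3)[OF M_subfield(1)] .
  then show "\<And>x. x \<in> M \<Longrightarrow> (algebraic over K) x" using alg by blast
  fix x assume x: "x \<in> M"
    and fixed: "\<And>g. g \<in> ring_hom (\<Omega>\<lparr>carrier := M\<rparr>) \<Omega> \<Longrightarrow> g ` M \<subseteq> M \<Longrightarrow> \<forall>c\<in>K. g c = c \<Longrightarrow> g x = x"
  have xc: "x \<in> carrier \<Omega>" using x Mc by blast
  obtain y where y: "y \<in> Kn" "\<And>i. y [^] (i::nat) = \<one> \<longleftrightarrow> (q ^ n - 1) dvd i"
    using unram_primitive_root[OF unram_n] by blast
  have yc: "y \<in> carrier \<Omega>" using y Kn by blast
  define \<zeta> where "\<zeta> = y [^] ((q ^ n - 1) div e)"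
  have \<zeta>: "\<zeta> \<in> Kn" "\<zeta> \<in> carrier \<Omega>" "\<And>i. \<zeta> [^] (i::nat) = \<one> \<longleftrightarrow> e dvd i"
    using primitive_root_of_divisor[OF yc y(2) e_dvd qn_pos[OF Kn(4)]] subfield_pow[OF Kn(1) y(1)] yc by (auto simp: \<zeta>_def)
  have xKn: "x \<in> Kn"
  proof -
    obtain p where p: "set p \<subseteq> Kn" "length p = e" "x = eval p \<alpha>" using Un.adjoin_reduced[OF x] by blast
    \<comment> \<open>The e conjugates of \<open>\<alpha>\<close> over \<open>Kn\<close>. The
      polynomial \<open>p\<close> has e coefficients and takes the value \<open>x\<close> at each of
      them, so it is constant.\<close>
    define S where "S = (\<lambda>i::nat. \<zeta> [^] i \<otimes> \<alpha>) ` {..<e}"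
    have "inj_on (\<lambda>i::nat. \<zeta> [^] i \<otimes> \<alpha>) {..<e}"
      using primitive_root_inj(1)[OF \<zeta>(2,3) e(1)] alpha_nz \<alpha>(1) \<zeta>(2)
      by (auto simp: inj_on_def m_rcancel)
    then have S: "finite S" "card S = e" "S \<subseteq> carrier \<Omega>" using \<zeta>(2) \<alpha>(1) by (auto simp: S_def card_image)
    have "eval p s = x" if s: "s \<in> S" for s
    proof -
      obtain i :: nat where i: "s = \<zeta> [^] i \<otimes> \<alpha>" using s by (auto simp: S_def)
      have sc: "s \<in> carrier \<Omega>" using s S by blast
      have "(\<zeta> [^] i) [^] e = \<one>" using \<zeta>(2,3) by (simp add: nat_pow_pow)
      then have "s [^] e = \<xi> \<otimes> \<pi>" unfolding i using \<zeta>(2) \<alpha> \<pi> \<xi> K_carrier by (simp add: nat_pow_distrib)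
      then have "eval (map id (Irr Kn \<alpha>)) s = \<zero>"
        unfolding Un.Irr_eq_binom_poly list.map_id by (intro binom_poly_root[OF e(1) _ sc]) (use \<pi> \<xi> K_carrier in auto)
      moreover have "id \<in> ring_hom (\<Omega>\<lparr>carrier := Kn\<rparr>) \<Omega>" using Kn(7) by (auto simp: ring_hom_def)
      ultimately obtain g where g: "g \<in> ring_hom (\<Omega>\<lparr>carrier := M\<rparr>) \<Omega>" "\<forall>x\<in>Kn. g x = x" "g \<alpha> = s"
        using extend_hom[OF Kn(1) \<alpha>(1) Un.alg_F[OF \<alpha>(1)], of id s] sc by auto
      have "s \<in> M" unfolding i
        by (rule subringE(6)[OF subfieldE(1)[OF M_subfield(1)] subsetD[OF M_subfield(3) subfield_pow[OF Kn(1) \<zeta>(1)]] M_subfield(4)])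
      moreover have "g ` Kn \<subseteq> M" using g(2) M_subfield(3) by auto
      ultimately have "g ` M \<subseteq> M"
        using hom_image_adjoin[OF Kn(1) \<alpha>(1) Un.alg_F[OF \<alpha>(1)] g(1) M_subfield(1)] g(3) by simp
      then have "g x = x" using fixed[OF g(1)] g(2) Kn(2) by blast
      moreover have "g x = eval p s"
        using hom_eval_fix[OF M_subfield(1) g(1) p(1) M_subfield(3) _ M_subfield(4)] g p(3) by simp
      ultimately show ?thesis by simp
    qed
    moreover have "p \<noteq> []" "set p \<subseteq> carrier \<Omega>" "length p \<le> card S" using p(1,2) e(1) Kn(7) S(2) by auto
    ultimately have "x = last p" using eval_const_of_many_values S(1,3) xc by blast
    then show ?thesis using p(1) last_in_set[OF \<open>p \<noteq> []\<close>] by blast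
  qed
  have gen: "y [^] (q ^ j - 1) = \<one> \<longleftrightarrow> n dvd j" for j
    using y(2) pow_minus_one_dvd_iff[OF q_gt_1 Kn(4)] by simp
  note ug = unram_generator[OF unram_n yc gen]
  \<comment> \<open>The same device over \<open>K\<close>: \<open>p\<close> has at most n
    coefficients and takes the value \<open>x\<close> at the n Frobenius conjugates of
    \<open>y\<close>.\<close>
  obtain p where p: "p \<in> carrier (K[X])" "length p \<le> n" "x = eval p y"
    using adjoin_elem[OF K yc alg[OF yc], of x] xKn ug(1,2) by metis
  note pK = poly_set[OF p(1)]
  obtain \<rho> g where g: "g \<in> ring_hom (\<Omega>\<lparr>carrier := M\<rparr>) \<Omega>" "g ` M \<subseteq> M"
    "\<And>c. c \<in> K \<Longrightarrow> g c = c" "\<And>z. z \<in> Kn \<Longrightarrow> z [^] (q ^ n - 1) = \<one> \<Longrightarrow> g z = z [^] q"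
    using frobenius_extension by metis
  have gx: "g x = x" using fixed[OF g(1,2)] g(3) by blast
  have ev: "eval p (y [^] (q ^ i)) = x" for i :: nat
  proof (induction i)
    case 0 then show ?case using p yc by simp
  next
    case (Suc i)
    have yi: "y [^] (q ^ i) \<in> Kn" using subfield_pow[OF Kn(1) y(1)] .
    have "(y [^] (q ^ i)) [^] (q ^ n - 1) = \<one>" using yc y(2) by (simp add: nat_pow_pow)
    then have "g (y [^] (q ^ i)) = y [^] (q ^ Suc i)" using g(4)[OF yi] yc by (simp add: nat_pow_pow mult.commute)
    moreover have "g (eval p (y [^] (q ^ i))) = eval p (g (y [^] (q ^ i)))"
      by (rule hom_eval_fix[OF M_subfield(1) g(1) pK M_subfield(2) g(3)]) (use yi M_subfield(3) in auto)
    ultimately show ?case using Suc gx by simp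
  qed
  show "x \<in> K"
  proof (cases "p = []")
    case True
    then show ?thesis using p subringE(2)[OF subfieldE(1)[OF K]] by simp
  next
    case False
    define S where "S = (\<lambda>i::nat. y [^] (q ^ i)) ` {..<n}"
    have "finite S" "card S = n" "S \<subseteq> carrier \<Omega>" using ug(4) yc by (auto simp: S_def card_image)
    moreover have "set p \<subseteq> carrier \<Omega>" using pK K_carrier by blast
    ultimately have "x = last p"
      using eval_const_of_many_values[of p S x] p(2) xc False ev by (auto simp: S_def)
    then show ?thesis using pK False last_in_set by blast
  qed
qed

lemma M_minimal:
  assumes A: "subfield A \<Omega>" "K \<subseteq> A" "normal_subextension \<Omega> K A" "adjoin \<Omega> Kf \<alpha> \<subseteq> A"
  shows "M \<subseteq> A"
proof -
  obtain \<rho> g where g: "\<rho> \<in> Kn" "\<rho> [^] e = \<xi> [^] (q - 1)" "g \<in> ring_hom (\<Omega>\<lparr>carrier := M\<rparr>) \<Omega>"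
    "\<And>c. c \<in> K \<Longrightarrow> g c = c" "g \<alpha> = \<rho> \<otimes> \<alpha>" using frobenius_extension by metis
  have \<rho>c: "\<rho> \<in> carrier \<Omega>" using g Kn by blast
  have aA: "\<alpha> \<in> A" "Kf \<subseteq> A" using A(4) adjoin_incl[where K=Kf and a=\<alpha>] by auto
  have "\<rho> \<otimes> \<alpha> \<in> A"
    using hom_conjugate_mem_normal(1)[OF K A(3) aA(1) M_subfield(1,2,4) alg[OF \<alpha>(1)] g(3,4)] g(5) by simp
  then have "\<alpha> \<otimes> \<rho> \<in> A" using \<rho>c \<alpha>(1) by (simp add: m_comm)
  then have \<rho>A: "\<rho> \<in> A" using subfield_m_inv_simprule[OF A(1), of \<alpha> \<rho>] aA alpha_nz \<rho>c by blast
  obtain y where y: "y \<in> Kf" "\<And>i. y [^] (i::nat) = \<one> \<longleftrightarrow> (q ^ f - 1) dvd i"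
    using unram_primitive_root[OF unram_f] by blast
  \<comment> \<open>The condition on \<open>y\<close> detects divisibility of j by f, and that on
    \<open>\<rho>\<close> divisibility of j / f by d. Only together do the two roots of unity
    determine \<open>Kn\<close>.\<close>
  have "Kn \<subseteq> A"
  proof (rule unram_subset_of_roots[OF unram_n A(1,2) _ \<rho>A])
    show "y \<in> A" using y aA by blast
    fix j
    have 1: "y [^] (q ^ j - 1) = \<one> \<longleftrightarrow> f dvd j" using y(2) pow_minus_one_dvd_iff[OF q_gt_1 Kf(4)] by simp
    have 2: "\<rho> [^] (q ^ (f * i) - 1) = \<one> \<longleftrightarrow> d dvd i" for i
    proof -
      have "e dvd q ^ (f * i) - 1" using geometric_quotient_cong(2)[OF q_pow_gt_1 e(2,1), of i] by (simp add: power_mult)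
      then have "q ^ (f * i) - 1 = e * ((q ^ (f * i) - 1) div e)" by simp
      then have "\<rho> [^] (q ^ (f * i) - 1) = (\<rho> [^] e) [^] ((q ^ (f * i) - 1) div e)" using \<rho>c nat_pow_pow by metis
      also have "\<dots> = \<xi> [^] ((q - 1) * ((q ^ (f * i) - 1) div e))" using g(2) \<xi>(1) by (simp add: nat_pow_pow)
      finally show ?thesis using \<xi>_pow by simp
    qed
    show "y [^] (q ^ j - 1) = \<one> \<and> \<rho> [^] (q ^ j - 1) = \<one> \<longleftrightarrow> n dvd j"
    proof (cases "f dvd j")
      case True
      then obtain i where "j = f * i" by blast
      then show ?thesis using 1 2[of i] Kf(4) by (simp add: mult.commute)
    next
      case False
      then have "\<not> n dvd j" using dvd_mult_right by blast
      then show ?thesis using 1 False by simp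
    qed
  qed
  then show ?thesis using adjoin_subset[OF Kn(1) A(1)] aA by blast
qed

lemma Kf_adjoin_M: "adjoin \<Omega> Kf \<alpha> \<subseteq> M"
  using adjoin_subset[OF Kf(1) M_subfield(1)] Kf_Kn M_subfield by blast

end

section \<open>Structure of tamely ramified extensions\<close>

context local_closure begin

text \<open>Equality of \<open>L\<close> with K_f(\<alpha>) comes from density: powers of
  \<open>\<alpha>\<close> supply every value and Teichmueller elements of \<open>Kf\<close> every
  residue, so each element of \<open>L\<close> is approximated to one order better from the
  subfield, and \<open>dense_Span\<close> over \<open>K\<close> applies.\<close>

lemma tame_structure:
  assumes L: "finite_subextension \<Omega> K L" "valuation_extends \<Omega> K v L vL e" "has_residual_degree \<Omega> K v L vL f"
    and e: "0 < e" "coprime e q" and un: "unram f Kf uf" and \<pi>: "\<pi> \<in> K" "\<pi> \<noteq> \<zero>" "v \<pi> = 1"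
  shows "Kf \<subseteq> L" "\<exists>\<xi> \<alpha>. \<xi> \<in> carrier \<Omega> \<and> \<xi> [^] (q ^ f - 1) = \<one> \<and> \<alpha> \<in> carrier \<Omega> \<and> \<alpha> [^] e = \<xi> \<otimes> \<pi> \<and> L = adjoin \<Omega> Kf \<alpha>"
proof -
  have Ls: "subfield L \<Omega>" "K \<subseteq> L" "finite_dimension K L" using L(1) by (auto simp: finite_subextension_def)
  note Lr = subfieldE(1)[OF Ls(1)]
  note Lrr = subringE[OF Lr]
  have Lc: "x \<in> carrier \<Omega>" if "x \<in> L" for x using that Lrr(1) by blast
  note ve = valued_extensionI[OF Ls(1,2) L(2)]
  interpret V: valued_extension "\<Omega>\<lparr>carrier := L\<rparr>" vL K v e by (rule ve)
  have rd: "ring.dimension V.k f V.kK (carrier V.k)"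
    using L(3) V.residue_degree_iff by (simp add: has_residual_degree_def Let_def)
  note rc = V.residue_card[OF rd]
  have lf: "local_field (\<Omega>\<lparr>carrier := L\<rparr>) vL" using complete_of_finite[OF L(1) ve rc(1)] .
  interpret Lf: local_field "\<Omega>\<lparr>carrier := L\<rparr>" vL by (rule lf)
  have Q: "Lf.Q = q ^ f" using rc(2) by (simp add: Lf.Q_def)
  note Kf = unramD[OF un]
  have minus: "x \<ominus>\<^bsub>\<Omega>\<lparr>carrier := L\<rparr>\<^esub> y = x \<ominus> y" if "x \<in> L" "y \<in> L" for x y
    using subring_a_minus[OF Lr that] .
  have Lm: "x \<ominus> y \<in> L" if "x \<in> L" "y \<in> L" for x y unfolding a_minus_def using Lrr(5,7) that by simp
  obtain z where z: "z \<in> L" "\<And>i. z [^] (i::nat) = \<one> \<longleftrightarrow> (q ^ f - 1) dvd i"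
    using Lf.primitive_root_exists Q by auto
  show KfL: "Kf \<subseteq> L" using unram_subset[OF un Ls(1,2) z] .
  have teich: "\<exists>t\<in>L. t \<in> V.B 0 \<and> t [^] (q ^ f) = t \<and> t \<ominus> x \<in> V.B 1 \<and> t \<in> Kf" if x: "x \<in> L" "x \<in> V.B 0" for x
  proof -
    obtain t where t: "t \<in> V.B 0" "t [^] (q ^ f) = t" "t \<ominus>\<^bsub>\<Omega>\<lparr>carrier := L\<rparr>\<^esub> x \<in> V.B 1"
      using Lf.teichmuller_exists[of x] x Q by auto
    have tL: "t \<in> L" using V.vball_carrier[OF t(1)] by simp
    have "t \<in> Kf"
    proof (cases "t = \<zero>")
      case True then show ?thesis using subringE(2)[OF subfieldE(1)[OF Kf(1)]] by simp
    next
      case False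
      then show ?thesis
        using unram_root_of_unity_mem[OF un Lc[OF tL] fixed_of_root_of_unity(2)[OF Lc[OF tL] Kf(4) t(2)]] by blast
    qed
    then show ?thesis using t tL minus[OF tL x(1)] by auto
  qed
  have inv: "inv x \<in> L" "inv x \<noteq> \<zero>" "x \<otimes> inv x = \<one>" "vL (inv x) = - vL x" if "x \<in> L" "x \<noteq> \<zero>" for x
  proof -
    show 1: "inv x \<in> L" "inv x \<noteq> \<zero>" "x \<otimes> inv x = \<one>" using subfield_m_inv[OF Ls(1), of x] that by auto
    show "vL (inv x) = - vL x" using V.val_mult[of x "inv x"] V.val_one that 1 by simp
  qed
  obtain \<theta> where \<theta>: "\<theta> \<in> L" "\<theta> \<noteq> \<zero>" "vL \<theta> = 1" using V.exists_uniformiser by auto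
  have \<pi>L: "\<pi> \<in> L" "vL \<pi> = int e" using \<pi> Ls(2) V.val_K[of \<pi>] by auto
  \<comment> \<open>A unit, since \<open>\<pi>\<close> has value \<open>e\<close> in
    \<open>L\<close>. It is split into its Teichmueller part \<open>t\<close> and a one-unit
    \<open>b\<close>, and only \<open>b\<close> can be removed by changing
    \<open>\<theta>\<close>.\<close>
  define y where "y = \<theta> [^] e \<otimes> inv \<pi>"
  have Pe: "\<theta> [^] e \<in> L" "\<theta> [^] e \<noteq> \<zero>" "vL (\<theta> [^] e) = int e"
    using subfield_pow[OF Ls(1) \<theta>(1)] pow_non_zero[OF Lc[OF \<theta>(1)] \<theta>(2)] V.val_pow[of \<theta> e] \<theta> by auto
  have y: "y \<in> L" "y \<noteq> \<zero>" "vL y = 0"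
  proof -
    show "y \<in> L" unfolding y_def using Pe inv(1)[OF \<pi>L(1) \<pi>(2)] Lrr(6) by blast
    show "y \<noteq> \<zero>" unfolding y_def using Pe inv[OF \<pi>L(1) \<pi>(2)] Lc by (simp add: integral_iff)
    show "vL y = 0" unfolding y_def using V.val_mult[of "\<theta> [^] e" "inv \<pi>"] Pe inv[OF \<pi>L(1) \<pi>(2)] \<pi>L by simp
  qed
  have yB: "y \<in> V.B 0" "y \<notin> V.B 1" using y by (auto simp: vball_def)
  obtain t where t: "t \<in> L" "t \<in> V.B 0" "t [^] (q ^ f) = t" "t \<ominus> y \<in> V.B 1" using teich[OF y(1) yB(1)] by blast
  have tnz: "t \<noteq> \<zero>"
  proof
    assume "t = \<zero>"
    then have "\<ominus> y \<in> V.B 1" using t(4) Lc[OF y(1)] by (simp add: minus_eq)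
    then have "\<ominus>\<^bsub>\<Omega>\<lparr>carrier := L\<rparr>\<^esub> (\<ominus> y) \<in> V.B 1" by (rule V.vball_minus)
    then have "y \<in> V.B 1" using subring_a_inv[OF Lr Lrr(5)[OF y(1)]] Lc[OF y(1)] by simp
    then show False using yB by simp
  qed
  have t1: "t [^] (q ^ f - 1) = \<one>" using fixed_of_root_of_unity(2)[OF Lc[OF t(1)] Kf(4) t(3) tnz] .
  have vt: "vL t = 0" using V.val_root_of_unity(1)[of t "q ^ f - 1"] t(1) t1 qn_pos[OF Kf(4)] by simp
  note it = inv[OF t(1) tnz]
  define b where "b = y \<otimes> inv t"
  have b: "b \<in> L" unfolding b_def using y it Lrr(6) by blast
  have yt: "y \<ominus> t \<in> V.B 1"
    using V.vball_diff_commute[of t y 1] t(1,4) y(1) minus by simp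
  have "b \<ominus> \<one> = inv t \<otimes> (y \<ominus> t)"
  proof -
    have c: "inv t \<in> carrier \<Omega>" "y \<in> carrier \<Omega>" "t \<in> carrier \<Omega>" using it y t Lc by auto
    have "inv t \<otimes> (y \<ominus> t) = y \<otimes> inv t \<ominus> t \<otimes> inv t" using c by algebra
    then show ?thesis using it by (simp add: b_def)
  qed
  moreover have "inv t \<in> V.B 0" using it vt by (simp add: vball_def)
  ultimately have "b \<ominus> \<one> \<in> V.B 1" using V.vball_mult0[of "inv t" "y \<ominus> t" 1] yt by simp
  then have "b \<ominus>\<^bsub>\<Omega>\<lparr>carrier := L\<rparr>\<^esub> \<one>\<^bsub>\<Omega>\<lparr>carrier := L\<rparr>\<^esub> \<in> V.B 1" using minus[OF b Lrr(3)] by simp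
  moreover have "coprime e Lf.Q" using e(2) Q by simp
  ultimately obtain r where r: "r \<in> L" "r [^] e = b" "r \<ominus>\<^bsub>\<Omega>\<lparr>carrier := L\<rparr>\<^esub> \<one> \<in> V.B 1"
    using Lf.one_unit_root[of b e] b e(1) by auto
  have bnz: "b \<noteq> \<zero>" unfolding b_def using y it Lc by (simp add: integral_iff)
  have rnz: "r \<noteq> \<zero>" using r(2) bnz nat_pow_zero[of e] e(1) by auto
  have "vL b = 0" unfolding b_def using V.val_mult[of y "inv t"] y it vt by simp
  then have vr: "vL r = 0" using V.val_pow[of r e] r rnz e(1) by simp
  note ir = inv[OF r(1) rnz]
  define \<alpha> where "\<alpha> = \<theta> \<otimes> inv r"
  have cs: "\<theta> \<in> carrier \<Omega>" "inv r \<in> carrier \<Omega>" "r \<in> carrier \<Omega>" "t \<in> carrier \<Omega>" "inv t \<in> carrier \<Omega>"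
    "\<pi> \<in> carrier \<Omega>" "inv \<pi> \<in> carrier \<Omega>" "y \<in> carrier \<Omega>" "b \<in> carrier \<Omega>"
    using \<theta> ir r t it \<pi>L inv[OF \<pi>L(1) \<pi>(2)] y b Lc by auto
  have \<alpha>: "\<alpha> \<in> L" "\<alpha> \<in> carrier \<Omega>" "\<alpha> \<noteq> \<zero>"
    unfolding \<alpha>_def using \<theta> ir Lrr(6) Lc cs by (auto simp: integral_iff)
  have v\<alpha>: "vL \<alpha> = 1" unfolding \<alpha>_def using V.val_mult[of \<theta> "inv r"] \<theta> ir vr by simp
  have \<alpha>e: "\<alpha> [^] e = t \<otimes> \<pi>"
  proof -
    have 1: "\<alpha> [^] e = \<theta> [^] e \<otimes> inv r [^] e" unfolding \<alpha>_def using cs by (simp add: nat_pow_distrib)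
    have "r [^] e \<otimes> inv r [^] e = \<one>" using cs ir by (simp add: nat_pow_distrib[symmetric])
    then have 2: "b \<otimes> inv r [^] e = \<one>" using r by simp
    have 3: "\<theta> [^] e = y \<otimes> \<pi>" unfolding y_def using cs inv[OF \<pi>L(1) \<pi>(2)]
      by (simp add: m_assoc m_comm[of "inv \<pi>" \<pi>])
    have 4: "y = b \<otimes> t" unfolding b_def using cs it by (simp add: m_assoc m_comm[of "inv t" t])
    have "\<alpha> [^] e = (b \<otimes> inv r [^] e) \<otimes> (t \<otimes> \<pi>)" unfolding 1 3 4 using cs by (simp add: m_ac)
    then show ?thesis using 2 cs by simp
  qed
  define S where "S = adjoin \<Omega> Kf \<alpha>"
  have Ss: "subfield S \<Omega>" "Kf \<subseteq> S" "\<alpha> \<in> S" "S \<subseteq> L" "K \<subseteq> S"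
    using adjoin_subfield[OF Kf(1) \<alpha>(2)] adjoin_incl[where K=Kf and a=\<alpha>] adjoin_subset[OF Kf(1) Ls(1) KfL \<alpha>(1)] Kf(2)
    by (auto simp: S_def)
  note Sr = subringE[OF subfieldE(1)[OF Ss(1)]]
  have "subalgebra K S \<Omega>"
    using subring.axioms(1)[OF subfieldE(1)[OF Ss(1)]] Sr(6) Ss(5)
    by (intro subalgebra.intro subalgebra_axioms.intro) auto
  then have "finite_dimension K S" using subalbegra_incl_imp_finite_dimension[OF K Ls(3) _ Ss(4)] by blast
  then obtain m where "dimension m K S" by blast
  then obtain us where us: "independent K us" "Span K us = S" using exists_base[OF K] by blast
  have usS: "set us \<subseteq> S" using Span_base_incl[OF K independent_in_carrier[OF us(1)]] us by simp
  have Sc: "V.Span K us = S" using us Span_consistent[OF Lr] by simp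
  have "V.Span K us = carrier (\<Omega>\<lparr>carrier := L\<rparr>)"
  proof (rule V.dense_Span)
    show "set us \<subseteq> carrier (\<Omega>\<lparr>carrier := L\<rparr>)" using usS Ss(4) by auto
    fix x assume "x \<in> carrier (\<Omega>\<lparr>carrier := L\<rparr>)" "x \<noteq> \<zero>\<^bsub>\<Omega>\<lparr>carrier := L\<rparr>\<^esub>"
    then have x: "x \<in> L" "x \<noteq> \<zero>" by auto
    have ap: "\<alpha> [^] (k::nat) \<in> S" "\<alpha> [^] k \<in> L" "\<alpha> [^] k \<noteq> \<zero>" "vL (\<alpha> [^] k) = int k" for k
      using subfield_pow[OF Ss(1,3)] Ss(4) pow_non_zero[OF \<alpha>(2,3)] V.val_pow[of \<alpha> k] \<alpha> v\<alpha> by auto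
    obtain \<beta> where \<beta>: "\<beta> \<in> S" "\<beta> \<in> L" "\<beta> \<noteq> \<zero>" "vL \<beta> = vL x"
    proof (cases "0 \<le> vL x")
      case True
      then show ?thesis using that[of "\<alpha> [^] nat (vL x)"] ap[of "nat (vL x)"] by simp
    next
      case False
      let ?p = "\<alpha> [^] nat (- vL x)"
      have "inv ?p \<in> S" using subfield_m_inv(1)[OF Ss(1), of ?p] ap by auto
      then show ?thesis using that[of "inv ?p"] inv[of ?p] ap[of "nat (- vL x)"] False by simp
    qed
    note ib = inv[OF \<beta>(2,3)]
    define y' where "y' = x \<otimes> inv \<beta>"
    have y': "y' \<in> L" unfolding y'_def using x ib Lrr(6) by blast
    have c: "x \<in> carrier \<Omega>" "inv \<beta> \<in> carrier \<Omega>" "\<beta> \<in> carrier \<Omega>" "y' \<in> carrier \<Omega>" using x ib \<beta> y' Lc by auto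
    have "vL y' = 0" unfolding y'_def using V.val_mult[of x "inv \<beta>"] x ib \<beta> by simp
    then have "y' \<in> V.B 0" using y' by (simp add: vball_def)
    then obtain s where s: "s \<in> L" "s \<ominus> y' \<in> V.B 1" "s \<in> Kf" using teich[OF y'] by blast
    have sc: "s \<in> carrier \<Omega>" using s Lc by blast
    have ys: "y' \<ominus> s \<in> V.B 1" using V.vball_diff_commute[of s y' 1] s y' minus by simp
    have bs: "\<beta> \<otimes> s \<in> S" using \<beta> s Ss Sr(6) by blast
    have "\<beta> \<otimes> y' = x \<otimes> (\<beta> \<otimes> inv \<beta>)" unfolding y'_def using c(1-3) by (simp add: m_ac)
    then have "x = \<beta> \<otimes> y'" using ib(3) c(1) by simp
    then have "x \<ominus> \<beta> \<otimes> s = \<beta> \<otimes> (y' \<ominus> s)" using c sc by (simp add: minus_eq r_distr r_minus)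
    moreover have "\<beta> \<otimes> (y' \<ominus> s) \<in> V.B (vL x + 1)"
      using V.vball_mult[of \<beta> "vL x" "y' \<ominus> s" 1] ys \<beta> by (simp add: vball_def)
    ultimately have "x \<ominus>\<^bsub>\<Omega>\<lparr>carrier := L\<rparr>\<^esub> (\<beta> \<otimes> s) \<in> V.B (vL x + 1)"
      using minus[of x "\<beta> \<otimes> s"] x(1) bs Ss(4) by auto
    then show "\<exists>y\<in>V.Span K us. x \<ominus>\<^bsub>\<Omega>\<lparr>carrier := L\<rparr>\<^esub> y \<in> V.B (vL x + 1)" using bs Sc by blast
  qed
  then have "L = adjoin \<Omega> Kf \<alpha>" using Sc by (simp add: S_def)
  then show "\<exists>\<xi> \<alpha>. \<xi> \<in> carrier \<Omega> \<and> \<xi> [^] (q ^ f - 1) = \<one> \<and> \<alpha> \<in> carrier \<Omega> \<and> \<alpha> [^] e = \<xi> \<otimes> \<pi> \<and> L = adjoin \<Omega> Kf \<alpha>"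
    using t1 cs \<alpha> \<alpha>e by blast
qed

lemma uniformiser_root_of_unram:
  assumes un: "unram f Kf uf" and \<xi>: "\<xi> \<in> carrier \<Omega>" "\<xi> [^] (q ^ f - 1) = \<one>"
    and \<pi>: "\<pi> \<in> K" "\<pi> \<noteq> \<zero>" "v \<pi> = 1" and \<alpha>: "\<alpha> \<in> carrier \<Omega>" "\<alpha> [^] e = \<xi> \<otimes> \<pi>" and e: "0 < e"
  shows "uniformiser_root \<Omega> K v Kf uf (\<xi> \<otimes> \<pi>) \<alpha> e"
proof (intro uniformiser_root.intro uniformiser_root_axioms.intro local_closure_axioms)
  note Kf = unramD[OF un]
  interpret V: valued_extension "\<Omega>\<lparr>carrier := Kf\<rparr>" uf K v 1 using Kf(5) .
  have \<xi>_Kf: "\<xi> \<in> Kf" using unram_root_of_unity_mem[OF un \<xi>] .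
  show "normalised_valuation (\<Omega>\<lparr>carrier := Kf\<rparr>) uf" by (rule V.normalised_valuation_axioms)
  have nz: "\<xi> \<noteq> \<zero>" "uf \<xi> = 0" using V.val_root_of_unity(1,2)[of \<xi> "q ^ f - 1"] \<xi> \<xi>_Kf qn_pos[OF Kf(4)] by auto
  show "\<xi> \<otimes> \<pi> \<in> Kf" using subringE(6)[OF subfieldE(1)[OF Kf(1)] \<xi>_Kf subsetD[OF Kf(2) \<pi>(1)]] .
  show "\<xi> \<otimes> \<pi> \<noteq> \<zero>" using nz \<pi> K_carrier[OF \<pi>(1)] \<xi>(1) by (simp add: integral_iff)
  show "uf (\<xi> \<otimes> \<pi>) = 1" using V.val_mult[of \<xi> \<pi>] V.val_K[of \<pi>] nz \<pi> \<xi>_Kf Kf(2) by auto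
qed (use unramD[OF un] \<alpha> e in auto)

lemma roots_of_unity_in_normal:
  assumes un: "unram f Kf uf" and un': "unram (r * f) E w" and r: "r = ord e (q ^ f)"
    and \<xi>: "\<xi> \<in> carrier \<Omega>" "\<xi> [^] (q ^ f - 1) = \<one>"
    and \<pi>: "\<pi> \<in> K" "\<pi> \<noteq> \<zero>" "v \<pi> = 1" and \<alpha>: "\<alpha> \<in> carrier \<Omega>" "\<alpha> [^] e = \<xi> \<otimes> \<pi>" and e: "0 < e" "coprime e q"
    and A: "subfield A \<Omega>" "K \<subseteq> A" "normal_subextension \<Omega> K A" "adjoin \<Omega> Kf \<alpha> \<subseteq> A"
  shows "E \<subseteq> A"
proof -
  interpret U: uniformiser_root \<Omega> K v Kf uf "\<xi> \<otimes> \<pi>" \<alpha> e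
    by (rule uniformiser_root_of_unram[OF un \<xi> \<pi> \<alpha> e(1)])
  note Kf = unramD[OF un] and E = unramD[OF un']
  have ediv: "e dvd q ^ (f * i) - 1 \<longleftrightarrow> r dvd i" for i
  proof -
    have "1 \<le> (q ^ f) ^ i" using q_gt_1 by simp
    then have "e dvd (q ^ f) ^ i - 1 \<longleftrightarrow> [(q ^ f) ^ i = 1] (mod e)" by (simp add: cong_altdef_nat)
    then show ?thesis using ord_divides[of "q ^ f" i e] r by (simp add: power_mult)
  qed
  have "e dvd q ^ (r * f) - 1" using ediv[of r] by (simp add: mult.commute)
  obtain x where x: "x \<in> E" "\<And>i. x [^] (i::nat) = \<one> \<longleftrightarrow> (q ^ (r * f) - 1) dvd i"
    using unram_primitive_root[OF un'] by blast
  have xc: "x \<in> carrier \<Omega>" using x E(7) by blast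
  define \<zeta> where "\<zeta> = x [^] ((q ^ (r * f) - 1) div e)"
  have \<zeta>: "\<zeta> \<in> carrier \<Omega>" "\<And>i. \<zeta> [^] (i::nat) = \<one> \<longleftrightarrow> e dvd i"
    using primitive_root_of_divisor[OF xc x(2) \<open>e dvd q ^ (r * f) - 1\<close> qn_pos[OF E(4)]] xc by (auto simp: \<zeta>_def)
  have aA: "\<alpha> \<in> A" "Kf \<subseteq> A" using A(4) adjoin_incl[where K=Kf and a=\<alpha>] by auto
  have ac: "\<xi> \<otimes> \<pi> \<in> carrier \<Omega>" using \<xi> \<pi> K_carrier by simp
  have "\<zeta> [^] e = \<one>" using \<zeta>(2) by simp
  then have "(\<zeta> \<otimes> \<alpha>) [^] e = \<xi> \<otimes> \<pi>" using \<zeta>(1) \<alpha> ac by (simp add: nat_pow_distrib)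
  then have ev: "eval (Irr Kf \<alpha>) (\<zeta> \<otimes> \<alpha>) = \<zero>"
    unfolding U.Irr_eq_binom_poly using \<zeta> \<alpha> by (intro binom_poly_root[OF e(1) ac]) auto
  note IK = IrrE[OF K \<alpha>(1) alg[OF \<alpha>(1)]]
  note Ifc = carrier_polynomial_shell[OF U.F_ring IrrE(1)[OF Kf(1) \<alpha>(1) U.alg_F[OF \<alpha>(1)]]]
  \<comment> \<open>Normality concerns the minimal polynomial over \<open>K\<close>. The one over
    \<open>Kf\<close>, of which \<zeta> \<alpha> is known to be a root, divides it.\<close>
  have "Irr K \<alpha> \<in> carrier (Kf[X])"
    using IK(1) Kf(2) by (auto simp: univ_poly_carrier[symmetric] polynomial_def)
  then have "Irr Kf \<alpha> pdivides Irr K \<alpha>"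
    using Irr_minimal[OF Kf(1) \<alpha>(1) U.alg_F[OF \<alpha>(1)]] IK(4) by blast
  then have "eval (Irr K \<alpha>) (\<zeta> \<otimes> \<alpha>) = \<zero>"
    using pdivides_imp_root_sharing[OF Ifc _ _ ev] \<zeta> \<alpha> by simp
  then have "is_root (Irr K \<alpha>) (\<zeta> \<otimes> \<alpha>)"
    using \<zeta> \<alpha> pirreducibleE(1)[OF subfieldE(1)[OF K] IK(1,2)] by (simp add: is_root_def)
  then have "\<zeta> \<otimes> \<alpha> \<in> A" using A(3) aA by (auto simp: normal_subextension_def)
  then have "\<alpha> \<otimes> \<zeta> \<in> A" using \<zeta> \<alpha>(1) by (simp add: m_comm)
  moreover have "\<alpha> \<noteq> \<zero>" using \<alpha>(2) U.a(2) nat_pow_zero[of e] e(1) by auto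
  ultimately have \<zeta>A: "\<zeta> \<in> A" using subfield_m_inv_simprule[OF A(1), of \<alpha> \<zeta>] aA \<zeta>(1) by blast
  obtain y where y: "y \<in> Kf" "\<And>i. y [^] (i::nat) = \<one> \<longleftrightarrow> (q ^ f - 1) dvd i"
    using unram_primitive_root[OF un] by blast
  show "E \<subseteq> A"
  proof (rule unram_subset_of_roots[OF un' A(1,2) _ \<zeta>A])
    show "y \<in> A" using y aA by blast
    fix j
    have 1: "y [^] (q ^ j - 1) = \<one> \<longleftrightarrow> f dvd j" using y(2) pow_minus_one_dvd_iff[OF q_gt_1 Kf(4)] by simp
    show "y [^] (q ^ j - 1) = \<one> \<and> \<zeta> [^] (q ^ j - 1) = \<one> \<longleftrightarrow> r * f dvd j"
    proof (cases "f dvd j")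
      case True
      then obtain i where "j = f * i" by blast
      then show ?thesis using 1 \<zeta>(2) ediv[of i] Kf(4) by (simp add: mult.commute)
    next
      case False
      then have "\<not> r * f dvd j" using dvd_mult_right by blast
      then show ?thesis using 1 False by simp
    qed
  qed
qed

section \<open>Isomorphic extensions\<close>

lemma iso_of_hom:
  assumes "subfield A \<Omega>" "g \<in> ring_hom (\<Omega>\<lparr>carrier := A\<rparr>) \<Omega>" "g ` A = C"
  shows "g \<in> ring_iso (\<Omega>\<lparr>carrier := A\<rparr>) (\<Omega>\<lparr>carrier := C\<rparr>)"
  using hom_inj[OF assms(1,2)] hom_simps[OF assms(2)] assms(3)
  by (intro ring_iso_memI) (auto simp: bij_betw_def)

lemma hom_of_iso:
  assumes "subfield C \<Omega>" "g \<in> ring_iso (\<Omega>\<lparr>carrier := A\<rparr>) (\<Omega>\<lparr>carrier := C\<rparr>)"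
  shows "g \<in> ring_hom (\<Omega>\<lparr>carrier := A\<rparr>) \<Omega>" "g ` A = C"
proof -
  show 1: "g ` A = C" using ring_iso_memE(5)[OF assms(2)] by (simp add: bij_betw_def)
  show "g \<in> ring_hom (\<Omega>\<lparr>carrier := A\<rparr>) \<Omega>"
    using ring_iso_memE(1-4)[OF assms(2)] subfieldE(3)[OF assms(1)] by (intro ring_hom_memI) auto
qed

lemma isomorphic_over_sym:
  assumes "subfield A \<Omega>" "K \<subseteq> A" "isomorphic_over \<Omega> K A C"
  shows "isomorphic_over \<Omega> K C A"
proof -
  interpret A: ring "\<Omega>\<lparr>carrier := A\<rparr>" using subring_is_ring[OF subfieldE(1)[OF assms(1)]] .
  obtain g where g: "g \<in> ring_iso (\<Omega>\<lparr>carrier := A\<rparr>) (\<Omega>\<lparr>carrier := C\<rparr>)" "\<forall>x\<in>K. g x = x"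
    using assms(3) by (auto simp: isomorphic_over_def)
  have inj: "inj_on g A" using ring_iso_memE(5)[OF g(1)] by (simp add: bij_betw_def)
  have "inv_into (carrier (\<Omega>\<lparr>carrier := A\<rparr>)) g \<in> ring_iso (\<Omega>\<lparr>carrier := C\<rparr>) (\<Omega>\<lparr>carrier := A\<rparr>)"
    using ring_iso_set_sym[OF A.ring_axioms g(1)] .
  moreover have "inv_into A g x = x" if "x \<in> K" for x
    using inv_into_f_f[OF inj, of x] g(2) assms(2) that by auto
  ultimately show ?thesis by (auto simp: isomorphic_over_def)
qed

lemma isomorphic_over_trans:
  assumes "isomorphic_over \<Omega> K A C" "isomorphic_over \<Omega> K C D"
  shows "isomorphic_over \<Omega> K A D"
proof -
  obtain g h where g: "g \<in> ring_iso (\<Omega>\<lparr>carrier := A\<rparr>) (\<Omega>\<lparr>carrier := C\<rparr>)" "\<forall>x\<in>K. g x = x"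
    and h: "h \<in> ring_iso (\<Omega>\<lparr>carrier := C\<rparr>) (\<Omega>\<lparr>carrier := D\<rparr>)" "\<forall>x\<in>K. h x = x"
    using assms by (auto simp: isomorphic_over_def)
  have "h \<circ> g \<in> ring_iso (\<Omega>\<lparr>carrier := A\<rparr>) (\<Omega>\<lparr>carrier := D\<rparr>)" using ring_iso_set_trans[OF g(1) h(1)] .
  then show ?thesis unfolding isomorphic_over_def using g(2) h(2) by (intro bexI[of _ "h \<circ> g"]) auto
qed

lemma isomorphic_subset_normal:
  assumes "subfield A \<Omega>" "subfield C \<Omega>" "K \<subseteq> A" "isomorphic_over \<Omega> K A C" "normal_subextension \<Omega> K E" "A \<subseteq> E"
  shows "C \<subseteq> E"
proof
  fix y assume y: "y \<in> C"
  obtain g where g: "g \<in> ring_iso (\<Omega>\<lparr>carrier := A\<rparr>) (\<Omega>\<lparr>carrier := C\<rparr>)" "\<forall>x\<in>K. g x = x"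
    using assms(4) by (auto simp: isomorphic_over_def)
  note gh = hom_of_iso[OF assms(2) g(1)]
  obtain x where x: "x \<in> A" "y = g x" using gh(2) y by blast
  have "x \<in> carrier \<Omega>" using x subfieldE(3)[OF assms(1)] by blast
  then show "y \<in> E"
    using hom_conjugate_mem_normal(1)[OF K assms(5) _ assms(1,3) x(1) alg gh(1)] g(2) x assms(6) by auto
qed

lemma galois_closure_eqI:
  assumes "galois_subextension \<Omega> K M" "L \<subseteq> M"
    and "\<And>E. galois_subextension \<Omega> K E \<Longrightarrow> L \<subseteq> E \<Longrightarrow> M \<subseteq> E"
  shows "galois_closure \<Omega> K L = M"
  unfolding galois_closure_def using assms by blast

end

context tame_tower begin

text \<open>\<open>L\<close> is only isomorphic to K_f(\<alpha>). This suffices because a normal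
  extension that contains one of two isomorphic subfields contains the other.\<close>

lemma galois_closure_eq:
  assumes "subfield L \<Omega>" "K \<subseteq> L" "isomorphic_over \<Omega> K L (adjoin \<Omega> Kf \<alpha>)"
  shows "galois_closure \<Omega> K L = M"
proof (rule galois_closure_eqI[OF M_galois])
  have s: "subfield (adjoin \<Omega> Kf \<alpha>) \<Omega>" "K \<subseteq> adjoin \<Omega> Kf \<alpha>"
    using adjoin_subfield[OF Kf(1) \<alpha>(1)] adjoin_incl(1)[where K=Kf and a=\<alpha>] Kf(2) by auto
  have nM: "normal_subextension \<Omega> K M" using M_galois by (simp add: galois_subextension_def)
  show "L \<subseteq> M"
    using isomorphic_subset_normal[OF s(1) assms(1) s(2) isomorphic_over_sym[OF assms] nM Kf_adjoin_M] .
  fix E assume "galois_subextension \<Omega> K E" "L \<subseteq> E"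
  then have E: "subfield E \<Omega>" "K \<subseteq> E" "normal_subextension \<Omega> K E" "L \<subseteq> E" by (auto simp: galois_subextension_def)
  have "adjoin \<Omega> Kf \<alpha> \<subseteq> E"
    using isomorphic_subset_normal[OF assms(1) s(1) assms(2,3) E(3,4)] .
  then show "M \<subseteq> E" using M_minimal[OF E(1-3)] by blast
qed

end

section \<open>Classes modulo powers\<close>

context field begin

lemma mult_of_comm_group: "comm_group (mult_of R)"
proof -
  interpret M: group "mult_of R" using field_mult_group unfolding mult_of_eq .
  show ?thesis by (rule M.group_comm_groupI) (auto simp: m_comm)
qed

lemma powers_subgroup: "subgroup (powers (mult_of R) e) (mult_of R)"
proof -
  interpret M: comm_group "mult_of R" by (rule mult_of_comm_group)
  show ?thesis
  proof (rule M.subgroupI)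
    show "powers (mult_of R) e \<subseteq> carrier (mult_of R)"
      by (auto simp: powers_def nat_pow_mult_of pow_non_zero)
    show "powers (mult_of R) e \<noteq> {}" unfolding powers_def using one_not_zero by auto
    fix a assume "a \<in> powers (mult_of R) e"
    then obtain x where x: "x \<in> carrier (mult_of R)" "a = x [^]\<^bsub>mult_of R\<^esub> e" by (auto simp: powers_def)
    have "inv\<^bsub>mult_of R\<^esub> a = (inv\<^bsub>mult_of R\<^esub> x) [^]\<^bsub>mult_of R\<^esub> e" using x M.nat_pow_inv by simp
    then show "inv\<^bsub>mult_of R\<^esub> a \<in> powers (mult_of R) e" unfolding powers_def using x M.inv_closed by blast
    fix b assume "b \<in> powers (mult_of R) e"
    then obtain y where y: "y \<in> carrier (mult_of R)" "b = y [^]\<^bsub>mult_of R\<^esub> e" by (auto simp: powers_def)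
    have "a \<otimes>\<^bsub>mult_of R\<^esub> b = (x \<otimes> y) [^]\<^bsub>mult_of R\<^esub> e"
      using x y nat_pow_distrib[of x y e] by (simp add: nat_pow_mult_of)
    moreover have "x \<otimes> y \<in> carrier (mult_of R)" using x(1) y(1) by (simp add: integral_iff)
    ultimately show "a \<otimes>\<^bsub>mult_of R\<^esub> b \<in> powers (mult_of R) e" unfolding powers_def by simp
  qed
qed

lemma powers_normal: "powers (mult_of R) e \<lhd> mult_of R"
  using comm_group.normal_iff_subgroup[OF mult_of_comm_group] powers_subgroup by blast

lemma mem_power_class:
  "y \<in> power_class (mult_of R) e x \<longleftrightarrow> (\<exists>c\<in>carrier R - {\<zero>}. y = c [^] e \<otimes> x)"
  by (auto simp: power_class_def powers_def r_coset_def nat_pow_mult_of)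

lemma power_class_self: "x \<in> carrier R \<Longrightarrow> x \<in> power_class (mult_of R) e x"
  unfolding mem_power_class by (intro bexI[of _ \<one>]) auto

text \<open>The relation is cleared of denominators: it says \<open>y = c ^ e t ^ (k - m)\<close>.\<close>
lemma generate_power_class:
  assumes t: "t \<in> carrier R" "t \<noteq> \<zero>"
    and C: "C \<in> generate (power_quotient (mult_of R) e) {power_class (mult_of R) e t}" and y: "y \<in> C"
  shows "y \<in> carrier R - {\<zero>} \<and> (\<exists>c\<in>carrier R - {\<zero>}. \<exists>(m::nat) (k::nat). y \<otimes> t [^] m = c [^] e \<otimes> t [^] k)"
  using C y
proof (induction arbitrary: y rule: generate.induct)
  case one
  then obtain c where "c \<in> carrier R - {\<zero>}" "y = c [^] e"
    by (auto simp: power_quotient_def powers_def nat_pow_mult_of)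
  then show ?case using pow_non_zero by (auto intro!: bexI[of _ c] exI[of _ "0::nat"])
next
  case (incl h)
  then obtain c where c: "c \<in> carrier R - {\<zero>}" "y = c [^] e \<otimes> t" by (auto simp: mem_power_class)
  then have "y \<otimes> t [^] (0::nat) = c [^] e \<otimes> t [^] (1::nat)" using t by simp
  moreover have "y \<in> carrier R - {\<zero>}" using c t pow_non_zero by (auto simp: integral_iff)
  ultimately show ?case using c(1) by blast
next
  case (inv h)
  interpret M: comm_group "mult_of R" by (rule mult_of_comm_group)
  have h: "h = powers (mult_of R) e #>\<^bsub>mult_of R\<^esub> t" using inv by (simp add: power_class_def)
  have hc: "h \<in> carrier (mult_of R Mod powers (mult_of R) e)" using h t by (auto simp: carrier_FactGroup)
  have "y \<in> set_inv\<^bsub>mult_of R\<^esub> h"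
    using inv.prems normal.inv_FactGroup[OF powers_normal hc] by (simp add: power_quotient_def)
  then obtain z where z: "z \<in> h" "y = inv\<^bsub>mult_of R\<^esub> z" by (auto simp: SET_INV_def)
  obtain c where c: "c \<in> carrier R - {\<zero>}" "z = c [^] e \<otimes> t"
    using z(1) mem_power_class[of z e t] by (auto simp: h power_class_def)
  have zc: "z \<in> carrier (mult_of R)" using c t pow_non_zero by (auto simp: integral_iff)
  have yc: "y \<in> carrier R - {\<zero>}" using z(2) M.inv_closed[OF zc] by simp
  define b where "b = inv\<^bsub>mult_of R\<^esub> c"
  have b: "b \<in> carrier R - {\<zero>}" "b \<otimes> c = \<one>"
    using M.inv_closed[of c] M.l_inv[of c] c(1) by (auto simp: b_def)
  have bc: "b \<in> carrier R" "c \<in> carrier R" "y \<in> carrier R" using b c yc by auto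
  have 1: "y \<otimes> (c [^] e \<otimes> t) = \<one>" using M.l_inv[OF zc] z(2) c(2) by simp
  have 2: "b [^] e \<otimes> c [^] e = \<one>" using b bc nat_pow_distrib[of b c e] by simp
  have "y \<otimes> t = (b [^] e \<otimes> c [^] e) \<otimes> (y \<otimes> t)" using 2 bc t by simp
  also have "\<dots> = b [^] e \<otimes> (y \<otimes> (c [^] e \<otimes> t))" using bc t by (simp add: m_ac)
  finally have "y \<otimes> t [^] (1::nat) = b [^] e \<otimes> t [^] (0::nat)" using 1 t bc by simp
  then show ?case using yc b(1) by blast
next
  case (eng h1 h2)
  obtain y1 y2 where yy: "y1 \<in> h1" "y2 \<in> h2" "y = y1 \<otimes> y2"
    using eng.prems by (auto simp: power_quotient_def set_mult_def)
  obtain c1 m1 k1 where 1: "y1 \<in> carrier R - {\<zero>}" "c1 \<in> carrier R - {\<zero>}" "y1 \<otimes> t [^] (m1::nat) = c1 [^] e \<otimes> t [^] (k1::nat)"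
    using eng.IH(1)[OF yy(1)] by blast
  obtain c2 m2 k2 where 2: "y2 \<in> carrier R - {\<zero>}" "c2 \<in> carrier R - {\<zero>}" "y2 \<otimes> t [^] (m2::nat) = c2 [^] e \<otimes> t [^] (k2::nat)"
    using eng.IH(2)[OF yy(2)] by blast
  have c: "y1 \<in> carrier R" "y2 \<in> carrier R" "c1 \<in> carrier R" "c2 \<in> carrier R" using 1 2 by auto
  have "y \<otimes> t [^] (m1 + m2) = (y1 \<otimes> t [^] m1) \<otimes> (y2 \<otimes> t [^] m2)"
    unfolding yy(3) using c t(1) by (simp add: nat_pow_mult[symmetric] m_ac)
  also have "\<dots> = (c1 \<otimes> c2) [^] e \<otimes> t [^] (k1 + k2)"
    unfolding 1(3) 2(3) using c t(1) by (simp add: nat_pow_mult[symmetric] nat_pow_distrib m_ac)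
  finally have "y \<otimes> t [^] (m1 + m2) = (c1 \<otimes> c2) [^] e \<otimes> t [^] (k1 + k2)" .
  moreover have "c1 \<otimes> c2 \<in> carrier R - {\<zero>}" "y \<in> carrier R - {\<zero>}" using 1 2 yy(3) by (auto simp: integral_iff)
  ultimately show ?case by blast
qed

text \<open>In terms of a generator g of the cyclic group of order e c, an element g^s is killed by
  \<open>c\<close> exactly when \<open>e\<close> divides s.\<close>

lemma mem_powers_iff:
  assumes fin: "finite (carrier R)" and card: "card (carrier R) - 1 = e * c" "0 < e * c" and y: "y \<in> carrier R" "y \<noteq> \<zero>"
  shows "y \<in> powers (mult_of R) e \<longleftrightarrow> y [^] c = \<one>"
proof
  have all: "x [^] (e * c) = \<one>" if "x \<in> carrier R" "x \<noteq> \<zero>" for x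
  proof -
    have "card (carrier R) = Suc (e * c)" using card by linarith
    then have "x [^] (e * c) \<otimes> x = \<one> \<otimes> x" using finite_field_pow_card[OF fin that(1)] that by simp
    then show ?thesis using m_rcancel[of x "x [^] (e * c)" \<one>] that by simp
  qed
  assume "y \<in> powers (mult_of R) e"
  then obtain x where "x \<in> carrier R" "x \<noteq> \<zero>" "y = x [^] e" by (auto simp: powers_def nat_pow_mult_of)
  then show "y [^] c = \<one>" using all by (simp add: nat_pow_pow)
next
  assume yc: "y [^] c = \<one>"
  obtain g where g: "g \<in> carrier R" "\<And>i. g [^] (i::nat) = \<one> \<longleftrightarrow> (e * c) dvd i"
    using finite_field_generator[OF fin] card by metis
  have "y [^] (e * c) = (y [^] c) [^] e" using y by (simp add: nat_pow_pow mult.commute)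
  then obtain s :: nat where s: "y = g [^] s"
    using root_of_unity_is_power[OF g card(2) y(1)] yc by auto
  then have "e * c dvd s * c" using yc g by (simp add: nat_pow_pow)
  then have "e dvd s" using card by simp
  then obtain r where "s = e * r" by blast
  then have "y = (g [^] r) [^] e" using s g by (simp add: nat_pow_pow mult.commute)
  moreover have "g [^] r \<in> carrier (mult_of R)" using g primitive_root_inj(2)[OF g card(2)] pow_non_zero by simp
  ultimately show "y \<in> powers (mult_of R) e" unfolding powers_def nat_pow_mult_of by blast
qed

text \<open>Being an e-th power is tested by the exponent \<open>c\<close>, so the order of a class
  in the quotient turns into a divisibility condition on exponents of \<open>x\<close>.\<close>

lemma class_power_order_eqI:
  assumes fin: "finite (carrier R)" and card: "card (carrier R) - 1 = e * c" "0 < e * c" and x: "x \<in> carrier R" "x \<noteq> \<zero>"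
    and d: "\<And>i. x [^] (n * i * c) = \<one> \<longleftrightarrow> d dvd i"
  shows "class_power_order R e n x = d"
proof -
  interpret M: comm_group "mult_of R" by (rule mult_of_comm_group)
  interpret N: normal "powers (mult_of R) e" "mult_of R" by (rule powers_normal)
  define Q where "Q = power_quotient (mult_of R) e"
  have Qg: "group Q" unfolding Q_def power_quotient_def by (rule N.factorgroup_is_group)
  interpret Q: group Q by (rule Qg)
  have cl: "power_class (mult_of R) e z \<in> carrier Q" if "z \<in> carrier R" "z \<noteq> \<zero>" for z
    using that by (auto simp: Q_def power_quotient_def carrier_FactGroup power_class_def)
  have pw: "power_class (mult_of R) e z [^]\<^bsub>Q\<^esub> (m::nat) = power_class (mult_of R) e (z [^] m)"
    if z: "z \<in> carrier R" "z \<noteq> \<zero>" for z m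
  proof (induction m)
    case 0
    have "powers (mult_of R) e #>\<^bsub>mult_of R\<^esub> \<one> = powers (mult_of R) e"
      using M.coset_join2[of \<one>] powers_subgroup N.one_closed by simp
    then show ?case by (simp add: Q_def power_quotient_def power_class_def)
  next
    case (Suc m)
    then show ?case
      using N.rcos_sum[of "z [^] m" z] z pow_non_zero by (simp add: Q_def power_quotient_def power_class_def)
  qed
  have one: "power_class (mult_of R) e z = \<one>\<^bsub>Q\<^esub> \<longleftrightarrow> z \<in> powers (mult_of R) e"
    if z: "z \<in> carrier R" "z \<noteq> \<zero>" for z
    using M.coset_join1[of "powers (mult_of R) e" z] M.coset_join2[of z "powers (mult_of R) e"] z powers_subgroup
    by (auto simp: Q_def power_quotient_def power_class_def)
  have "(power_class (mult_of R) e x [^]\<^bsub>Q\<^esub> n) [^]\<^bsub>Q\<^esub> i = \<one>\<^bsub>Q\<^esub> \<longleftrightarrow> d dvd i" for i :: nat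
  proof -
    have "(power_class (mult_of R) e x [^]\<^bsub>Q\<^esub> n) [^]\<^bsub>Q\<^esub> i = power_class (mult_of R) e (x [^] (n * i))"
      using Q.nat_pow_pow[OF cl[OF x]] pw[OF x] by simp
    then show ?thesis
      using one[of "x [^] (n * i)"] mem_powers_iff[OF fin card, of "x [^] (n * i)"] x pow_non_zero[OF x] d[of i]
      by (simp add: nat_pow_pow)
  qed
  then have "group.ord Q (power_class (mult_of R) e x [^]\<^bsub>Q\<^esub> n) = d"
    using Q.ord_unique[of "power_class (mult_of R) e x [^]\<^bsub>Q\<^esub> n" d] cl[OF x] by simp
  then show ?thesis by (simp add: class_power_order_def Q_def)
qed

lemma exists_order:
  assumes "z \<in> carrier R" "z [^] (N::nat) = \<one>" "0 < N"
  shows "\<exists>d>0. \<forall>i. z [^] (i::nat) = \<one> \<longleftrightarrow> d dvd i"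
proof -
  interpret M: comm_group "mult_of R" by (rule mult_of_comm_group)
  have "z \<noteq> \<zero>" using assms nat_pow_zero[of N] by auto
  then have z: "z \<in> carrier (mult_of R)" using assms by simp
  have iff: "z [^] (i::nat) = \<one> \<longleftrightarrow> M.ord z dvd i" for i
    using M.pow_eq_id[OF z, of i] by (simp add: nat_pow_mult_of)
  then have "M.ord z dvd N" using assms by simp
  then have "0 < M.ord z" using assms by (metis dvd_0_left_iff not_gr_zero)
  then show ?thesis using iff by blast
qed

end

context local_field begin

text \<open>Existence by completeness and uniqueness by \<open>teichmuller_unique\<close> together
  show that the description in \<open>teichmuller\<close> denotes an actual lift.\<close>

lemma teichmuller_lift:
  assumes "\<xi> \<in> carrier (mult_of k)"
  shows "teichmuller F v \<xi> \<in> B 0" "teichmuller F v \<xi> [^] Q = teichmuller F v \<xi>" "res (teichmuller F v \<xi>) = \<xi>"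
    "teichmuller F v \<xi> \<noteq> \<zero>"
proof -
  obtain x where x: "x \<in> B 0" "\<xi> = res x" using assms by (auto simp: k_carrier)
  obtain t where t: "t \<in> B 0" "t [^] Q = t" "t \<ominus> x \<in> B 1" using teichmuller_exists[OF x(1)] by blast
  have rt: "res t = \<xi>" using t x res_eq_iff by simp
  have "teichmuller F v \<xi> = t" unfolding teichmuller_def Q_def[symmetric]
  proof (rule the_equality)
    show "t \<in> \<xi> \<and> t [^] Q = t" using mem_res_self[OF t(1)] rt t(2) by simp
    fix s assume s: "s \<in> \<xi> \<and> s [^] Q = s"
    then have "s \<in> B 0" "res s = res t" using mem_res[of x s] x rt by auto
    then show "s = t" using teichmuller_unique[of s t] s t res_eq_iff[of s t] vball_carrier by blast
  qed
  then show "teichmuller F v \<xi> \<in> B 0" "teichmuller F v \<xi> [^] Q = teichmuller F v \<xi>" "res (teichmuller F v \<xi>) = \<xi>"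
    using t rt by auto
  then show "teichmuller F v \<xi> \<noteq> \<zero>" using assms res_zero_iff[of \<zero>] by auto
qed

lemma teichmuller_pow_eq_one_iff:
  assumes "t \<in> B 0" "t [^] Q = t"
  shows "t [^] (i::nat) = \<one> \<longleftrightarrow> res t [^]\<^bsub>k\<^esub> i = \<one>\<^bsub>k\<^esub>"
proof -
  have tc: "t \<in> carrier F" using assms vball_carrier by blast
  have "(t [^] i) [^] Q = t [^] i" using tc assms(2) by (metis mult.commute nat_pow_pow)
  then have "t [^] i = \<one> \<longleftrightarrow> t [^] i \<ominus> \<one> \<in> B 1"
    using teichmuller_unique[of "t [^] i" \<one>] tc by (auto simp: a_minus_def r_neg)
  then show ?thesis using res_eq_iff[of "t [^] i" \<one>] assms vball_pow res_pow[of t i] res_one by auto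
qed

end

section \<open>Ramified lines\<close>

context local_closure begin

text \<open>The uniformiser \<open>\<pi>'\<close> belongs to the conjugate line, so it is
  \<sigma>(y) for some \<open>y\<close> in a class of \<open>D\<close>. Comparing valuations shows
  that \<open>y\<close> is t times an e-th power, with t = \<xi> \<pi>. So \<open>\<pi>'\<close> is
  \<sigma>(t) times an e-th power \<delta>^e, the quotient of \<open>\<gamma>\<close> by
  \<open>\<delta>\<close> is an e-th root of \<sigma>(t), and \<open>\<sigma>\<close> extends by
  sending \<open>\<alpha>\<close> to it.\<close>

lemma represents_orbit_isomorphic:
  assumes un: "unram f Kf uf" and \<xi>: "\<xi> \<in> carrier \<Omega>" "\<xi> [^] (q ^ f - 1) = \<one>"
    and \<pi>: "\<pi> \<in> K" "\<pi> \<noteq> \<zero>" "v \<pi> = 1" and \<alpha>: "\<alpha> \<in> carrier \<Omega>" "\<alpha> [^] e = \<xi> \<otimes> \<pi>" and e: "0 < e"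
    and rep: "represents_orbit_of \<Omega> K Kf uf e D L" and gen: "generated_by_class (\<Omega>\<lparr>carrier := Kf\<rparr>) e D (\<xi> \<otimes> \<pi>)"
  shows "isomorphic_over \<Omega> K (adjoin \<Omega> Kf \<alpha>) L"
proof -
  interpret U: uniformiser_root \<Omega> K v Kf uf "\<xi> \<otimes> \<pi>" \<alpha> e
    by (rule uniformiser_root_of_unram[OF un \<xi> \<pi> \<alpha> e])
  define t where "t = \<xi> \<otimes> \<pi>"
  note Kf = unramD[OF un]
  interpret V: valued_extension "\<Omega>\<lparr>carrier := Kf\<rparr>" uf K v 1 using Kf(5) .
  note Kr = subringE[OF subfieldE(1)[OF Kf(1)]]
  have Kc: "x \<in> carrier \<Omega>" if "x \<in> Kf" for x using Kf(7) that by blast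
  obtain \<sigma> E \<pi>' \<gamma> where \<sigma>: "\<sigma> \<in> galois_group \<Omega> K Kf"
    and \<pi>': "uniformiser (\<Omega>\<lparr>carrier := Kf\<rparr>) uf \<pi>'"
    and gen': "generated_by_class (\<Omega>\<lparr>carrier := Kf\<rparr>) e ((`) \<sigma> ` D) \<pi>'"
    and \<gamma>: "\<gamma> \<in> carrier \<Omega>" "\<gamma> [^] e = \<pi>'" "E = adjoin \<Omega> Kf \<gamma>" and iso: "isomorphic_over \<Omega> K E L"
    using rep by (auto simp: represents_orbit_of_def line_orbit_def line_root_field_def)
  have \<sigma>iso: "\<sigma> \<in> ring_iso (\<Omega>\<lparr>carrier := Kf\<rparr>) (\<Omega>\<lparr>carrier := Kf\<rparr>)" and \<sigma>K: "\<And>c. c \<in> K \<Longrightarrow> \<sigma> c = c"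
    using \<sigma> by (auto simp: galois_group_def)
  note \<sigma>h = hom_of_iso[OF Kf(1) \<sigma>iso]
  note hs = hom_simps[OF \<sigma>h(1)]
  have \<sigma>Kf: "\<sigma> x \<in> Kf" if "x \<in> Kf" for x using \<sigma>h(2) that by blast
  have \<sigma>nz: "\<sigma> x \<noteq> \<zero>" if "x \<in> Kf" "x \<noteq> \<zero>" for x
    using hom_inj[OF Kf(1) \<sigma>h(1)] hom_zero[OF Kf(1) \<sigma>h(1)] that Kr(2) by (metis inj_onD)
  have \<pi>'F: "\<pi>' \<in> Kf" "\<pi>' \<noteq> \<zero>" "uf \<pi>' = 1" using \<pi>' by (auto simp: uniformiser_def)
  have tF: "t \<in> Kf" "t \<noteq> \<zero>" using U.a by (auto simp: t_def)
  have tc: "t \<in> carrier \<Omega>" using Kc tF by blast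
  have "power_class (mult_of (\<Omega>\<lparr>carrier := Kf\<rparr>)) e \<pi>' \<in> (`) \<sigma> ` D"
    using gen' unfolding generated_by_class_def by (metis generate.incl singletonI)
  then obtain C where C: "C \<in> D" "power_class (mult_of (\<Omega>\<lparr>carrier := Kf\<rparr>)) e \<pi>' = \<sigma> ` C" by blast
  then obtain y where y: "y \<in> C" "\<pi>' = \<sigma> y" using field.power_class_self[OF subfield_iff(2)[OF Kf(1)], of \<pi>' e] \<pi>'F by auto
  have "C \<in> generate (power_quotient (mult_of (\<Omega>\<lparr>carrier := Kf\<rparr>)) e) {power_class (mult_of (\<Omega>\<lparr>carrier := Kf\<rparr>)) e t}"
    using C(1) gen by (simp add: generated_by_class_def t_def)
  then obtain c m k where c: "y \<in> Kf" "y \<noteq> \<zero>" "c \<in> Kf" "c \<noteq> \<zero>" "y \<otimes> t [^] (m::nat) = c [^] e \<otimes> t [^] (k::nat)"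
    using field.generate_power_class[OF subfield_iff(2)[OF Kf(1)], of t C e y] tF y(1) by auto
  have pF: "x [^] (i::nat) \<in> Kf" if "x \<in> Kf" for x i using subfield_pow[OF Kf(1) that] .
  have pnz: "x [^] (i::nat) \<noteq> \<zero>" if "x \<in> Kf" "x \<noteq> \<zero>" for x i using pow_non_zero[OF Kc[OF that(1)] that(2)] .
  \<comment> \<open>Instead of invariance of \<open>uf\<close> under \<open>\<sigma>\<close>, this
    uses that the image of \<open>\<xi>\<close> is a root of unity and that \<open>\<pi>\<close> is
    fixed.\<close>
  have uf\<sigma>t: "uf (\<sigma> t) = 1"
  proof -
    have \<xi>F: "\<xi> \<in> Kf" using unram_root_of_unity_mem[OF un \<xi>] .
    have "\<sigma> \<xi> [^] (q ^ f - 1) = \<one>" using hom_pow(1)[OF Kf(1) \<sigma>h(1) \<xi>F, of "q ^ f - 1"] \<xi> hs(4) by simp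
    then have "uf (\<sigma> \<xi>) = 0" "\<sigma> \<xi> \<noteq> \<zero>"
      using U.N.val_root_of_unity(1,2)[of "\<sigma> \<xi>" "q ^ f - 1"] \<sigma>Kf[OF \<xi>F] qn_pos[OF Kf(4)] by auto
    moreover have "\<sigma> t = \<sigma> \<xi> \<otimes> \<pi>" unfolding t_def using hs(2)[OF \<xi>F, of \<pi>] \<sigma>K \<pi> Kf(2) by auto
    ultimately show ?thesis using U.N.val_mult[of "\<sigma> \<xi>" \<pi>] V.val_K[of \<pi>] \<pi> \<sigma>Kf[OF \<xi>F] Kf(2) by auto
  qed
  have \<sigma>t: "\<sigma> t \<in> Kf" "\<sigma> t \<noteq> \<zero>" and \<sigma>c: "\<sigma> c \<in> Kf" "\<sigma> c \<noteq> \<zero>" using \<sigma>Kf \<sigma>nz tF c by auto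
  define j where "j = uf (\<sigma> c)"
  have "\<sigma> (y \<otimes> t [^] m) = \<pi>' \<otimes> \<sigma> t [^] m"
    using hs(2)[OF c(1) pF[OF tF(1)]] y(2) hom_pow(1)[OF Kf(1) \<sigma>h(1) tF(1)] by simp
  moreover have "\<sigma> (c [^] e \<otimes> t [^] k) = \<sigma> c [^] e \<otimes> \<sigma> t [^] k"
    using hs(2)[OF pF[OF c(3)] pF[OF tF(1)]] hom_pow(1)[OF Kf(1) \<sigma>h(1) tF(1)] hom_pow(1)[OF Kf(1) \<sigma>h(1) c(3)] by simp
  ultimately have "\<pi>' \<otimes> \<sigma> t [^] m = \<sigma> c [^] e \<otimes> \<sigma> t [^] k" using c(5) by simp
  moreover have "uf (\<pi>' \<otimes> \<sigma> t [^] m) = 1 + int m"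
    using U.N.val_mult[of \<pi>' "\<sigma> t [^] m"] U.N.val_pow[of "\<sigma> t" m] \<pi>'F \<sigma>t pF pnz uf\<sigma>t by simp
  moreover have "uf (\<sigma> c [^] e \<otimes> \<sigma> t [^] k) = int e * j + int k"
    using U.N.val_mult[of "\<sigma> c [^] e" "\<sigma> t [^] k"] U.N.val_pow[of "\<sigma> t" k] U.N.val_pow[of "\<sigma> c" e] \<sigma>c \<sigma>t pF pnz uf\<sigma>t
    by (simp add: j_def)
  ultimately have exps: "1 + int m = int e * j + int k" by simp
  have cc: "c \<in> carrier \<Omega>" "y \<in> carrier \<Omega>" using c Kc by auto
  \<comment> \<open>By \<open>exps\<close> the exponent k - m of \<open>t\<close> is 1 - e j, so the
    surplus is an e-th power and is absorbed into \<open>c\<close>. The sign of \<open>j\<close>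
    decides whether this needs an inverse.\<close>
  have "\<exists>c'\<in>Kf - {\<zero>}. y = t \<otimes> c' [^] e"
  proof (cases "0 \<le> j")
    case True
    define J where "J = nat j"
    have "int (1 + m) = int (e * J + k)" using exps True by (simp add: J_def)
    then have mk: "k + e * J = m + 1" by linarith
    define s where "s = t [^] J"
    have s: "s \<in> Kf" "s \<noteq> \<zero>" "s \<in> carrier \<Omega>" using pF[OF tF(1)] pnz[OF tF] Kc by (auto simp: s_def)
    have ins: "inv s \<in> Kf" "inv s \<noteq> \<zero>" "s \<otimes> inv s = \<one>" using subfield_m_inv[OF Kf(1), of s] s by auto
    have isc: "inv s \<in> carrier \<Omega>" using ins Kc by blast
    have se: "s [^] e = t [^] (e * J)" using tc by (simp add: s_def nat_pow_pow mult.commute)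
    have "t [^] m \<otimes> (y \<otimes> s [^] e) = (y \<otimes> t [^] m) \<otimes> s [^] e" using cc tc s by (simp add: m_ac)
    also have "\<dots> = c [^] e \<otimes> t [^] (k + e * J)" unfolding c(5) se using cc tc by (simp add: nat_pow_mult[symmetric] m_assoc)
    also have "\<dots> = t [^] m \<otimes> (c [^] e \<otimes> t)" unfolding mk using cc tc by (simp add: m_ac)
    finally have "y \<otimes> s [^] e = c [^] e \<otimes> t"
      using m_lcancel[of "t [^] m" "y \<otimes> s [^] e" "c [^] e \<otimes> t"] pnz[OF tF] cc tc s by simp
    moreover have "s [^] e \<otimes> inv s [^] e = \<one>" using s ins isc by (simp add: nat_pow_distrib[symmetric])
    then have "y = (y \<otimes> s [^] e) \<otimes> inv s [^] e" using cc s isc by (simp add: m_assoc)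
    ultimately have "y = t \<otimes> (c \<otimes> inv s) [^] e" using cc s isc tc by (simp add: nat_pow_distrib m_ac)
    moreover have "c \<otimes> inv s \<in> Kf - {\<zero>}" using c ins cc isc Kr(6) by (auto simp: integral_iff)
    ultimately show ?thesis by blast
  next
    case False
    define J where "J = nat (- j)"
    have "int k = int 1 + int m + int e * int J" using exps False by (simp add: J_def algebra_simps)
    then have "int k = int (m + (1 + e * J))" by simp
    then have mk: "k = m + (1 + e * J)" by linarith
    define s where "s = t [^] J"
    have s: "s \<in> Kf" "s \<noteq> \<zero>" "s \<in> carrier \<Omega>" using pF[OF tF(1)] pnz[OF tF] Kc by (auto simp: s_def)
    have se: "s [^] e = t [^] (e * J)" using tc by (simp add: s_def nat_pow_pow mult.commute)
    have "t [^] m \<otimes> y = y \<otimes> t [^] m" using cc tc by (simp add: m_comm)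
    also have "\<dots> = t [^] m \<otimes> (t \<otimes> (c \<otimes> s) [^] e)"
      unfolding c(5) mk using cc tc s by (simp add: nat_pow_mult[symmetric] nat_pow_distrib se m_ac)
    finally have "y = t \<otimes> (c \<otimes> s) [^] e"
      using m_lcancel[of "t [^] m" y "t \<otimes> (c \<otimes> s) [^] e"] pnz[OF tF] cc tc s by simp
    moreover have "c \<otimes> s \<in> Kf - {\<zero>}" using c s cc Kr(6) by (auto simp: integral_iff)
    ultimately show ?thesis by blast
  qed
  then obtain c' where c': "c' \<in> Kf" "c' \<noteq> \<zero>" "y = t \<otimes> c' [^] e" by blast
  define \<delta> where "\<delta> = \<sigma> c'"
  have \<delta>: "\<delta> \<in> Kf" "\<delta> \<noteq> \<zero>" using \<sigma>Kf \<sigma>nz c' by (auto simp: \<delta>_def)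
  have i\<delta>: "inv \<delta> \<in> Kf" "inv \<delta> \<noteq> \<zero>" "\<delta> \<otimes> inv \<delta> = \<one>" using subfield_m_inv[OF Kf(1), of \<delta>] \<delta> by auto
  have dc: "\<delta> \<in> carrier \<Omega>" "inv \<delta> \<in> carrier \<Omega>" "\<sigma> t \<in> carrier \<Omega>" using \<delta> i\<delta> \<sigma>t Kc by auto
  have \<pi>'\<delta>: "\<pi>' = \<sigma> t \<otimes> \<delta> [^] e"
    unfolding y(2) c'(3) \<delta>_def using hs(2)[OF tF(1) pF[OF c'(1)]] hom_pow(1)[OF Kf(1) \<sigma>h(1) c'(1)] by simp
  define \<gamma>' where "\<gamma>' = \<gamma> \<otimes> inv \<delta>"
  have \<gamma>'c: "\<gamma>' \<in> carrier \<Omega>" using \<gamma> dc by (simp add: \<gamma>'_def)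
  have \<gamma>\<gamma>': "\<gamma> = \<gamma>' \<otimes> \<delta>" unfolding \<gamma>'_def using \<gamma>(1) dc i\<delta> by (simp add: m_assoc m_comm[of "inv \<delta>" \<delta>])
  have \<gamma>'e: "\<gamma>' [^] e = \<sigma> t"
  proof -
    have "\<delta> [^] e \<otimes> inv \<delta> [^] e = \<one>" using dc i\<delta> by (simp add: nat_pow_distrib[symmetric])
    moreover have "\<gamma>' [^] e = \<sigma> t \<otimes> (\<delta> [^] e \<otimes> inv \<delta> [^] e)"
      unfolding \<gamma>'_def using \<gamma> \<pi>'\<delta> dc by (simp add: nat_pow_distrib m_assoc)
    ultimately show ?thesis using dc by simp
  qed
  \<comment> \<open>Dividing the generator by an element of \<open>Kf\<close> does not change the
    field it generates over \<open>Kf\<close>.\<close>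
  have E: "E = adjoin \<Omega> Kf \<gamma>'"
  proof
    have s: "subfield (adjoin \<Omega> Kf \<gamma>') \<Omega>" "subfield (adjoin \<Omega> Kf \<gamma>) \<Omega>" using adjoin_subfield[OF Kf(1)] \<gamma>'c \<gamma>(1) by auto
    note r1 = subringE(6)[OF subfieldE(1)[OF s(1)]] and r2 = subringE(6)[OF subfieldE(1)[OF s(2)]]
    have "\<gamma> \<in> adjoin \<Omega> Kf \<gamma>'" unfolding \<gamma>\<gamma>' using r1 adjoin_incl \<delta>(1) by blast
    then show "E \<subseteq> adjoin \<Omega> Kf \<gamma>'" unfolding \<gamma>(3) using adjoin_subset[OF Kf(1) s(1)] adjoin_incl(1) by blast
    have "\<gamma>' \<in> adjoin \<Omega> Kf \<gamma>" unfolding \<gamma>'_def using r2 adjoin_incl i\<delta>(1) by blast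
    then show "adjoin \<Omega> Kf \<gamma>' \<subseteq> E" unfolding \<gamma>(3) using adjoin_subset[OF Kf(1) s(2)] adjoin_incl(1) by blast
  qed
  have "eval (map \<sigma> (Irr Kf \<alpha>)) \<gamma>' = \<zero>"
    unfolding U.Irr_eq_binom_poly t_def[symmetric] hom_binom_poly[OF Kf(1) \<sigma>h(1) tF(1)]
    by (rule binom_poly_root[OF e dc(3) \<gamma>'c \<gamma>'e])
  then obtain g where g: "g \<in> ring_hom (\<Omega>\<lparr>carrier := adjoin \<Omega> Kf \<alpha>\<rparr>) \<Omega>" "\<forall>x\<in>Kf. g x = \<sigma> x" "g \<alpha> = \<gamma>'"
    using extend_hom[OF Kf(1) \<alpha>(1) U.alg_F[OF \<alpha>(1)] \<sigma>h(1) \<gamma>'c] by blast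
  have As: "subfield (adjoin \<Omega> Kf \<alpha>) \<Omega>" using adjoin_subfield[OF Kf(1) \<alpha>(1)] .
  have Es: "subfield E \<Omega>" "Kf \<subseteq> E" "\<gamma>' \<in> E"
    unfolding E using adjoin_subfield[OF Kf(1) \<gamma>'c] adjoin_incl by auto
  have gKf: "g ` Kf = Kf" using g(2) \<sigma>h(2) by auto
  have "g ` adjoin \<Omega> Kf \<alpha> = E"
  proof
    show "g ` adjoin \<Omega> Kf \<alpha> \<subseteq> E"
      using hom_image_adjoin[OF Kf(1) \<alpha>(1) U.alg_F[OF \<alpha>(1)] g(1) Es(1)] gKf Es g(3) by simp
    have "Kf \<subseteq> g ` adjoin \<Omega> Kf \<alpha>" using gKf adjoin_incl(1)[where K=Kf and a=\<alpha>] by blast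
    moreover have "\<gamma>' \<in> g ` adjoin \<Omega> Kf \<alpha>" using g(3) adjoin_incl(2) by (metis imageI)
    ultimately show "E \<subseteq> g ` adjoin \<Omega> Kf \<alpha>"
      unfolding E using adjoin_subset[OF Kf(1) hom_image_subfield[OF As g(1)]] by blast
  qed
  then have "g \<in> ring_iso (\<Omega>\<lparr>carrier := adjoin \<Omega> Kf \<alpha>\<rparr>) (\<Omega>\<lparr>carrier := E\<rparr>)" using iso_of_hom[OF As g(1)] by blast
  moreover have "\<forall>x\<in>K. g x = x" using g(2) \<sigma>K Kf(2) by auto
  ultimately have "isomorphic_over \<Omega> K (adjoin \<Omega> Kf \<alpha>) E" by (auto simp: isomorphic_over_def)
  then show ?thesis using iso by (rule isomorphic_over_trans)
qed

end

section \<open>The order of the twist and the conclusion\<close>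

context local_field begin

lemma class_power_order_teichmuller:
  assumes \<xi>: "\<xi> \<in> carrier (mult_of k)" and c: "Q - 1 = e * c" "0 < e * c"
    and d: "\<And>i. teichmuller F v \<xi> [^] (n * i * c) = \<one> \<longleftrightarrow> d dvd i"
  shows "class_power_order k e n \<xi> = d"
proof -
  interpret k: field k by (rule k_field)
  note t = teichmuller_lift[OF \<xi>]
  show ?thesis
  proof (rule k.class_power_order_eqI[OF finite_residue_field _ c(2)])
    show "card (carrier k) - 1 = e * c" using c(1) by (simp add: Q_def)
    show "\<xi> \<in> carrier k" "\<xi> \<noteq> \<zero>\<^bsub>k\<^esub>" using \<xi> by auto
    show "\<xi> [^]\<^bsub>k\<^esub> (n * i * c) = \<one>\<^bsub>k\<^esub> \<longleftrightarrow> d dvd i" for i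
      using teichmuller_pow_eq_one_iff[OF t(1,2)] t(3) d by simp
  qed
qed

end

context local_closure begin

lemma exists_root:
  assumes "0 < (n::nat)" "c \<in> carrier \<Omega>"
  obtains x where "x \<in> carrier \<Omega>" "x [^] n = c"
proof -
  let ?p = "binom_poly n c"
  note p = binom_poly_closed[OF carrier_is_subring assms(2), of n]
  have "size (roots ?p) = n"
    using algebraically_splits[OF p(1)] binom_poly_length[OF assms(1), of c] by (simp add: splitted_def)
  then obtain x where "x \<in># roots ?p" using assms(1) by (metis multiset_nonemptyE not_gr_zero size_empty)
  then have x: "x \<in> carrier \<Omega>" "eval ?p x = \<zero>" using roots_mem_iff_is_root[OF p(1)] by (auto simp: is_root_def)
  then have "x [^] n = c" using binom_poly_eval[OF assms x(1)] assms x(1) by (simp add: r_right_minus_eq)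
  then show thesis using that x(1) by blast
qed

text \<open>Here the order belongs to an element of \<Omega>, so it is available for any
  presentation of the extension, independently of lines and residue classes.\<close>

lemma exists_twist_order:
  assumes "0 < f" "\<xi> \<in> carrier \<Omega>" "\<xi> [^] (q ^ f - 1) = \<one>"
  obtains d where "0 < d" "\<And>i. \<xi> [^] ((q - 1) * i * c) = \<one> \<longleftrightarrow> d dvd i"
proof -
  define z where "z = \<xi> [^] ((q - 1) * c)"
  have "z [^] (q ^ f - 1) = (\<xi> [^] (q ^ f - 1)) [^] ((q - 1) * c)"
    using assms(2) by (simp add: z_def nat_pow_pow mult.commute)
  then have "z [^] (q ^ f - 1) = \<one>" using assms by simp
  moreover have zc: "z \<in> carrier \<Omega>" using assms(2) by (simp add: z_def)
  ultimately obtain d where d: "0 < d" "\<forall>i. z [^] (i::nat) = \<one> \<longleftrightarrow> d dvd i"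
    using exists_order qn_pos[OF assms(1)] by blast
  have "\<xi> [^] ((q - 1) * i * c) = z [^] i" for i
    using assms(2) by (simp add: z_def nat_pow_pow mult_ac)
  then show thesis using that d by simp
qed

lemma tame_towerI:
  assumes "unram f Kf uf" "unram (d * f) Kn un" "0 < e" "e dvd q ^ f - 1"
    and "\<xi> \<in> carrier \<Omega>" "\<xi> [^] (q ^ f - 1) = \<one>" "\<pi> \<in> K" "\<pi> \<noteq> \<zero>" "v \<pi> = 1"
    and "\<alpha> \<in> carrier \<Omega>" "\<alpha> [^] e = \<xi> \<otimes> \<pi>"
    and "\<And>i. \<xi> [^] ((q - 1) * i * ((q ^ f - 1) div e)) = \<one> \<longleftrightarrow> d dvd i"
  shows "tame_tower \<Omega> K v f e d Kf Kn uf un \<xi> \<pi> \<alpha>"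
proof -
  have "0 < d" using unramD(4)[OF assms(2)] by simp
  then show ?thesis
    by (intro tame_tower.intro[OF local_closure_axioms] tame_tower_axioms.intro) (use assms in auto)
qed

lemma admissible_choice_galois_closure:
  assumes un: "unram f Kf uf" and Km: "\<And>n. 0 < n \<Longrightarrow> \<exists>w. unram n (Km n) w"
    and e: "0 < e" "e dvd q ^ f - 1" and L: "subfield L \<Omega>" "K \<subseteq> L"
    and adm: "admissible_choice \<Omega> K v Kf uf e L D \<pi> \<xi>"
  defines "d \<equiv> class_power_order (residue_field (\<Omega>\<lparr>carrier := Kf\<rparr>) uf) e (q - 1) \<xi>"
  shows "\<And>\<alpha>. \<alpha> \<in> carrier \<Omega> \<Longrightarrow> \<alpha> [^] e = twisted_uniformiser \<Omega> Kf uf \<xi> \<pi> \<Longrightarrow>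
      isomorphic_over \<Omega> K L (adjoin \<Omega> Kf \<alpha>)"
    and "\<And>\<alpha>. \<alpha> \<in> carrier \<Omega> \<Longrightarrow> \<alpha> [^] e = twisted_uniformiser \<Omega> Kf uf \<xi> \<pi> \<Longrightarrow>
      galois_closure \<Omega> K L = adjoin \<Omega> (Km (d * f)) \<alpha>"
    and "dimension (d * f * e) K (galois_closure \<Omega> K L)"
proof -
  note Kf = unramD[OF un]
  interpret N: local_field "\<Omega>\<lparr>carrier := Kf\<rparr>" uf by (rule Kf(6))
  define t where "t = teichmuller (\<Omega>\<lparr>carrier := Kf\<rparr>) uf \<xi>"
  have \<xi>: "\<xi> \<in> carrier (mult_of N.k)" using adm by (simp add: admissible_choice_def)
  note T = N.teichmuller_lift[OF \<xi>, folded t_def]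
  have tF: "t \<in> Kf" using T(1) N.vball_carrier by fastforce
  have tc: "t \<in> carrier \<Omega>" using tF Kf(7) by blast
  have t1: "t [^] (q ^ f - 1) = \<one>"
    using fixed_of_root_of_unity(2)[OF tc Kf(4)] T(2,4) unram_Q[OF un] by simp
  have \<pi>: "\<pi> \<in> K" "\<pi> \<noteq> \<zero>" "v \<pi> = 1" using adm by (auto simp: admissible_choice_def uniformiser_def)
  have tw: "twisted_uniformiser \<Omega> Kf uf \<xi> \<pi> = t \<otimes> \<pi>" by (simp add: twisted_uniformiser_def t_def)
  obtain d' where d': "0 < d'" "\<And>i. t [^] ((q - 1) * i * ((q ^ f - 1) div e)) = \<one> \<longleftrightarrow> d' dvd i"
    using exists_twist_order[OF Kf(4) tc t1] by metis
  have c: "q ^ f - 1 = e * ((q ^ f - 1) div e)" using e(2) by simp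
  \<comment> \<open>The order computed with residue classes equals the order computed with the
    Teichmueller lift, because a power of the lift is 1 exactly when its residue is.\<close>
  have dd': "d = d'" unfolding d_def
    by (rule N.class_power_order_teichmuller[OF \<xi>, where c = "(q ^ f - 1) div e"])
      (use c qn_pos[OF Kf(4)] d'(2) unram_Q[OF un] in \<open>simp_all add: t_def[symmetric]\<close>)
  obtain w where w: "unram (d * f) (Km (d * f)) w" using Km[of "d * f"] d'(1) Kf(4) dd' by auto
  have iso: "isomorphic_over \<Omega> K L (adjoin \<Omega> Kf \<alpha>)" if \<alpha>: "\<alpha> \<in> carrier \<Omega>" "\<alpha> [^] e = t \<otimes> \<pi>" for \<alpha>
  proof (rule isomorphic_over_sym)
    show "subfield (adjoin \<Omega> Kf \<alpha>) \<Omega>" using adjoin_subfield[OF Kf(1) \<alpha>(1)] .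
    show "K \<subseteq> adjoin \<Omega> Kf \<alpha>" using Kf(2) adjoin_incl(1)[where K = Kf and a = \<alpha>] by blast
    show "isomorphic_over \<Omega> K (adjoin \<Omega> Kf \<alpha>) L"
      using represents_orbit_isomorphic[OF un tc t1 \<pi> \<alpha> e(1)] adm tw by (auto simp: admissible_choice_def)
  qed
  have tt: "tame_tower \<Omega> K v f e d Kf (Km (d * f)) uf w t \<pi> \<alpha>" if "\<alpha> \<in> carrier \<Omega>" "\<alpha> [^] e = t \<otimes> \<pi>" for \<alpha>
    by (rule tame_towerI[OF un w e tc t1 \<pi> that]) (use d'(2) dd' in simp)
  note gc = tame_tower.galois_closure_eq[OF tt L iso]
  show "isomorphic_over \<Omega> K L (adjoin \<Omega> Kf \<alpha>)"
    if "\<alpha> \<in> carrier \<Omega>" "\<alpha> [^] e = twisted_uniformiser \<Omega> Kf uf \<xi> \<pi>" for \<alpha> using iso that tw by simp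
  show "galois_closure \<Omega> K L = adjoin \<Omega> (Km (d * f)) \<alpha>"
    if "\<alpha> \<in> carrier \<Omega>" "\<alpha> [^] e = twisted_uniformiser \<Omega> Kf uf \<xi> \<pi>" for \<alpha> using gc that tw by simp
  obtain \<alpha> where \<alpha>: "\<alpha> \<in> carrier \<Omega>" "\<alpha> [^] e = t \<otimes> \<pi>"
    using exists_root[OF e(1), of "t \<otimes> \<pi>"] tc K_carrier[OF \<pi>(1)] by auto
  show "dimension (d * f * e) K (galois_closure \<Omega> K L)"
    using tame_tower.M_dimension[OF tt[OF \<alpha>]] gc[OF \<alpha> \<alpha>] by simp
qed

lemma class_power_order_unique:
  assumes "unram f Kf uf" "\<And>n. 0 < n \<Longrightarrow> \<exists>w. unram n (Km n) w"
    and "0 < e" "e dvd q ^ f - 1" "subfield L \<Omega>" "K \<subseteq> L"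
    and "admissible_choice \<Omega> K v Kf uf e L D \<pi> \<xi>" "admissible_choice \<Omega> K v Kf uf e L D' \<pi>' \<xi>'"
  shows "class_power_order (residue_field (\<Omega>\<lparr>carrier := Kf\<rparr>) uf) e (q - 1) \<xi>' =
    class_power_order (residue_field (\<Omega>\<lparr>carrier := Kf\<rparr>) uf) e (q - 1) \<xi>"
  using dimension_is_inj[OF K admissible_choice_galois_closure(3)[OF assms(1-6,8)]
      admissible_choice_galois_closure(3)[OF assms(1-7)]] assms(3) unramD(4)[OF assms(1)]
  by simp

text \<open>The claim on ramification stands outside the quantifier over admissible choices, so it
  is derived from an explicit presentation K_f(\<alpha>) and not from a line.\<close>

lemma galois_closure_ramification:
  assumes un: "unram f Kf uf" and Km: "\<And>n. 0 < n \<Longrightarrow> \<exists>w. unram n (Km n) w"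
    and e: "0 < e" "e dvd q ^ f - 1" and \<xi>: "\<xi> \<in> carrier \<Omega>" "\<xi> [^] (q ^ f - 1) = \<one>"
    and \<pi>: "\<pi> \<in> K" "\<pi> \<noteq> \<zero>" "v \<pi> = 1" and \<alpha>: "\<alpha> \<in> carrier \<Omega>" "\<alpha> [^] e = \<xi> \<otimes> \<pi>"
  shows "has_ramification_index \<Omega> K v (galois_closure \<Omega> K (adjoin \<Omega> Kf \<alpha>)) e"
proof -
  note Kf = unramD[OF un]
  obtain d where d: "0 < d" "\<And>i. \<xi> [^] ((q - 1) * i * ((q ^ f - 1) div e)) = \<one> \<longleftrightarrow> d dvd i"
    using exists_twist_order[OF Kf(4) \<xi>] by metis
  obtain w where w: "unram (d * f) (Km (d * f)) w" using Km[of "d * f"] d(1) Kf(4) by auto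
  interpret T: tame_tower \<Omega> K v f e d Kf "Km (d * f)" uf w \<xi> \<pi> \<alpha>
    by (rule tame_towerI[OF un w e \<xi> \<pi> \<alpha> d(2)])
  have "subfield (adjoin \<Omega> Kf \<alpha>) \<Omega>" "K \<subseteq> adjoin \<Omega> Kf \<alpha>"
    using adjoin_subfield[OF Kf(1) \<alpha>(1)] adjoin_incl(1)[where K = Kf and a = \<alpha>] Kf(2) by auto
  moreover have "isomorphic_over \<Omega> K (adjoin \<Omega> Kf \<alpha>) (adjoin \<Omega> Kf \<alpha>)"
    unfolding isomorphic_over_def by (rule bexI[of _ "\<lambda>x. x"]) (auto simp: ring_iso_def ring_hom_def bij_betw_def)
  ultimately show ?thesis using T.galois_closure_eq T.M_ramification by simp
qed

end

theorem mainTheorem12: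
  fixes \<Omega> :: "('a, 'b) ring_scheme"
    and K L :: "'a set" and Km :: "nat \<Rightarrow> 'a set"
    and v vf vL :: "'a \<Rightarrow> int"
    and p q e f :: nat
  assumes "algebraic_closure \<Omega> K"
    and "local_field (\<Omega>\<lparr>carrier := K\<rparr>) v"
    and "p = residue_char (\<Omega>\<lparr>carrier := K\<rparr>) v"
    and "q = card (carrier (residue_field (\<Omega>\<lparr>carrier := K\<rparr>) v))"
    and "0 < e" and "\<not> p dvd e" and "0 < f"
    and "\<And>m. 0 < m \<Longrightarrow> unramified_extension \<Omega> K v m (Km m)"
    and "valuation_extends \<Omega> K v (Km f) vf 1"
    and "finite_subextension \<Omega> K L" and "separable_subextension \<Omega> K L"
    and "valuation_extends \<Omega> K v L vL e"
    and "has_residual_degree \<Omega> K v L vL f"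
  shows
    "Km f \<subseteq> L \<and>
     Km (ord e (q ^ f) * f) \<subseteq> galois_closure \<Omega> K L \<and>
     ([q ^ f = 1] (mod e) \<longrightarrow>
       (let kf = residue_field (\<Omega>\<lparr>carrier := Km f\<rparr>) vf in
         (\<forall>D \<pi> \<xi>. admissible_choice \<Omega> K v (Km f) vf e L D \<pi> \<xi> \<longrightarrow>
           (\<forall>D' \<pi>' \<xi>'. admissible_choice \<Omega> K v (Km f) vf e L D' \<pi>' \<xi>' \<longrightarrow>
              class_power_order kf e (q - 1) \<xi>' = class_power_order kf e (q - 1) \<xi>) \<and>
           (\<forall>\<alpha>\<in>carrier \<Omega>. \<alpha> [^]\<^bsub>\<Omega>\<^esub> e = twisted_uniformiser \<Omega> (Km f) vf \<xi> \<pi> \<longrightarrow>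
              isomorphic_over \<Omega> K L (adjoin \<Omega> (Km f) \<alpha>) \<and>
              galois_closure \<Omega> K L =
                adjoin \<Omega> (Km (class_power_order kf e (q - 1) \<xi> * f)) \<alpha>)) \<and>
         has_ramification_index \<Omega> K v (galois_closure \<Omega> K L) e))"
proof -
  interpret C: local_closure \<Omega> K v
    using assms(1,2) by (intro local_closure.intro local_closure_axioms.intro) (auto simp: algebraic_closure_def)
  have q: "q = C.q" using assms(4) by (simp add: C.Kl.Q_def)
  have cop: "coprime e C.q" using C.Kl.coprime_residue_char assms(3,6) by simp
  have Km: "\<exists>w. C.unram n (Km n) w" if "0 < n" for n
    using assms(8)[OF that] C.unramI by (auto simp: unramified_extension_def has_ramification_index_def)
  have un: "C.unram f (Km f) vf"
    using assms(8)[OF assms(7)] C.unramI[OF _ _ assms(9)]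
    by (auto simp: unramified_extension_def has_ramification_index_def)
  have L: "subfield L \<Omega>" "K \<subseteq> L" using assms(10) by (auto simp: finite_subextension_def)
  \<comment> \<open>Any uniformiser of \<open>K\<close> gives a presentation of \<open>L\<close>. It
    serves the inclusions and the ramification index, and it is unrelated to the quantified choices
    of \<open>\<pi>\<close> and \<open>\<xi>\<close>.\<close>
  obtain \<pi> where \<pi>: "\<pi> \<in> K" "\<pi> \<noteq> \<zero>\<^bsub>\<Omega>\<^esub>" "v \<pi> = 1" using C.Kl.exists_uniformiser by auto
  note ts = C.tame_structure[OF assms(10,12,13,5) cop un \<pi>]
  obtain \<xi> \<alpha> where \<xi>: "\<xi> \<in> carrier \<Omega>" "\<xi> [^]\<^bsub>\<Omega>\<^esub> (C.q ^ f - 1) = \<one>\<^bsub>\<Omega>\<^esub>"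
    and \<alpha>: "\<alpha> \<in> carrier \<Omega>" "\<alpha> [^]\<^bsub>\<Omega>\<^esub> e = \<xi> \<otimes>\<^bsub>\<Omega>\<^esub> \<pi>" and Leq: "L = adjoin \<Omega> (Km f) \<alpha>"
    using ts(2) by blast
  have "0 < ord e (C.q ^ f)" using cop by (simp add: ord_eq_0)
  then obtain w where w: "C.unram (ord e (C.q ^ f) * f) (Km (ord e (C.q ^ f) * f)) w"
    using Km[of "ord e (C.q ^ f) * f"] assms(7) by auto
  have "Km (ord e (C.q ^ f) * f) \<subseteq> galois_closure \<Omega> K L"
    unfolding galois_closure_def
    using C.roots_of_unity_in_normal[OF un w refl \<xi> \<pi> \<alpha> assms(5) cop]
    by (auto simp: galois_subextension_def Leq[symmetric])
  moreover have edvd: "e dvd C.q ^ f - 1" if "[C.q ^ f = 1] (mod e)"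
    using cong_to_1_nat[OF that] .
  ultimately show ?thesis
  proof (intro conjI impI ts(1))
    assume "[q ^ f = 1] (mod e)"
    then have e: "e dvd C.q ^ f - 1" using edvd q by simp
    note gc = C.admissible_choice_galois_closure(1,2)[OF un Km assms(5) e L]
      and unique = C.class_power_order_unique[OF un Km assms(5) e L]
    show "let kf = residue_field (\<Omega>\<lparr>carrier := Km f\<rparr>) vf in
         (\<forall>D \<pi> \<xi>. admissible_choice \<Omega> K v (Km f) vf e L D \<pi> \<xi> \<longrightarrow>
           (\<forall>D' \<pi>' \<xi>'. admissible_choice \<Omega> K v (Km f) vf e L D' \<pi>' \<xi>' \<longrightarrow>
              class_power_order kf e (q - 1) \<xi>' = class_power_order kf e (q - 1) \<xi>) \<and>
           (\<forall>\<alpha>\<in>carrier \<Omega>. \<alpha> [^]\<^bsub>\<Omega>\<^esub> e = twisted_uniformiser \<Omega> (Km f) vf \<xi> \<pi> \<longrightarrow>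
              isomorphic_over \<Omega> K L (adjoin \<Omega> (Km f) \<alpha>) \<and>
              galois_closure \<Omega> K L =
                adjoin \<Omega> (Km (class_power_order kf e (q - 1) \<xi> * f)) \<alpha>)) \<and>
         has_ramification_index \<Omega> K v (galois_closure \<Omega> K L) e"
      unfolding Let_def q
    proof (intro conjI allI impI ballI)
      show "has_ramification_index \<Omega> K v (galois_closure \<Omega> K L) e"
        using C.galois_closure_ramification[OF un Km assms(5) e \<xi> \<pi> \<alpha>] Leq by simp
    qed (rule unique gc; assumption)+
  qed (simp add: q)
qed

end
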